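(* Let $G$ be a Cameron-Walker graph. Then for every positive integer $s$ with $s\leq \mathrm{match}(G)$, we have $$\mathrm{reg}\big(I(G)^{[s]}\big)=\mathrm{match}(G)+s.$$
   Context: Let $\mathbb{K}$ be a field and $S=\mathbb{K}[x_1,\ldots,x_n]$ the standard graded polynomial ring. Graphs are finite and simple. For a graph $G$ with vertex set $V(G)=\{x_1,\ldots,x_n\}$ (vertices are identified with variables of $S$), the edge ideal is $I(G)=(x_ix_j : x_ix_j\in E(G))\subseteq S$. A matching is a set of pairwise disjoint edges, and $\mathrm{match}(G)$ is the maximum size of a matching of $G$. A matching $M$ is an induced matching if for every pair of edges $e,e'\in M$ there is no edge $f\in E(G)\setminus M$ with $f\subset e\cup e'$; the induced matching number of $G$ is the maximum size of an induced matching of $G$. A graph is a Cameron-Walker graph if its matching number equals its induced matching number. For a squarefree monomial ideal $I$, the $s$-th squarefree power $I^{[s]}$ is the ideal generated by the squarefree monomials belonging to $I^s$; thus $I(G)^{[s]}$ is generated by the products $e_1\cdots e_s$ with $\{e_1,\ldots,e_s\}$ a matching of $G$. For a finitely generated graded $S$-module $M$ with graded Betti numbers $\beta_{i,j}(M)$, the Castelnuovo--Mumford regularity is $\mathrm{reg}(M)=\max\{j-i : \beta_{i,j}(M)\neq 0\}$. *)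

theory Defs
  imports Complex_Main "HOL-Library.Poly_Mapping"
begin

text \<open>Graphs on the vertex set \<open>UNIV :: 'v set\<close>, given by their edge sets.\<close>

definition simple_graph :: "'v set set \<Rightarrow> bool" where
  "simple_graph E \<longleftrightarrow> (\<forall>e\<in>E. card e = 2)"

definition matching :: "'v set set \<Rightarrow> 'v set set \<Rightarrow> bool" where
  "matching E M \<longleftrightarrow> M \<subseteq> E \<and> pairwise disjnt M"

definition induced_matching :: "'v set set \<Rightarrow> 'v set set \<Rightarrow> bool" where
  "induced_matching E M \<longleftrightarrow>
     matching E M \<and> (\<forall>e\<in>M. \<forall>e'\<in>M. \<not> (\<exists>f\<in>E - M. f \<subseteq> e \<union> e'))"

definition matching_number :: "'v::finite set set \<Rightarrow> nat" where
  "matching_number E = Max (card ` {M. matching E M})"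

definition induced_matching_number :: "'v::finite set set \<Rightarrow> nat" where
  "induced_matching_number E = Max (card ` {M. induced_matching E M})"

definition cameron_walker :: "'v::finite set set \<Rightarrow> bool" where
  "cameron_walker E \<longleftrightarrow> matching_number E = induced_matching_number E"


text \<open>The polynomial ring in the variables \<open>UNIV :: 'v set\<close>: finitely supported functions
  from exponent vectors to coefficients, with the convolution product.\<close>

type_synonym ('v, 'k) mpoly = "('v \<Rightarrow>\<^sub>0 nat) \<Rightarrow>\<^sub>0 'k"

definition monomial :: "('v \<Rightarrow>\<^sub>0 nat) \<Rightarrow> ('v, 'k::field) mpoly" where
  "monomial u = Poly_Mapping.single u 1"

definition var :: "'v \<Rightarrow> ('v, 'k::field) mpoly" where
  "var v = monomial (Poly_Mapping.single v 1)"

definition mdeg :: "('v::finite \<Rightarrow>\<^sub>0 nat) \<Rightarrow> nat" where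
  "mdeg u = (\<Sum>v\<in>UNIV. Poly_Mapping.lookup u v)"

text \<open>Degrees are integers; only the zero polynomial is homogeneous of negative degree.\<close>

definition homogeneous :: "int \<Rightarrow> ('v::finite, 'k::field) mpoly \<Rightarrow> bool" where
  "homogeneous d f \<longleftrightarrow> (\<forall>u\<in>Poly_Mapping.keys f. int (mdeg u) = d)"

definition squarefree_exponent :: "('v \<Rightarrow>\<^sub>0 nat) \<Rightarrow> bool" where
  "squarefree_exponent u \<longleftrightarrow> (\<forall>v. Poly_Mapping.lookup u v \<le> 1)"

definition ideal_gen :: "'a::comm_ring_1 set \<Rightarrow> 'a set" where
  "ideal_gen A = module.span (*) A"

primrec ideal_power :: "'a::comm_ring_1 set \<Rightarrow> nat \<Rightarrow> 'a set" where
  "ideal_power I 0 = UNIV"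
| "ideal_power I (Suc s) = ideal_gen {a * b | a b. a \<in> I \<and> b \<in> ideal_power I s}"

definition squarefree_power :: "('v, 'k::field) mpoly set \<Rightarrow> nat \<Rightarrow> ('v, 'k) mpoly set" where
  "squarefree_power I s =
     ideal_gen {monomial u | u. squarefree_exponent u \<and> monomial u \<in> ideal_power I s}"

definition edge_ideal :: "'v set set \<Rightarrow> ('v, 'k::field) mpoly set" where
  "edge_ideal E = ideal_gen {var u * var v | u v. {u, v} \<in> E}"


text \<open>A graded complex of finitely generated free modules augmented to a module of type \<open>'b\<close>.
  Over a ring \<open>S\<close> of type \<open>'r\<close>, the free module in homological degree \<open>i\<close> has basis \<open>e\<^sub>0, \<dots>, e\<^sub>r\<^sub>-\<^sub>1\<close> with
  \<open>r = basis_size F i\<close>, the vector \<open>e\<^sub>k\<close> having degree \<open>basis_deg F i k\<close>; so it is the direct sum of the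
  \<open>S(- basis_deg F i k)\<close>.  The differential from homological degree \<open>Suc i\<close> to \<open>i\<close> sends \<open>e\<^sub>k\<close> to
  \<open>\<Sum>l<basis_size F i. diff_mat F i k l * e\<^sub>l\<close>, and the augmentation sends the basis vector \<open>e\<^sub>k\<close> in
  homological degree 0 to \<open>aug F k\<close>.\<close>

record ('r, 'b) free_complex =
  basis_size :: "nat \<Rightarrow> nat"
  basis_deg :: "nat \<Rightarrow> nat \<Rightarrow> int"
  diff_mat :: "nat \<Rightarrow> nat \<Rightarrow> nat \<Rightarrow> 'r"
  aug :: "nat \<Rightarrow> 'b"

definition free_module :: "('r::comm_ring_1, 'b) free_complex \<Rightarrow> nat \<Rightarrow> (nat \<Rightarrow> 'r) set" where
  "free_module F i = {f. \<forall>k\<ge>basis_size F i. f k = 0}"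

definition diff_map ::
  "('r::comm_ring_1, 'b) free_complex \<Rightarrow> nat \<Rightarrow> (nat \<Rightarrow> 'r) \<Rightarrow> (nat \<Rightarrow> 'r)" where
  "diff_map F i f =
     (\<lambda>l. if l < basis_size F i then \<Sum>k<basis_size F (Suc i). f k * diff_mat F i k l else 0)"

definition aug_map ::
  "('r::comm_ring_1 \<Rightarrow> 'b::ab_group_add \<Rightarrow> 'b) \<Rightarrow> ('r, 'b) free_complex \<Rightarrow> (nat \<Rightarrow> 'r) \<Rightarrow> 'b" where
  "aug_map scale F f = (\<Sum>k<basis_size F 0. scale (f k) (aug F k))"

text \<open>In the following, a finitely generated graded module is given by its scalar multiplication
  \<open>scale\<close>, its carrier \<open>M\<close> and its graded components \<open>gr j\<close>.\<close>

definition graded_free_resolution ::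
  "(('v::finite, 'k::field) mpoly \<Rightarrow> 'b::ab_group_add \<Rightarrow> 'b) \<Rightarrow> 'b set \<Rightarrow> (int \<Rightarrow> 'b set)
     \<Rightarrow> (('v, 'k) mpoly, 'b) free_complex \<Rightarrow> bool" where
  "graded_free_resolution scale M gr F \<longleftrightarrow>
     (\<forall>k<basis_size F 0. aug F k \<in> gr (basis_deg F 0 k)) \<and>
     (\<forall>i. \<forall>k<basis_size F (Suc i). \<forall>l<basis_size F i.
        homogeneous (basis_deg F (Suc i) k - basis_deg F i l) (diff_mat F i k l)) \<and>
     aug_map scale F ` free_module F 0 = M \<and>
     diff_map F 0 ` free_module F 1 = {f \<in> free_module F 0. aug_map scale F f = 0} \<and>
     (\<forall>i. diff_map F (Suc i) ` free_module F (Suc (Suc i)) =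
        {f \<in> free_module F (Suc i). diff_map F i f = (\<lambda>_. 0)})"

definition minimal_graded_free_resolution ::
  "(('v::finite, 'k::field) mpoly \<Rightarrow> 'b::ab_group_add \<Rightarrow> 'b) \<Rightarrow> 'b set \<Rightarrow> (int \<Rightarrow> 'b set)
     \<Rightarrow> (('v, 'k) mpoly, 'b) free_complex \<Rightarrow> bool" where
  "minimal_graded_free_resolution scale M gr F \<longleftrightarrow>
     graded_free_resolution scale M gr F \<and>
     (\<forall>i. \<forall>k<basis_size F (Suc i). \<forall>l<basis_size F i. diff_mat F i k l \<in> ideal_gen (range var))"

text \<open>The minimal graded free resolution is unique up to isomorphism, so the choice made here is
  immaterial.\<close>

definition graded_betti ::
  "(('v::finite, 'k::field) mpoly \<Rightarrow> 'b::ab_group_add \<Rightarrow> 'b) \<Rightarrow> 'b set \<Rightarrow> (int \<Rightarrow> 'b set)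
     \<Rightarrow> nat \<Rightarrow> int \<Rightarrow> nat" where
  "graded_betti scale M gr i j =
     (let F = (SOME F. minimal_graded_free_resolution scale M gr F)
      in card {k. k < basis_size F i \<and> basis_deg F i k = j})"

definition regularity ::
  "(('v::finite, 'k::field) mpoly \<Rightarrow> 'b::ab_group_add \<Rightarrow> 'b) \<Rightarrow> 'b set \<Rightarrow> (int \<Rightarrow> 'b set) \<Rightarrow> int" where
  "regularity scale M gr = Max {j - int i | i j. graded_betti scale M gr i j \<noteq> 0}"

text \<open>A homogeneous ideal as a graded module, with the grading inherited from the polynomial ring.\<close>

definition ideal_regularity :: "('v::finite, 'k::field) mpoly set \<Rightarrow> int" where
  "ideal_regularity I = regularity (*) I (\<lambda>j. {f \<in> I. homogeneous j f})"

end

theory Submission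
  imports Defs "HOL-Library.Function_Algebras"
begin

text \<open>For a graded module \<open>M\<close> and a presentation \<open>0 \<rightarrow> K \<rightarrow> F \<rightarrow> M \<rightarrow> 0\<close> with \<open>F\<close> free and
  \<open>K \<subseteq> (x\<^sub>1, \<dots>, x\<^sub>n) F\<close>, the Koszul homology of \<open>K\<close> is that of \<open>M\<close> shifted by one, and that of \<open>M\<close> in
  homological degree 0 shows the degrees of the basis of \<open>F\<close>. So graded Betti numbers are
  read off Koszul homology, without comparing resolutions. Since Koszul homology of a squarefree
  monomial ideal vanishes in degrees above the number of variables, all syzygy modules
  are finitely generated, which gives existence of the minimal resolution.

  In multidegree \<open>a\<close>, Koszul homology of a monomial ideal is the cohomology of a family of subsets of
  the support \<open>A\<close> of \<open>a\<close>. It vanishes unless \<open>a\<close> is squarefree, and then the family consists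
  of the subsets of \<open>A\<close> that contain a matching of size \<open>s\<close>, a set of size \<open>b\<close> contributing to homological
  degree \<open>card A - b\<close>. So the regularity is the largest \<open>b\<close> for which the cohomology in size \<open>b\<close> does
  not vanish for some \<open>A\<close>.

  Let \<open>M\<close> be an induced matching of maximum size \<open>m\<close>. Since there are no augmenting paths, every edge of \<open>M\<close>
  either has an endpoint without neighbours outside of \<open>M\<close> or lies in a triangle whose third vertex
  is the only outside neighbour of both endpoints. Fixing the trace of a set on suitable vertices of
  \<open>M\<close>, the rest of \<open>A\<close> is independent and the condition becomes that of having a given rank in a
  transversal matroid; such families have cohomology in a single size. This gives vanishing for
  \<open>b > m + s\<close>. For \<open>A = \<Union>M\<close> there is an explicit nonzero class with \<open>b = m + s\<close>.\<close>

section \<open>Cochains on families of finite sets\<close>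

text \<open>The constant m + s comes from a count. In a squarefree multidegree with support
  \<open>A\<close> the total degree is \<open>card A\<close>, so a set of size b, sitting in
  homological degree \<open>card A - b\<close>, contributes exactly b to the regularity. Once the
  trace \<open>Z\<close> is fixed, every edge of \<open>M\<close> puts at most one vertex into
  \<open>Z\<close>, except that a triangle edge may put in both: each of its endpoints is adjacent
  to the third vertex, which stays outside of the trace, so neither endpoint can be left out. Such a
  full edge can, however, always be used in the matching, so it lowers by one the rank still
  demanded from the matroid, and the bound m + s survives. With more than \<open>s\<close> full
  triangle edges the family is a cone instead.

  The Betti numbers refer to an arbitrarily chosen minimal resolution, but the regularity only asks
  which of them are nonzero. Nonvanishing of Koszul homology decides this for every minimal
  resolution at once. The signs are kept abstract because passing from the indices of Koszul basis
  elements to their complements changes them.\<close>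

definition sign_function :: "('v \<Rightarrow> 'v set \<Rightarrow> 'k::field) \<Rightarrow> bool" where
  "sign_function sg \<longleftrightarrow> (\<forall>v B. sg v B * sg v B = 1) \<and>
     (\<forall>v w B. v \<in> B \<longrightarrow> w \<in> B \<longrightarrow> v \<noteq> w \<longrightarrow>
        sg v (B - {w}) * sg w B = - (sg w (B - {v}) * sg v B))"

lemma sign_function_sq: "sign_function sg \<Longrightarrow> sg v B * sg v B = 1"
  by (simp add: sign_function_def)

lemma sign_function_swap:
  "sign_function sg \<Longrightarrow> v \<in> B \<Longrightarrow> w \<in> B \<Longrightarrow> v \<noteq> w \<Longrightarrow>
    sg v (B - {w}) * sg w B = - (sg w (B - {v}) * sg v B)"
  unfolding sign_function_def by (elim conjE allE impE) assumption+

definition coboundary :: "('v \<Rightarrow> 'v set \<Rightarrow> 'k::field) \<Rightarrow> ('v set \<Rightarrow> 'k) \<Rightarrow> 'v set \<Rightarrow> 'k" where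
  "coboundary sg c B = (\<Sum>v\<in>B. sg v B * c (B - {v}))"

definition cochain :: "'v set set \<Rightarrow> nat \<Rightarrow> ('v set \<Rightarrow> 'k::field) \<Rightarrow> bool" where
  "cochain F b c \<longleftrightarrow> (\<forall>B. c B \<noteq> 0 \<longrightarrow> B \<in> F \<and> card B = b)"

text \<open>The degree \<open>b\<close> of a cochain is the cardinality of the sets it lives on, and coboundaries are
  only evaluated on members of the family. Degree \<open>b - 1\<close> is expressed as \<open>Suc b' = b\<close>, so that
  in degree 0 there is nothing to bound.\<close>

definition acyclic_at :: "('v \<Rightarrow> 'v set \<Rightarrow> 'k::field) \<Rightarrow> 'v set set \<Rightarrow> nat \<Rightarrow> bool" where
  "acyclic_at sg F b \<longleftrightarrow>
     (\<forall>c. cochain F b c \<longrightarrow> (\<forall>B\<in>F. card B = Suc b \<longrightarrow> coboundary sg c B = 0) \<longrightarrow>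
        (\<exists>c'. (\<forall>B. c' B \<noteq> 0 \<longrightarrow> B \<in> F \<and> Suc (card B) = b) \<and>
              (\<forall>B\<in>F. card B = b \<longrightarrow> c B = coboundary sg c' B)))"

definition convex_family :: "'v set set \<Rightarrow> bool" where
  "convex_family F \<longleftrightarrow> (\<forall>A B C. A \<in> F \<longrightarrow> C \<in> F \<longrightarrow> A \<subseteq> B \<longrightarrow> B \<subseteq> C \<longrightarrow> B \<in> F)"

text \<open>The sign is -1 to the number of elements of \<open>B\<close> before \<open>v\<close> in
  a fixed enumeration. Deleting the later of two elements leaves the count of the earlier one alone,
  while deleting the earlier one lowers the other count by one; hence the anticommutation. The
  second property holds because the elements before \<open>v\<close> in \<open>A\<close> split into
  those in \<open>B\<close> and those in \<open>A - B\<close>.\<close>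

lemma sign_function_exists:
  "\<exists>sg :: 'v::finite \<Rightarrow> 'v set \<Rightarrow> 'k::field. sign_function sg \<and>
     (\<forall>A B v. B \<subseteq> A \<longrightarrow> sg v (insert v (A - B)) = sg v A * sg v B)"
proof -
  obtain ix :: "'v \<Rightarrow> nat" where ix: "inj ix"
    using finite_imp_inj_to_nat_seg[of "UNIV :: 'v set"] by auto
  define n where "n v B = card {w\<in>B. ix w < ix v}" for v B
  define sg :: "'v \<Rightarrow> 'v set \<Rightarrow> 'k" where "sg v B = (-1) ^ n v B" for v B
  have sq: "sg v B * sg v B = 1" for v B
    by (simp add: sg_def flip: power_mult_distrib)
  have *: "sg v (B - {w}) * sg w B = - (sg w (B - {v}) * sg v B)"
    if "v \<in> B" "w \<in> B" "ix v < ix w" for v w B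
  proof -
    have "{x\<in>B. ix x < ix v} = {x\<in>B - {w}. ix x < ix v}" using that by auto
    then have 1: "n v (B - {w}) = n v B" by (simp add: n_def)
    have "{x\<in>B. ix x < ix w} = insert v {x\<in>B - {v}. ix x < ix w}" using that by auto
    then have 2: "n w B = Suc (n w (B - {v}))" by (simp add: n_def)
    show ?thesis by (simp add: sg_def 1 2)
  qed
  have "sg v (B - {w}) * sg w B = - (sg w (B - {v}) * sg v B)"
    if "v \<in> B" "w \<in> B" "v \<noteq> w" for v w B
  proof -
    have "ix v \<noteq> ix w" using that ix by (auto dest: injD)
    then consider "ix v < ix w" | "ix w < ix v" by linarith
    then show ?thesis
    proof cases
      case 2
      show ?thesis using *[OF that(2,1) 2] by simp
    qed (use * that in auto)
  qed
  then have "sign_function sg" using sq unfolding sign_function_def by blast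
  moreover have "sg v (insert v (A - B)) = sg v A * sg v B" if "B \<subseteq> A" for A B v
  proof -
    have "{x\<in>insert v (A - B). ix x < ix v} = {x\<in>A - B. ix x < ix v}" by auto
    then have 1: "n v (insert v (A - B)) = n v (A - B)" by (simp add: n_def)
    have "{x\<in>A. ix x < ix v} = {x\<in>A - B. ix x < ix v} \<union> {x\<in>B. ix x < ix v}" using that by auto
    then have "n v A = n v (A - B) + n v B"
      by (simp add: n_def) (subst card_Un_disjoint, auto)
    then show ?thesis using sq[of v B] by (simp add: sg_def 1 power_add)
  qed
  ultimately show ?thesis by blast
qed

lemma coboundary_cong:
  "(\<And>v. v \<in> B \<Longrightarrow> c (B - {v}) = c' (B - {v})) \<Longrightarrow> coboundary sg c B = coboundary sg c' B"
  by (simp add: coboundary_def)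

lemma coboundary_diff:
  "coboundary sg (\<lambda>B. c B - c' B) B = coboundary sg c B - coboundary sg c' B"
  by (simp add: coboundary_def algebra_simps sum_subtractf)

lemma coboundary_add:
  "coboundary sg (\<lambda>B. c B + c' B) B = coboundary sg c B + coboundary sg c' B"
  by (simp add: coboundary_def algebra_simps sum.distrib)

text \<open>The terms cancel in pairs. Induction removes one such family of pairs at a time;
  comparing the sum with its own negative would prove nothing in characteristic 2.\<close>

lemma sum_antisymmetric_pairs:
  fixes f :: "'a \<Rightarrow> 'a \<Rightarrow> 'b::ab_group_add"
  assumes "finite B" and "\<And>v w. v \<in> B \<Longrightarrow> w \<in> B \<Longrightarrow> v \<noteq> w \<Longrightarrow> f v w = - f w v"
  shows "(\<Sum>v\<in>B. \<Sum>w\<in>B - {v}. f v w) = 0"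
  using assms
proof (induction B rule: finite_induct)
  case (insert x B)
  have "(\<Sum>v\<in>insert x B. \<Sum>w\<in>insert x B - {v}. f v w) =
      (\<Sum>w\<in>B. f x w) + (\<Sum>v\<in>B. \<Sum>w\<in>insert x B - {v}. f v w)"
    using insert.hyps by simp
  also have "(\<Sum>v\<in>B. \<Sum>w\<in>insert x B - {v}. f v w) = (\<Sum>v\<in>B. f v x + (\<Sum>w\<in>B - {v}. f v w))"
  proof (rule sum.cong[OF refl])
    fix v assume "v \<in> B"
    then have "insert x B - {v} = insert x (B - {v})" "x \<notin> B - {v}" using insert.hyps by auto
    then show "(\<Sum>w\<in>insert x B - {v}. f v w) = f v x + (\<Sum>w\<in>B - {v}. f v w)"
      using insert.hyps by simp
  qed
  also have "\<dots> = (\<Sum>v\<in>B. f v x)"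
    unfolding sum.distrib using insert.IH[OF insert.prems] by simp
  also have "\<dots> = (\<Sum>v\<in>B. - f x v)"
    using insert.prems insert.hyps by (intro sum.cong refl) blast
  finally show ?case by (simp add: sum_negf)
qed simp

lemma coboundary_coboundary:
  assumes sg: "sign_function sg" and "finite B"
  shows "coboundary sg (coboundary sg c) B = 0"
proof -
  have "coboundary sg (coboundary sg c) B =
      (\<Sum>v\<in>B. \<Sum>w\<in>B - {v}. sg v B * sg w (B - {v}) * c (B - {v} - {w}))"
    by (simp add: coboundary_def sum_distrib_left mult.assoc)
  also have "\<dots> = 0"
  proof (rule sum_antisymmetric_pairs[OF \<open>finite B\<close>])
    fix v w assume "v \<in> B" "w \<in> B" "v \<noteq> w"
    then have "sg v (B - {w}) * sg w B = - (sg w (B - {v}) * sg v B)"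
      by (rule sign_function_swap[OF sg])
    moreover have "B - {w} - {v} = B - {v} - {w}" by auto
    ultimately show "sg v B * sg w (B - {v}) * c (B - {v} - {w}) =
        - (sg w B * sg v (B - {w}) * c (B - {w} - {v}))"
      by (simp add: mult.commute)
  qed
  finally show ?thesis .
qed

text \<open>A nonzero term \<open>c (B - {v} - {w})\<close> places a member of \<open>F\<close>
  below \<open>B - {v}\<close>, and \<open>B\<close> lies above it, so convexity puts
  \<open>B - {v}\<close> into \<open>F\<close>. The truncation thus drops only zero terms. This is
  why all families are required to be convex.\<close>

lemma coboundary_truncated:
  assumes sg: "sign_function sg" and "convex_family F" and "B \<in> F" and "finite B"
    and supp: "\<And>B. c B \<noteq> 0 \<Longrightarrow> B \<in> F"
  shows "coboundary sg (\<lambda>B. if B \<in> F then coboundary sg c B else 0) B = 0"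
proof -
  have "(if B - {v} \<in> F then coboundary sg c (B - {v}) else 0) = coboundary sg c (B - {v})"
    if "v \<in> B" for v
  proof (cases "B - {v} \<in> F")
    case False
    have "c (B - {v} - {w}) = 0" if "w \<in> B - {v}" for w
    proof (rule ccontr)
      assume "c (B - {v} - {w}) \<noteq> 0"
      then have "B - {v} - {w} \<in> F" by (rule supp)
      then show False
        using False \<open>B \<in> F\<close> \<open>convex_family F\<close> unfolding convex_family_def
        by (metis Diff_subset)
    qed
    then show ?thesis by (simp add: coboundary_def)
  qed simp
  then have "coboundary sg (\<lambda>B. if B \<in> F then coboundary sg c B else 0) B =
      coboundary sg (coboundary sg c) B"
    by (intro coboundary_cong) simp
  then show ?thesis using coboundary_coboundary[OF sg \<open>finite B\<close>] by simp
qed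

text \<open>Pairing \<open>B\<close> with \<open>insert v B\<close> gives the contracting homotopy
  \<open>c'\<close>. On sets containing \<open>v\<close> only the term that removes \<open>v\<close>
  survives; on the other sets the cocycle condition at \<open>D = insert v B\<close> is solved for
  \<open>c B\<close>.\<close>

lemma acyclic_at_cone:
  fixes sg :: "'v::finite \<Rightarrow> 'v set \<Rightarrow> 'k::field"
  assumes sg: "sign_function sg"
    and add: "\<And>B. B \<in> F \<Longrightarrow> insert v B \<in> F" and del: "\<And>B. B \<in> F \<Longrightarrow> B - {v} \<in> F"
  shows "acyclic_at sg F b"
  unfolding acyclic_at_def
proof (intro allI impI)
  fix c assume c: "cochain F b c"
    and cocycle: "\<forall>B\<in>F. card B = Suc b \<longrightarrow> coboundary sg c B = 0"
  define c' where "c' B = (if v \<in> B then 0 else sg v (insert v B) * c (insert v B))" for B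
  have sq: "sg x B * sg x B = 1" for x B using sg by (simp add: sign_function_def)
  have "B \<in> F \<and> Suc (card B) = b" if "c' B \<noteq> 0" for B
  proof -
    have "v \<notin> B" "c (insert v B) \<noteq> 0" using that by (auto simp: c'_def split: if_splits)
    then have "insert v B \<in> F" "card (insert v B) = b" using c by (auto simp: cochain_def)
    then show ?thesis using del[of "insert v B"] \<open>v \<notin> B\<close> by simp
  qed
  moreover have "c B = coboundary sg c' B" if B: "B \<in> F" "card B = b" for B
  proof (cases "v \<in> B")
    case True
    have "coboundary sg c' B = sg v B * c' (B - {v}) + (\<Sum>w\<in>B - {v}. sg w B * c' (B - {w}))"
      unfolding coboundary_def using True by (subst sum.remove[of _ v]) auto
    also have "(\<Sum>w\<in>B - {v}. sg w B * c' (B - {w})) = 0"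
      using True by (intro sum.neutral) (auto simp: c'_def)
    also have "c' (B - {v}) = sg v B * c B"
      using True by (simp add: c'_def insert_absorb)
    finally show ?thesis by (simp add: sq flip: mult.assoc)
  next
    case False
    define D where "D = insert v B"
    have DB: "D - {v} = B" "v \<in> D" using False by (auto simp: D_def)
    have "coboundary sg c D = 0" using cocycle add[OF B(1)] B(2) False by (simp add: D_def)
    then have "sg v D * c B + (\<Sum>w\<in>B. sg w D * c (D - {w})) = 0"
      unfolding coboundary_def using sum.remove[of D v "\<lambda>w. sg w D * c (D - {w})"] DB by simp
    then have "sg v D * (sg v D * c B) + sg v D * (\<Sum>w\<in>B. sg w D * c (D - {w})) = 0"
      by (metis distrib_left mult_zero_right)
    then have eq: "c B = - (\<Sum>w\<in>B. sg v D * sg w D * c (D - {w}))"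
      by (simp add: sq sum_distrib_left mult.assoc[symmetric] eq_neg_iff_add_eq_0)
    have "coboundary sg c' B = (\<Sum>w\<in>B. sg w B * (sg v (D - {w}) * c (D - {w})))"
    proof -
      have "c' (B - {w}) = sg v (D - {w}) * c (D - {w})" if "w \<in> B" for w
      proof -
        have "insert v (B - {w}) = D - {w}" using that False by (auto simp: D_def)
        then show ?thesis using False by (simp add: c'_def)
      qed
      then show ?thesis by (simp add: coboundary_def)
    qed
    also have "\<dots> = (\<Sum>w\<in>B. - (sg v D * sg w D * c (D - {w})))"
    proof (rule sum.cong[OF refl])
      fix w assume w: "w \<in> B"
      then have "w \<in> D" "v \<noteq> w" using False by (auto simp: D_def)
      then have s: "sg v (D - {w}) * sg w D = - (sg w B * sg v D)"
        using sign_function_swap[OF sg, of v D w] DB by simp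
      have "sg w B * sg v (D - {w}) = sg w B * sg v (D - {w}) * (sg w D * sg w D)"
        by (simp add: sq)
      also have "\<dots> = sg w B * sg w D * (sg v (D - {w}) * sg w D)"
        by (simp add: mult_ac)
      also have "\<dots> = - (sg w B * sg w B * sg w D * sg v D)"
        by (simp only: s) (simp add: mult_ac)
      finally have "sg w B * sg v (D - {w}) = - (sg v D * sg w D)"
        by (simp add: sq mult.commute)
      then show "sg w B * (sg v (D - {w}) * c (D - {w})) = - (sg v D * sg w D * c (D - {w}))"
        by (simp only: mult.assoc[symmetric] mult_minus_left)
    qed
    finally show ?thesis using eq by (simp add: sum_negf)
  qed
  ultimately show "\<exists>c'. (\<forall>B. c' B \<noteq> 0 \<longrightarrow> B \<in> F \<and> Suc (card B) = b) \<and>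
      (\<forall>B\<in>F. card B = b \<longrightarrow> c B = coboundary sg c' B)"
    by blast
qed

lemma acyclic_at_no_cells: "(\<And>B. B \<in> F \<Longrightarrow> card B \<noteq> b) \<Longrightarrow> acyclic_at sg F b"
  unfolding acyclic_at_def by (intro allI impI exI[of _ "\<lambda>_. 0"]) simp

lemma acyclic_atE:
  assumes "acyclic_at sg F b" and "cochain F b c"
    and "\<And>B. B \<in> F \<Longrightarrow> card B = Suc b \<Longrightarrow> coboundary sg c B = 0"
  obtains c' where "\<And>B. c' B \<noteq> 0 \<Longrightarrow> B \<in> F \<and> Suc (card B) = b"
    and "\<And>B. B \<in> F \<Longrightarrow> card B = b \<Longrightarrow> c B = coboundary sg c' B"
  using assms(1)[unfolded acyclic_at_def, rule_format, OF assms(2)] assms(3) that by metis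

lemma convex_family_split:
  assumes "convex_family F"
  shows "convex_family {B\<in>F. v \<in> B}" and "convex_family {B\<in>F. v \<notin> B}"
  using assms unfolding convex_family_def by blast+

text \<open>The members containing \<open>v\<close> form a subcomplex, the remaining ones the quotient complex; this
  lemma and the next one are two pieces of the resulting long exact sequence.\<close>

lemma acyclic_at_split:
  fixes sg :: "'v::finite \<Rightarrow> 'v set \<Rightarrow> 'k::field"
  assumes sg: "sign_function sg" and conv: "convex_family F"
    and sub: "acyclic_at sg {B\<in>F. v \<in> B} b" and quot: "acyclic_at sg {B\<in>F. v \<notin> B} b"
  shows "acyclic_at sg F b"
  unfolding acyclic_at_def
proof (intro allI impI)
  fix c assume c: "cochain F b c"
    and cocycle: "\<forall>B\<in>F. card B = Suc b \<longrightarrow> coboundary sg c B = 0"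
  define c0 where "c0 B = (if v \<in> B then 0 else c B)" for B
  have "cochain {B\<in>F. v \<notin> B} b c0" using c by (auto simp: cochain_def c0_def)
  moreover have "coboundary sg c0 B = 0" if "B \<in> {B\<in>F. v \<notin> B}" "card B = Suc b" for B
  proof -
    have "coboundary sg c0 B = coboundary sg c B"
      using that by (intro coboundary_cong) (auto simp: c0_def)
    then show ?thesis using cocycle that by simp
  qed
  ultimately obtain d0 where d0: "\<And>B. d0 B \<noteq> 0 \<Longrightarrow> B \<in> F \<and> v \<notin> B \<and> Suc (card B) = b"
    and d0': "\<And>B. B \<in> F \<Longrightarrow> v \<notin> B \<Longrightarrow> card B = b \<Longrightarrow> c0 B = coboundary sg d0 B"
    by (rule acyclic_atE[OF quot]) auto
  \<comment> \<open>\<open>d0\<close> bounds \<open>c\<close> on the quotient only. Subtracting its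
    coboundary within all of \<open>F\<close> leaves a cocycle \<open>c1\<close> that lives on sets
    containing \<open>v\<close>, where the assumption on the subcomplex applies.\<close>
  define e where "e B = (if B \<in> F then coboundary sg d0 B else 0)" for B
  have e_card: "card B = b" if "e B \<noteq> 0" for B
  proof -
    have "coboundary sg d0 B \<noteq> 0" using that by (simp add: e_def split: if_splits)
    then obtain w where "w \<in> B" "d0 (B - {w}) \<noteq> 0"
      unfolding coboundary_def by (metis (mono_tags, lifting) mult_zero_right sum.neutral)
    then have "Suc (card (B - {w})) = b" using d0 by blast
    then show ?thesis using \<open>w \<in> B\<close> by (metis card_Suc_Diff1 finite)
  qed
  define c1 where "c1 B = c B - e B" for B
  have "cochain {B\<in>F. v \<in> B} b c1"
    unfolding cochain_def
  proof (intro allI impI)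
    fix B assume "c1 B \<noteq> 0"
    then have "c B \<noteq> 0 \<or> e B \<noteq> 0" by (auto simp: c1_def)
    then have B: "B \<in> F" "card B = b"
      using c e_card by (auto simp: cochain_def e_def split: if_splits)
    have "v \<in> B"
    proof (rule ccontr)
      assume "v \<notin> B"
      then have "c1 B = 0" using d0'[of B] B by (simp add: c1_def e_def c0_def)
      then show False using \<open>c1 B \<noteq> 0\<close> by simp
    qed
    then show "B \<in> {B\<in>F. v \<in> B} \<and> card B = b" using B by simp
  qed
  moreover have "coboundary sg c1 B = 0" if "B \<in> {B\<in>F. v \<in> B}" "card B = Suc b" for B
  proof -
    have "coboundary sg e B = 0"
      unfolding e_def using that d0 by (intro coboundary_truncated[OF sg conv]) auto
    then show ?thesis
      unfolding c1_def coboundary_diff using cocycle that by simp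
  qed
  ultimately obtain d1 where d1: "\<And>B. d1 B \<noteq> 0 \<Longrightarrow> B \<in> F \<and> v \<in> B \<and> Suc (card B) = b"
    and d1': "\<And>B. B \<in> F \<Longrightarrow> v \<in> B \<Longrightarrow> card B = b \<Longrightarrow> c1 B = coboundary sg d1 B"
    by (rule acyclic_atE[OF sub]) auto
  have "c B = coboundary sg (\<lambda>B. d0 B + d1 B) B" if B: "B \<in> F" "card B = b" for B
  proof (cases "v \<in> B")
    case True
    then show ?thesis using d1'[OF B(1) True B(2)] B
      by (simp add: coboundary_add c1_def e_def algebra_simps)
  next
    case False
    have "d1 (B - {w}) = 0" for w using d1[of "B - {w}"] False by blast
    then have "coboundary sg d1 B = 0" by (simp add: coboundary_def)
    then show ?thesis using d0'[OF B(1) False B(2)] False by (simp add: coboundary_add c0_def)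
  qed
  moreover have "B \<in> F \<and> Suc (card B) = b" if "d0 B + d1 B \<noteq> 0" for B
    using that d0[of B] d1[of B] by fastforce
  ultimately show "\<exists>c'. (\<forall>B. c' B \<noteq> 0 \<longrightarrow> B \<in> F \<and> Suc (card B) = b) \<and>
      (\<forall>B\<in>F. card B = b \<longrightarrow> c B = coboundary sg c' B)"
    by (intro exI[of _ "\<lambda>B. d0 B + d1 B"]) blast
qed

lemma acyclic_at_subcomplex:
  fixes sg :: "'v::finite \<Rightarrow> 'v set \<Rightarrow> 'k::field"
  assumes sg: "sign_function sg" and conv: "convex_family F"
    and quot: "acyclic_at sg {B\<in>F. v \<notin> B} b" and acyc: "acyclic_at sg F (Suc b)"
  shows "acyclic_at sg {B\<in>F. v \<in> B} (Suc b)"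
  unfolding acyclic_at_def
proof (intro allI impI)
  fix c assume c: "cochain {B\<in>F. v \<in> B} (Suc b) c"
    and cocycle: "\<forall>B\<in>{B\<in>F. v \<in> B}. card B = Suc (Suc b) \<longrightarrow> coboundary sg c B = 0"
  have c0: "c B = 0" if "v \<notin> B" for B using c that by (auto simp: cochain_def)
  have "cochain F (Suc b) c" using c by (auto simp: cochain_def)
  moreover have "coboundary sg c B = 0" if "B \<in> F" "card B = Suc (Suc b)" for B
  proof (cases "v \<in> B")
    case False
    then show ?thesis by (simp add: coboundary_def c0)
  qed (use cocycle that in auto)
  ultimately obtain c' where c': "\<And>B. c' B \<noteq> 0 \<Longrightarrow> B \<in> F \<and> card B = b"
    and cc': "\<And>B. B \<in> F \<Longrightarrow> card B = Suc b \<Longrightarrow> c B = coboundary sg c' B"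
    by (rule acyclic_atE[OF acyc]) auto
  define c0' where "c0' B = (if v \<in> B then 0 else c' B)" for B
  have "cochain {B\<in>F. v \<notin> B} b c0'" using c' by (auto simp: cochain_def c0'_def)
  moreover have "coboundary sg c0' B = 0" if "B \<in> {B\<in>F. v \<notin> B}" "card B = Suc b" for B
  proof -
    have "coboundary sg c0' B = coboundary sg c' B"
      using that by (intro coboundary_cong) (auto simp: c0'_def)
    then show ?thesis using cc'[of B] c0[of B] that by simp
  qed
  ultimately obtain g where g: "\<And>B. g B \<noteq> 0 \<Longrightarrow> B \<in> F \<and> v \<notin> B \<and> Suc (card B) = b"
    and g': "\<And>B. B \<in> F \<Longrightarrow> v \<notin> B \<Longrightarrow> card B = b \<Longrightarrow> c0' B = coboundary sg g B"
    by (rule acyclic_atE[OF quot]) auto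
  \<comment> \<open>The part of \<open>c'\<close> off \<open>v\<close> is a cocycle of the quotient,
    as \<open>c\<close> vanishes there. Subtracting the coboundary of \<open>g\<close> moves
    \<open>c'\<close> into the subcomplex without changing its coboundary.\<close>
  define e where "e B = (if B \<in> F then coboundary sg g B else 0)" for B
  define c1 where "c1 B = c' B - e B" for B
  have e_card: "card B = b" if "e B \<noteq> 0" for B
  proof -
    have "coboundary sg g B \<noteq> 0" using that by (simp add: e_def split: if_splits)
    then obtain w where "w \<in> B" "g (B - {w}) \<noteq> 0"
      unfolding coboundary_def by (metis (mono_tags, lifting) mult_zero_right sum.neutral)
    then have "Suc (card (B - {w})) = b" using g by blast
    then show ?thesis using \<open>w \<in> B\<close> by (metis card_Suc_Diff1 finite)
  qed
  have "B \<in> {B\<in>F. v \<in> B} \<and> Suc (card B) = Suc b" if "c1 B \<noteq> 0" for B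
  proof -
    have "c' B \<noteq> 0 \<or> e B \<noteq> 0" using that by (auto simp: c1_def)
    then have B: "B \<in> F" "card B = b"
      using c' e_card by (auto simp: e_def split: if_splits)
    have "v \<in> B"
    proof (rule ccontr)
      assume "v \<notin> B"
      then have "c1 B = 0" using g'[of B] B by (simp add: c1_def e_def c0'_def)
      then show False using that by simp
    qed
    then show ?thesis using B by simp
  qed
  moreover have "c B = coboundary sg c1 B" if "B \<in> {B\<in>F. v \<in> B}" "card B = Suc b" for B
  proof -
    have "coboundary sg e B = 0"
      unfolding e_def using that g by (intro coboundary_truncated[OF sg conv]) auto
    then show ?thesis
      unfolding c1_def coboundary_diff using cc' that by simp
  qed
  ultimately show "\<exists>c'. (\<forall>B. c' B \<noteq> 0 \<longrightarrow> B \<in> {B\<in>F. v \<in> B} \<and> Suc (card B) = Suc b) \<and>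
      (\<forall>B\<in>{B\<in>F. v \<in> B}. card B = Suc b \<longrightarrow> c B = coboundary sg c' B)"
    by (intro exI[of _ c1]) blast
qed

text \<open>Membership of each vertex of \<open>Y\<close> is decided in turn by
  \<open>acyclic_at_split\<close>; both halves stay convex, and at the end a single trace
  \<open>Z\<close> is left.\<close>

lemma acyclic_at_fibers:
  fixes sg :: "'v::finite \<Rightarrow> 'v set \<Rightarrow> 'k::field"
  assumes sg: "sign_function sg" and "finite Y" and "convex_family F"
    and "\<And>Z. Z \<subseteq> Y \<Longrightarrow> acyclic_at sg {B\<in>F. B \<inter> Y = Z} b"
  shows "acyclic_at sg F b"
  using assms(2-)
proof (induction Y arbitrary: F rule: finite_induct)
  case empty
  then show ?case using empty.prems(2)[of "{}"] by simp
next
  case (insert v Y)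
  have "acyclic_at sg {B\<in>{B\<in>F. v \<in> B}. B \<inter> Y = Z} b" if "Z \<subseteq> Y" for Z
  proof -
    have "{B\<in>{B\<in>F. v \<in> B}. B \<inter> Y = Z} = {B\<in>F. B \<inter> insert v Y = insert v Z}"
      using that insert.hyps by auto
    then show ?thesis using insert.prems(2)[of "insert v Z"] that by auto
  qed
  moreover have "acyclic_at sg {B\<in>{B\<in>F. v \<notin> B}. B \<inter> Y = Z} b" if "Z \<subseteq> Y" for Z
  proof -
    have "{B\<in>{B\<in>F. v \<notin> B}. B \<inter> Y = Z} = {B\<in>F. B \<inter> insert v Y = Z}"
      using that insert.hyps by auto
    then show ?thesis using insert.prems(2)[of Z] that by auto
  qed
  ultimately show ?case
    using insert.IH[OF convex_family_split(1)[OF insert.prems(1)]]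
      insert.IH[OF convex_family_split(2)[OF insert.prems(1)]]
    by (intro acyclic_at_split[OF sg insert.prems(1)]) blast+
qed


section \<open>Matroids\<close>

definition independence_system :: "'v set set \<Rightarrow> bool" where
  "independence_system \<I> \<longleftrightarrow> (\<forall>I\<in>\<I>. \<forall>J\<subseteq>I. J \<in> \<I>) \<and>
     (\<forall>I\<in>\<I>. \<forall>J\<in>\<I>. card I < card J \<longrightarrow> (\<exists>y\<in>J - I. insert y I \<in> \<I>))"

lemma independent_extend:
  fixes \<I> :: "'v::finite set set"
  assumes ind: "independence_system \<I>" and "I \<in> \<I>" "J \<in> \<I>" "card I \<le> card J"
  shows "\<exists>K\<in>\<I>. I \<subseteq> K \<and> K \<subseteq> I \<union> J \<and> card K = card J"
  using assms(2-)
proof (induction "card J - card I" arbitrary: I)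
  case 0
  then show ?case by (intro bexI[of _ I]) auto
next
  case (Suc n)
  then have "card I < card J" by simp
  then obtain y where y: "y \<in> J - I" "insert y I \<in> \<I>"
    using ind Suc.prems unfolding independence_system_def by blast
  have c: "card (insert y I) = Suc (card I)" using y by simp
  have "n = card J - card (insert y I)" "card (insert y I) \<le> card J"
    using Suc c \<open>card I < card J\<close> by auto
  then obtain K where "K \<in> \<I>" "insert y I \<subseteq> K" "K \<subseteq> insert y I \<union> J" "card K = card J"
    using Suc.hyps(1)[of "insert y I"] y Suc.prems by blast
  then show ?case using y by (intro bexI[of _ K]) auto
qed

text \<open>Deletion and contraction of an element of the ground set \<open>N\<close>; a loop gives a cone.\<close>

lemma acyclic_at_matroid:
  fixes sg :: "'v::finite \<Rightarrow> 'v set \<Rightarrow> 'k::field"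
  assumes sg: "sign_function sg" and "finite N"
    and "independence_system \<I>" and "\<And>I. I \<in> \<I> \<Longrightarrow> I \<subseteq> N"
    and "Z \<inter> N = {}" and "card Z + t < b"
  shows "acyclic_at sg {Z \<union> X |X. X \<subseteq> N \<and> (\<exists>I\<in>\<I>. I \<subseteq> X \<and> card I = t)} b"
  using assms(2-)
proof (induction N arbitrary: \<I> Z t rule: finite_induct)
  case empty
  \<comment> \<open>The only possible member is \<open>Z\<close> itself, and
    \<open>card Z < b\<close>.\<close>
  then show ?case by (intro acyclic_at_no_cells) auto
next
  case (insert v N)
  let ?F = "{Z \<union> X |X. X \<subseteq> insert v N \<and> (\<exists>I\<in>\<I>. I \<subseteq> X \<and> card I = t)}"
  have vZ: "v \<notin> Z" using insert.prems by auto
  \<comment> \<open>If \<open>{v}\<close> is dependent or \<open>t = 0\<close>, adding or removing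
    \<open>v\<close> does not affect the rank condition, so the family is a cone over
    \<open>v\<close>.\<close>
  show ?case
  proof (cases "{v} \<in> \<I> \<and> 0 < t")
    case False
    have I': "\<exists>J\<in>\<I>. J \<subseteq> X - {v} \<and> card J = t" if "I \<in> \<I>" "I \<subseteq> X" "card I = t" for I X
    proof (cases "t = 0")
      case True
      moreover have "{} \<in> \<I>" using that insert.prems(1) unfolding independence_system_def by blast
      ultimately show ?thesis by (intro bexI[of _ "{}"]) auto
    next
      case tpos: False
      have "v \<notin> I"
      proof
        assume "v \<in> I"
        then have "{v} \<subseteq> I" by simp
        then have "{v} \<in> \<I>" using that insert.prems(1) unfolding independence_system_def by blast
        then show False using False tpos by simp
      qed
      then show ?thesis using that by blast
    qed
    show ?thesis
    proof (rule acyclic_at_cone[OF sg])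
      fix B assume "B \<in> ?F"
      then obtain X I where X: "B = Z \<union> X" "X \<subseteq> insert v N" "I \<in> \<I>" "I \<subseteq> X" "card I = t"
        by auto
      have "insert v B = Z \<union> insert v X" using X by auto
      moreover have "insert v X \<subseteq> insert v N" "I \<subseteq> insert v X" using X by auto
      ultimately show "insert v B \<in> ?F" using X by blast
      obtain J where "J \<in> \<I>" "J \<subseteq> X - {v}" "card J = t" using I' X by blast
      moreover have "B - {v} = Z \<union> (X - {v})" "X - {v} \<subseteq> insert v N" using X vZ by auto
      ultimately show "B - {v} \<in> ?F" by blast
    qed
  next
    case True
    then obtain t' where t: "t = Suc t'" using gr0_implies_Suc by blast
    \<comment> \<open>Deletion and contraction. For the contraction \<open>v\<close> moves into
      \<open>Z\<close> while \<open>t\<close> drops to \<open>t'\<close>, so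
      \<open>card Z + t\<close> is unchanged and the bound by \<open>b\<close> is inherited.\<close>
    let ?I0 = "{I\<in>\<I>. v \<notin> I}" and ?I1 = "{I. v \<notin> I \<and> insert v I \<in> \<I>}"
    have down: "\<And>I J. I \<in> \<I> \<Longrightarrow> J \<subseteq> I \<Longrightarrow> J \<in> \<I>"
      and aug: "\<And>I J. I \<in> \<I> \<Longrightarrow> J \<in> \<I> \<Longrightarrow> card I < card J \<Longrightarrow> \<exists>y\<in>J - I. insert y I \<in> \<I>"
      using insert.prems(1) unfolding independence_system_def by blast+
    have "independence_system ?I0"
      unfolding independence_system_def
    proof (intro conjI ballI allI impI)
      fix I J assume "I \<in> ?I0" "J \<in> ?I0" "card I < card J"
      then show "\<exists>y\<in>J - I. insert y I \<in> ?I0" using aug[of I J] by auto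
    qed (use down in auto)
    then have "acyclic_at sg {Z \<union> X |X. X \<subseteq> N \<and> (\<exists>I\<in>?I0. I \<subseteq> X \<and> card I = t)} b"
      using insert.prems insert.hyps by (intro insert.IH) auto
    moreover have "{Z \<union> X |X. X \<subseteq> N \<and> (\<exists>I\<in>?I0. I \<subseteq> X \<and> card I = t)} = {B\<in>?F. v \<notin> B}" (is "?L = ?R")
    proof (intro subset_antisym subsetI)
      fix B assume "B \<in> ?L"
      then show "B \<in> ?R" using insert.hyps vZ by blast
    next
      fix B assume "B \<in> ?R"
      then show "B \<in> ?L" by blast
    qed
    ultimately have quot: "acyclic_at sg {B\<in>?F. v \<notin> B} b" by simp
    have "independence_system ?I1"
      unfolding independence_system_def
    proof (intro conjI ballI allI impI)
      fix I J assume "I \<in> ?I1" "J \<in> ?I1" "card I < card J"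
      then show "\<exists>y\<in>J - I. insert y I \<in> ?I1"
        using aug[of "insert v I" "insert v J"] by (auto simp: insert_commute)
    next
      fix I J assume "I \<in> ?I1" "J \<subseteq> I"
      then show "J \<in> ?I1" using down[of "insert v I" "insert v J"] by auto
    qed
    moreover have "I \<subseteq> N" if "I \<in> ?I1" for I
      using insert.prems(2)[of "insert v I"] that by auto
    moreover have "insert v Z \<inter> N = {}" "card (insert v Z) + t' < b"
      using insert.prems insert.hyps t vZ by auto
    ultimately have "acyclic_at sg
        {insert v Z \<union> X |X. X \<subseteq> N \<and> (\<exists>I\<in>?I1. I \<subseteq> X \<and> card I = t')} b"
      by (intro insert.IH)
    moreover have "{insert v Z \<union> X |X. X \<subseteq> N \<and> (\<exists>I\<in>?I1. I \<subseteq> X \<and> card I = t')} =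
        {B\<in>?F. v \<in> B}" (is "?L = ?R")
    proof (intro subset_antisym subsetI)
      fix B assume "B \<in> ?L"
      then obtain X I where X: "B = insert v Z \<union> X" "X \<subseteq> N" "I \<in> ?I1" "I \<subseteq> X" "card I = t'"
        by blast
      then have "B = Z \<union> insert v X" "insert v X \<subseteq> insert v N" "insert v I \<in> \<I>"
        "insert v I \<subseteq> insert v X" "card (insert v I) = t" using t by auto
      then show "B \<in> ?R" by blast
    next
      fix B assume "B \<in> ?R"
      then obtain X I where X: "B = Z \<union> X" "X \<subseteq> insert v N" "I \<in> \<I>" "I \<subseteq> X" "card I = t"
        "v \<in> X" using vZ by blast
      obtain K where K: "K \<in> \<I>" "{v} \<subseteq> K" "K \<subseteq> {v} \<union> I" "card K = t"
        using independent_extend[OF insert.prems(1), of "{v}" I] True X by auto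
      have "insert v (K - {v}) = K" using K by auto
      then have "K - {v} \<in> ?I1" "K - {v} \<subseteq> X - {v}" "card (K - {v}) = t'" using K X t by auto
      moreover have "B = insert v Z \<union> (X - {v})" "X - {v} \<subseteq> N" using X by auto
      ultimately show "B \<in> ?L" by blast
    qed
    ultimately have sub: "acyclic_at sg {B\<in>?F. v \<in> B} b" by simp
    have "convex_family ?F"
      unfolding convex_family_def
    proof (intro allI impI)
      fix A B C assume *: "A \<in> ?F" "C \<in> ?F" "A \<subseteq> B" "B \<subseteq> C"
      then obtain X I where X: "A = Z \<union> X" "I \<in> \<I>" "I \<subseteq> X" "card I = t" "X \<subseteq> insert v N" by blast
      have "B = Z \<union> (B \<inter> insert v N)" "B \<inter> insert v N \<subseteq> insert v N" "I \<subseteq> B \<inter> insert v N"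
        using * X by auto
      then show "B \<in> ?F" using X by blast
    qed
    then show ?thesis using acyclic_at_split[OF sg _ sub quot] by blast
  qed
qed

text \<open>An augmenting path argument, one reassignment at a time. Some \<open>y\<close> of the
  larger set has a partner \<open>g y\<close> that \<open>f\<close> does not use. If
  \<open>y\<close> is new, it is added; otherwise \<open>f y\<close> is changed to
  \<open>g y\<close>, after which \<open>f\<close> and \<open>g\<close> disagree at fewer common
  points.\<close>

lemma transversal_independence_system:
  fixes R :: "'r set" and N :: "'v::finite set"
  shows "independence_system {I. I \<subseteq> N \<and> (\<exists>f. inj_on f I \<and> f ` I \<subseteq> R \<and> (\<forall>x\<in>I. P x (f x)))}"
proof -
  let ?ok = "\<lambda>I f. I \<subseteq> N \<and> inj_on f I \<and> f ` I \<subseteq> R \<and> (\<forall>x\<in>I. P x (f x))"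
  have aug: "\<exists>y\<in>Y - X. \<exists>h. ?ok (insert y X) h"
    if "?ok X f" "?ok Y g" "card X < card Y" for X Y f g
    using that
  proof (induction "card {x\<in>X \<inter> Y. f x \<noteq> g x}" arbitrary: f rule: less_induct)
    case less
    have "card (f ` X) < card (g ` Y)" using less.prems by (simp add: card_image)
    then obtain y where y: "y \<in> Y" "g y \<notin> f ` X"
      by (metis card_mono finite finite_imageI image_subsetI leD)
    have inj: "inj_on (f(y := g y)) (insert y X)"
    proof -
      have "inj_on (f(y := g y)) X" using less.prems(1) y by (blast intro: inj_on_fun_updI)
      moreover have "(f(y := g y)) ` (X - {y}) \<subseteq> f ` X" by auto
      ultimately show ?thesis using y unfolding inj_on_insert by auto
    qed
    have ok: "?ok (insert y X) (f(y := g y))"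
      using less.prems y inj by auto
    show ?case
    proof (cases "y \<in> X")
      case False
      then show ?thesis using ok y by blast
    next
      case True
      then have "?ok X (f(y := g y))" using ok by (simp add: insert_absorb)
      moreover have "f y \<noteq> g y" using True y by (metis image_eqI)
      then have "{x\<in>X \<inter> Y. (f(y := g y)) x \<noteq> g x} \<subset> {x\<in>X \<inter> Y. f x \<noteq> g x}"
        using True y by (intro psubsetI) (auto split: if_splits)
      then have "card {x\<in>X \<inter> Y. (f(y := g y)) x \<noteq> g x} < card {x\<in>X \<inter> Y. f x \<noteq> g x}"
        by (intro psubset_card_mono) auto
      ultimately show ?thesis using less.hyps[of "f(y := g y)"] less.prems by blast
    qed
  qed
  let ?S = "{I. I \<subseteq> N \<and> (\<exists>f. inj_on f I \<and> f ` I \<subseteq> R \<and> (\<forall>x\<in>I. P x (f x)))}"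
  have S: "I \<in> ?S \<longleftrightarrow> (\<exists>f. ?ok I f)" for I by simp
  show ?thesis
    unfolding independence_system_def
  proof (intro conjI ballI allI impI)
    fix I J assume "I \<in> ?S" "J \<subseteq> I"
    then obtain f where "?ok I f" by auto
    then have "?ok J f" using \<open>J \<subseteq> I\<close> by (auto intro: inj_on_subset)
    then show "J \<in> ?S" by blast
  next
    fix I J assume "I \<in> ?S" "J \<in> ?S" "card I < card J"
    from \<open>I \<in> ?S\<close> obtain f where f: "?ok I f" unfolding S by (elim exE)
    from \<open>J \<in> ?S\<close> obtain g where g: "?ok J g" unfolding S by (elim exE)
    show "\<exists>y\<in>J - I. insert y I \<in> ?S"
      unfolding S by (rule aug[OF f g \<open>card I < card J\<close>])
  qed
qed


section \<open>Maximum induced matchings\<close>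

definition has_matching :: "'v set set \<Rightarrow> nat \<Rightarrow> 'v set \<Rightarrow> bool" where
  "has_matching E s B \<longleftrightarrow> (\<exists>M. matching E M \<and> card M = s \<and> \<Union>M \<subseteq> B)"

lemma has_matching_mono: "has_matching E s A \<Longrightarrow> A \<subseteq> B \<Longrightarrow> has_matching E s B"
  unfolding has_matching_def by blast

lemma matching_subset: "matching E M \<Longrightarrow> N \<subseteq> M \<Longrightarrow> matching E N"
  unfolding matching_def by (blast intro: pairwise_subset)

lemma has_matchingI:
  assumes "matching E M" and "s \<le> card M" and "\<Union>M \<subseteq> B"
  shows "has_matching E s B"
proof -
  obtain N where "N \<subseteq> M" "card N = s"
    using assms(2) by (meson obtain_subset_with_card_n)
  then show ?thesis
    using assms matching_subset unfolding has_matching_def by (metis Sup_subset_mono dual_order.trans)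
qed

lemma convex_family_upward:
  "(\<And>B C. P B \<Longrightarrow> B \<subseteq> C \<Longrightarrow> C \<subseteq> A \<Longrightarrow> P C) \<Longrightarrow> convex_family {B. B \<subseteq> A \<and> P B}"
  unfolding convex_family_def by blast

lemma convex_family_has_matching: "convex_family {B. B \<subseteq> A \<and> has_matching E s B}"
  by (intro convex_family_upward) (rule has_matching_mono)

lemma card_le_matching_number:
  fixes E :: "'v::finite set set"
  shows "matching E M \<Longrightarrow> card M \<le> matching_number E"
  unfolding matching_number_def by (intro Max_ge) auto

locale maximum_induced_matching =
  fixes E M :: "'v::finite set set"
  assumes simple: "simple_graph E"
    and induced: "induced_matching E M"
    and maximum: "card M = matching_number E"
begin

lemma M_matching: "matching E M"
  using induced by (simp add: induced_matching_def)

lemma M_edges: "e \<in> M \<Longrightarrow> e \<in> E"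
  using M_matching by (auto simp: matching_def)

lemma M_disjoint: "e \<in> M \<Longrightarrow> f \<in> M \<Longrightarrow> x \<in> e \<Longrightarrow> x \<in> f \<Longrightarrow> e = f"
  using M_matching unfolding matching_def pairwise_def disjnt_def by blast

lemma edge_doubleton:
  assumes "e \<in> E" "x \<in> e"
  obtains y where "e = {x, y}" "x \<noteq> y"
proof -
  have "card e = 2" using simple assms by (simp add: simple_graph_def)
  then obtain u v where uv: "e = {u, v}" "u \<noteq> v" by (meson card_2_iff)
  show ?thesis
  proof (cases "x = u")
    case True
    then show ?thesis using that[of v] uv by simp
  next
    case False
    then show ?thesis using that[of u] uv assms by auto
  qed
qed

lemma edge_in_M:
  assumes "e \<in> E" "e \<subseteq> \<Union>M"
  shows "e \<in> M"
proof -
  have "card e = 2" using simple assms by (simp add: simple_graph_def)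
  then obtain u v where uv: "e = {u, v}" by (meson card_2_iff)
  then obtain f g where "f \<in> M" "g \<in> M" "u \<in> f" "v \<in> g" using assms by auto
  then have "e \<subseteq> f \<union> g" using uv by auto
  then show ?thesis using induced assms \<open>f \<in> M\<close> \<open>g \<in> M\<close> unfolding induced_matching_def by blast
qed

text \<open>Otherwise \<open>M\<close> could be enlarged by this edge.\<close>

lemma edge_meets_M:
  assumes "{x, y} \<in> E"
  shows "x \<in> \<Union>M \<or> y \<in> \<Union>M"
proof (rule ccontr)
  assume "\<not> ?thesis"
  then have n: "x \<notin> \<Union>M" "y \<notin> \<Union>M" by auto
  then have "matching E (insert {x, y} M)"
    using assms M_matching by (auto simp: matching_def pairwise_insert disjnt_def)
  then have "card (insert {x, y} M) \<le> card M" using card_le_matching_number maximum by metis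
  moreover have "{x, y} \<notin> M" using n by auto
  ultimately show False by simp
qed

text \<open>Otherwise \<open>x - u - v - y\<close> would be an augmenting path.\<close>

lemma common_outside_neighbour:
  assumes "{u, v} \<in> M" "u \<noteq> v" "{x, u} \<in> E" "{v, y} \<in> E" "x \<notin> \<Union>M" "y \<notin> \<Union>M"
  shows "x = y"
proof (rule ccontr)
  assume "x \<noteq> y"
  let ?K = "M - {{u, v}}"
  have uv: "u \<in> \<Union>M" "v \<in> \<Union>M" using assms by auto
  have n: "u \<notin> g" "v \<notin> g" if "g \<in> ?K" for g
    using that M_disjoint[OF assms(1), of g] by auto
  have K: "matching E ?K" using M_matching matching_subset by blast
  have "{x, u} \<inter> {v, y} = {}" using assms uv \<open>x \<noteq> y\<close> by auto
  moreover have "{x, u} \<inter> g = {}" "{v, y} \<inter> g = {}" if "g \<in> ?K" for g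
    using n[OF that] that assms by auto
  ultimately have "matching E (insert {x, u} (insert {v, y} ?K))"
    using K assms by (auto simp: matching_def pairwise_insert disjnt_def)
  then have le: "card (insert {x, u} (insert {v, y} ?K)) \<le> card M"
    using card_le_matching_number maximum by metis
  have "{x, u} \<notin> ?K" "{v, y} \<notin> ?K" "{x, u} \<noteq> {v, y}"
    using assms uv \<open>x \<noteq> y\<close> by (auto simp: doubleton_eq_iff)
  then have "card (insert {x, u} (insert {v, y} ?K)) = Suc (Suc (card ?K))" by simp
  moreover have "Suc (card ?K) = card M" using assms by (metis card_Suc_Diff1 finite)
  ultimately show False using le by simp
qed

text \<open>\<open>T\<close> collects the edges of \<open>M\<close> that form a triangle with a vertex of \<open>A\<close> outside of \<open>M\<close>. For
  the other edges of \<open>M\<close>, at most one endpoint \<open>h e\<close> has neighbours in \<open>A\<close> outside of \<open>M\<close>. Hence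
  \<open>A - Z0\<close> is independent, and for a fixed trace \<open>Z\<close> on \<open>Z0\<close> the family is given by a
  transversal matroid.\<close>

lemma acyclic_at_has_matching:
  fixes sg :: "'v \<Rightarrow> 'v set \<Rightarrow> 'k::field"
  assumes sg: "sign_function sg" and b: "card M + s < b"
  shows "acyclic_at sg {B. B \<subseteq> A \<and> has_matching E s B} b"
proof -
  define T where "T = {e\<in>M. \<exists>w\<in>A - \<Union>M. \<forall>x\<in>e. {x, w} \<in> E}"
  \<comment> \<open>If both endpoints had neighbours in \<open>A\<close> outside of
    \<open>M\<close>, \<open>common_outside_neighbour\<close> would make all of these equal, and
    \<open>e\<close> would be in \<open>T\<close>.\<close>
  have "\<exists>h. h \<in> e \<and> (\<forall>x\<in>e - {h}. \<forall>w\<in>A - \<Union>M. {x, w} \<notin> E)" if e: "e \<in> M - T" for e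
  proof -
    have "card e = 2" using simple M_edges e by (auto simp: simple_graph_def)
    then obtain u v where uv: "e = {u, v}" "u \<noteq> v" by (meson card_2_iff)
    have "\<not> ((\<exists>w\<in>A - \<Union>M. {u, w} \<in> E) \<and> (\<exists>w\<in>A - \<Union>M. {v, w} \<in> E))"
    proof
      assume "(\<exists>w\<in>A - \<Union>M. {u, w} \<in> E) \<and> (\<exists>w\<in>A - \<Union>M. {v, w} \<in> E)"
      then obtain x y where xy: "x \<in> A - \<Union>M" "y \<in> A - \<Union>M" "{u, x} \<in> E" "{v, y} \<in> E" by blast
      have "x = y"
        using common_outside_neighbour[of u v x y] e uv xy by (auto simp: insert_commute)
      then show False using xy uv e by (auto simp: T_def)
    qed
    then show ?thesis using uv by blast
  qed
  then obtain h where h: "\<And>e. e \<in> M - T \<Longrightarrow> h e \<in> e"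
    and h': "\<And>e x w. e \<in> M - T \<Longrightarrow> x \<in> e \<Longrightarrow> x \<noteq> h e \<Longrightarrow> w \<in> A - \<Union>M \<Longrightarrow> {x, w} \<notin> E"
    by (metis DiffI singletonD)
  define Z0 where "Z0 = A \<inter> (\<Union>T \<union> h ` (M - T))"
  define N0 where "N0 = A - Z0"
  have Z0M: "Z0 \<subseteq> \<Union>M" using h by (auto simp: Z0_def T_def)
  have Z0T: "e \<inter> Z0 \<subseteq> {h e}" if "e \<in> M - T" for e
  proof
    fix x assume x: "x \<in> e \<inter> Z0"
    have "x \<notin> \<Union>T"
    proof
      assume "x \<in> \<Union>T"
      then obtain f where "f \<in> T" "x \<in> f" by auto
      then have "f = e" using M_disjoint[of f e x] that x by (auto simp: T_def)
      then show False using \<open>f \<in> T\<close> that by simp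
    qed
    then obtain f where "f \<in> M - T" "x = h f" using x by (auto simp: Z0_def)
    then show "x \<in> {h e}" using h[of f] M_disjoint[of e f x] that x by auto
  qed
  \<comment> \<open>An edge within \<open>A\<close> belongs to \<open>M\<close>, and then meets
    \<open>Z0\<close>, or joins an endpoint of an edge of \<open>M\<close> to an outside vertex, and
    then that endpoint is in \<open>Z0\<close>.\<close>
  have independent: "{x, y} \<notin> E" if "x \<in> N0" "y \<in> N0" for x y
  proof
    assume xy: "{x, y} \<in> E"
    have one: "{x, y} \<notin> E" if x: "x \<in> N0" "x \<in> e" "e \<in> M" and y: "y \<in> N0" "y \<notin> \<Union>M" for x y e
    proof -
      have "e \<in> M - T" "x \<noteq> h e" using x by (auto simp: N0_def Z0_def)
      then show ?thesis using h'[of e x y] x y by (auto simp: N0_def)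
    qed
    show False
    proof (cases "x \<in> \<Union>M \<and> y \<in> \<Union>M")
      case True
      then have M: "{x, y} \<in> M" using edge_in_M[OF xy] by simp
      have "{x, y} \<notin> T" using that by (auto simp: N0_def Z0_def)
      then have "h {x, y} \<in> {x, y}" "h {x, y} \<in> h ` (M - T)" using M h by auto
      then show False using that by (auto simp: N0_def Z0_def)
    next
      case False
      then consider e where "x \<in> e" "e \<in> M" "y \<notin> \<Union>M" | e where "y \<in> e" "e \<in> M" "x \<notin> \<Union>M"
        using edge_meets_M[OF xy] by blast
      then show ?thesis
      proof cases
        case 1
        then show ?thesis using one[of x _ y] that xy by blast
      next
        case 2
        then show ?thesis using one[of y _ x] that xy by (simp add: insert_commute)
      qed
    qed
  qed
  let ?F = "{B. B \<subseteq> A \<and> has_matching E s B}"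
  have "acyclic_at sg {B\<in>?F. B \<inter> Z0 = Z} b" if Z: "Z \<subseteq> Z0" for Z
  proof -
    \<comment> \<open>\<open>F\<close> consists of the triangle edges that lie fully in the trace. A
      matching may be assumed to contain all of them; its other edges then join distinct vertices of
      \<open>R\<close> to distinct vertices of \<open>N0\<close>, and \<open>s - card F\<close> of
      these are needed. The independent sets of \<open>\<I>\<close> are the subsets of
      \<open>N0\<close> that can be matched into \<open>R\<close>.\<close>
    define F where "F = {e\<in>T. e \<subseteq> Z}"
    define R where "R = Z - \<Union>F"
    define \<I> where "\<I> = {I. I \<subseteq> N0 \<and> (\<exists>f. inj_on f I \<and> f ` I \<subseteq> R \<and> (\<forall>x\<in>I. {x, f x} \<in> E))}"
    have FM: "F \<subseteq> M" by (auto simp: F_def T_def)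
    have ZN: "Z \<inter> N0 = {}" using Z by (auto simp: N0_def)
    have ZA: "Z \<subseteq> A" using Z by (auto simp: Z0_def)
    \<comment> \<open>Replacing the edges of \<open>K\<close> that touch \<open>F\<close> by
      \<open>F\<close> itself loses nothing. Sending such an edge to a member of \<open>F\<close>
      that it meets is injective: two disjoint edges meeting the same {u, v} would be {u, x} and {v,
      y} with \<open>x\<close> and \<open>y\<close> outside of \<open>M\<close>, and then
      \<open>x = y\<close>.\<close>
    have touching: "card {g\<in>K. g \<inter> \<Union>F \<noteq> {}} \<le> card F" (is "card ?K' \<le> _")
      if K: "matching E K" "\<Union>K \<subseteq> A" for K
    proof -
      have "\<forall>g\<in>?K'. \<exists>e. e \<in> F \<and> g \<inter> e \<noteq> {}" by blast
      from bchoice[OF this] obtain \<phi> where "\<forall>g\<in>?K'. \<phi> g \<in> F \<and> g \<inter> \<phi> g \<noteq> {}"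
        by (elim exE)
      then have \<phi>: "\<And>g. g \<in> ?K' \<Longrightarrow> \<phi> g \<in> F \<and> g \<inter> \<phi> g \<noteq> {}" by (rule bspec)
      have "inj_on \<phi> ?K'"
      proof (rule inj_onI, rule ccontr)
        fix g g' assume g: "g \<in> ?K'" "g' \<in> ?K'" "\<phi> g = \<phi> g'" "g \<noteq> g'"
        then have disj: "g \<inter> g' = {}"
          using K unfolding matching_def pairwise_def disjnt_def by blast
        obtain u v where u: "u \<in> g" "u \<in> \<phi> g" and v: "v \<in> g'" "v \<in> \<phi> g"
          using \<phi>[OF g(1)] \<phi>[OF g(2)] g(3) by auto
        have uv: "u \<noteq> v" using u v disj by auto
        have M: "\<phi> g \<in> M" using \<phi>[OF g(1)] FM by auto
        obtain v' where "\<phi> g = {u, v'}" by (rule edge_doubleton[OF M_edges[OF M] u(2)])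
        moreover have "v \<in> {u, v'}" using v(2) calculation by (simp only:)
        then have "v' = v" using uv by simp
        ultimately have \<phi>_eq: "\<phi> g = {u, v}" by (simp only:)
        have gE: "g \<in> E" "g' \<in> E" using g K by (auto simp: matching_def)
        obtain x where x: "g = {u, x}" by (rule edge_doubleton[OF gE(1) u(1)])
        obtain y where y: "g' = {v, y}" by (rule edge_doubleton[OF gE(2) v(1)])
        have "x \<notin> \<Union>M"
        proof
          assume "x \<in> \<Union>M"
          then have "g \<in> M" using edge_in_M[OF gE(1)] x M u by blast
          then have "g = \<phi> g" using M_disjoint M u by blast
          then show False using disj \<phi>_eq v by auto
        qed
        moreover have "y \<notin> \<Union>M"
        proof
          assume "y \<in> \<Union>M"
          then have "g' \<in> M" using edge_in_M[OF gE(2)] y M v by blast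
          then have "g' = \<phi> g" using M_disjoint M v by blast
          then show False using disj \<phi>_eq u by auto
        qed
        ultimately have "x = y"
          using common_outside_neighbour[of u v x y] M \<phi>_eq uv gE x y by (simp add: insert_commute)
        then show False using disj x y by auto
      qed
      then show ?thesis
        using \<phi> by (metis (no_types, lifting) card_inj_on_le finite image_subsetI)
    qed
    have fiber: "{B\<in>?F. B \<inter> Z0 = Z} =
        {Z \<union> X |X. X \<subseteq> N0 \<and> (\<exists>I\<in>\<I>. I \<subseteq> X \<and> card I = s - card F)}" (is "?L = ?R")
    proof (intro subset_antisym subsetI)
      fix B assume "B \<in> ?L"
      then have B: "B \<subseteq> A" "has_matching E s B" "B \<inter> Z0 = Z" by auto
      then obtain K where K: "matching E K" "card K = s" "\<Union>K \<subseteq> B" unfolding has_matching_def by blast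
      define K1 where "K1 = {g\<in>K. g \<inter> \<Union>F = {}}"
      have "K = {g\<in>K. g \<inter> \<Union>F \<noteq> {}} \<union> K1" by (auto simp: K1_def)
      then have "card K \<le> card {g\<in>K. g \<inter> \<Union>F \<noteq> {}} + card K1" by (metis card_Un_le)
      moreover have "\<Union>K \<subseteq> A" using K(3) B(1) by (rule order_trans)
      ultimately have cK1: "s - card F \<le> card K1" using touching[of K] K by linarith
      have K1E: "g \<in> E" if "g \<in> K1" for g using that K by (auto simp: K1_def matching_def)
      have K1_disj: "g = g'" if "g \<in> K1" "g' \<in> K1" "x \<in> g" "x \<in> g'" for g g' x
        using that K unfolding K1_def matching_def pairwise_def disjnt_def by blast
      \<comment> \<open>No edge of \<open>K1\<close> lies in \<open>N0\<close>, which is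
        independent. One within \<open>Z\<close> would belong to \<open>M\<close>: if in
        \<open>T\<close>, it would be a member of \<open>F\<close>, which \<open>K1\<close> avoids;
        if not, it would have at most the vertex \<open>h g\<close> in \<open>Z0\<close>.\<close>
      have "\<exists>x r. g = {x, r} \<and> x \<in> B \<inter> N0 \<and> r \<in> R" if g: "g \<in> K1" for g
      proof -
        have "card g = 2" using K1E[OF g] simple by (simp add: simple_graph_def)
        then obtain x y where xy: "g = {x, y}" "x \<noteq> y" by (meson card_2_iff)
        have gB: "x \<in> B" "y \<in> B" using xy g K by (auto simp: K1_def)
        have nF: "x \<notin> \<Union>F" "y \<notin> \<Union>F" using g xy by (auto simp: K1_def)
        have "\<not> (x \<in> Z \<and> y \<in> Z)"
        proof
          assume Z': "x \<in> Z \<and> y \<in> Z"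
          then have gM: "g \<in> M" using edge_in_M[OF K1E[OF g]] xy Z Z0M by auto
          show False
          proof (cases "g \<in> T")
            case True
            then have "g \<in> F" using Z' xy by (auto simp: F_def)
            then show False using nF xy by auto
          next
            case False
            then have "{x, y} \<subseteq> {h g}" using Z0T[of g] gM Z' Z xy by auto
            then show False using xy by auto
          qed
        qed
        moreover have "\<not> (x \<in> N0 \<and> y \<in> N0)" using independent K1E[OF g] xy by auto
        moreover have "x \<in> Z \<or> x \<in> N0" "y \<in> Z \<or> y \<in> N0" using gB B by (auto simp: N0_def)
        ultimately consider "x \<in> N0" "y \<in> Z" | "y \<in> N0" "x \<in> Z" by blast
        then show ?thesis
        proof cases
          case 1
          then show ?thesis using xy gB nF by (auto simp: R_def)
        next
          case 2
          then have "g = {y, x} \<and> y \<in> B \<inter> N0 \<and> x \<in> R" using xy gB nF by (auto simp: R_def)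
          then show ?thesis by blast
        qed
      qed
      then obtain \<xi> \<rho> where \<xi>\<rho>: "\<And>g. g \<in> K1 \<Longrightarrow> g = {\<xi> g, \<rho> g} \<and> \<xi> g \<in> B \<inter> N0 \<and> \<rho> g \<in> R"
        by metis
      have inj\<xi>: "inj_on \<xi> K1" using \<xi>\<rho> K1_disj by (metis inj_onI insertI1)
      have inj\<rho>: "inj_on \<rho> K1" using \<xi>\<rho> K1_disj by (metis inj_onI insertI1 insertI2)
      obtain K2 where K2: "K2 \<subseteq> K1" "card K2 = s - card F"
        using cK1 by (meson obtain_subset_with_card_n)
      define I where "I = \<xi> ` K2"
      define f where "f = \<rho> \<circ> inv_into K1 \<xi>"
      have f: "f (\<xi> g) = \<rho> g" if "g \<in> K1" for g using that inj\<xi> by (simp add: f_def)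
      have "inj_on f I"
      proof (rule inj_onI)
        fix x y assume "x \<in> I" "y \<in> I" "f x = f y"
        then obtain g g' where g: "g \<in> K1" "g' \<in> K1" "x = \<xi> g" "y = \<xi> g'" using K2 by (auto simp: I_def)
        then have "\<rho> g = \<rho> g'" using \<open>f x = f y\<close> f by simp
        then show "x = y" using g inj\<rho> by (auto dest: inj_onD)
      qed
      moreover have "f ` I \<subseteq> R" using K2 f \<xi>\<rho> by (auto simp: I_def)
      moreover have "{x, f x} \<in> E" if x: "x \<in> I" for x
      proof -
        obtain g where g: "g \<in> K1" "x = \<xi> g" using x K2 by (auto simp: I_def)
        then have "{x, f x} = g" using f \<xi>\<rho>[of g] by auto
        then show ?thesis using K1E[OF g(1)] by simp
      qed
      moreover have "I \<subseteq> B \<inter> N0" using K2 \<xi>\<rho> by (auto simp: I_def)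
      moreover have "card I = s - card F"
        using K2 inj\<xi> unfolding I_def by (metis card_image inj_on_subset)
      moreover have "B = Z \<union> (B \<inter> N0)" using B by (auto simp: N0_def)
      ultimately show "B \<in> ?R"
        by (intro CollectI exI[of _ "B \<inter> N0"] conjI bexI[of _ I]) (auto simp: \<I>_def)
    next
      fix B assume "B \<in> ?R"
      then obtain X I f where X: "B = Z \<union> X" "X \<subseteq> N0" "I \<subseteq> X" "card I = s - card F"
        and f: "inj_on f I" "f ` I \<subseteq> R" "\<And>x. x \<in> I \<Longrightarrow> {x, f x} \<in> E"
        by (auto simp: \<I>_def)
      let ?g = "\<lambda>x. {x, f x}"
      have xR: "x \<notin> Z" "x \<notin> \<Union>F" "f x \<in> Z" "f x \<notin> \<Union>F" if "x \<in> I" for x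
      proof -
        show "x \<notin> Z" using that X ZN by auto
        then show "x \<notin> \<Union>F" by (auto simp: F_def)
        show "f x \<in> Z" "f x \<notin> \<Union>F" using that f(2) by (auto simp: R_def)
      qed
      have eq: "x = y" if "x \<in> I" "y \<in> I" "?g x \<inter> ?g y \<noteq> {}" for x y
        using that xR[of x] xR[of y] f(1) by (auto dest: inj_onD)
      have inj: "inj_on ?g I"
      proof (rule inj_onI)
        fix x y assume "x \<in> I" "y \<in> I" "?g x = ?g y"
        then show "x = y" using eq[of x y] by auto
      qed
      have disjF: "e \<inter> ?g x = {}" if "e \<in> F" "x \<in> I" for e x
        using xR[OF that(2)] that(1) by auto
      have "disjnt g g'" if g: "g \<in> F \<union> ?g ` I" "g' \<in> F \<union> ?g ` I" "g \<noteq> g'" for g g'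
      proof -
        consider "g \<in> F" "g' \<in> F" | x where "g \<in> F" "x \<in> I" "g' = ?g x"
          | x where "g' \<in> F" "x \<in> I" "g = ?g x" | x y where "x \<in> I" "y \<in> I" "g = ?g x" "g' = ?g y"
          using g by auto
        then show ?thesis
        proof cases
          case 1
          then show ?thesis using g FM M_disjoint unfolding disjnt_def by blast
        next
          case 2
          then show ?thesis using disjF unfolding disjnt_def by blast
        next
          case 3
          then show ?thesis using disjF unfolding disjnt_def by blast
        next
          case 4
          then have "x \<noteq> y" using g(3) by blast
          then have "?g x \<inter> ?g y = {}" using eq[OF 4(1,2)] by blast
          then show ?thesis using 4 by (simp only: disjnt_def)
        qed
      qed
      then have "matching E (F \<union> ?g ` I)"
        using FM M_edges f(3) unfolding matching_def by (auto simp: pairwise_def)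
      moreover have "F \<inter> ?g ` I = {}" using disjF by fastforce
      then have "card (F \<union> ?g ` I) = card F + (s - card F)"
        using inj X by (simp add: card_Un_disjoint card_image)
      moreover have "\<Union>(F \<union> ?g ` I) \<subseteq> B" using X xR by (auto simp: F_def)
      ultimately have "has_matching E s B" by (intro has_matchingI) auto
      moreover have "B \<subseteq> A" using X ZA by (auto simp: N0_def)
      moreover have "B \<inter> Z0 = Z" using X Z by (auto simp: N0_def)
      ultimately show "B \<in> ?L" by simp
    qed
    show ?thesis
    proof (cases "s < card F")
      case True
      then have "F \<noteq> {}" by auto
      then obtain e w where w: "w \<in> A - \<Union>M" by (auto simp: F_def T_def)
      then have wN: "w \<in> N0" using Z0M by (auto simp: N0_def)
      have "{} \<in> \<I>" by (auto simp: \<I>_def)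
      then have R: "{Z \<union> X |X. X \<subseteq> N0 \<and> (\<exists>I\<in>\<I>. I \<subseteq> X \<and> card I = s - card F)} =
          {B. Z \<subseteq> B \<and> B \<subseteq> Z \<union> N0}" (is "?L = ?R")
      proof (intro subset_antisym subsetI)
        fix B assume "B \<in> ?R"
        then have "B = Z \<union> (B \<inter> N0)" by auto
        then show "B \<in> ?L" using True \<open>{} \<in> \<I>\<close> by (intro CollectI exI[of _ "B \<inter> N0"]) auto
      qed auto
      show ?thesis unfolding fiber R
        using wN ZN by (intro acyclic_at_cone[OF sg, where v = w]) auto
    next
      case False
      \<comment> \<open>Each edge of \<open>M\<close> has at most one vertex in \<open>Z\<close>,
        those of \<open>F\<close> having a second one. The summand \<open>card F\<close> is
        compensated by the rank \<open>s - card F\<close>.\<close>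
      have "card Z \<le> card M + card F"
      proof -
        have "Z = (\<Union>e\<in>M. Z \<inter> e)" using Z Z0M by auto
        then have "card Z \<le> (\<Sum>e\<in>M. card (Z \<inter> e))" by (metis card_UN_le finite)
        also have "\<dots> \<le> (\<Sum>e\<in>M. 1 + (if e \<in> F then 1 else 0))"
        proof (rule sum_mono)
          fix e assume e: "e \<in> M"
          have c2: "card e = 2" using M_edges[OF e] simple by (simp add: simple_graph_def)
          show "card (Z \<inter> e) \<le> 1 + (if e \<in> F then 1 else 0)"
          proof (cases "e \<in> F")
            case True
            then show ?thesis using c2 card_mono[of e "Z \<inter> e"] by auto
          next
            case nF: False
            show ?thesis
            proof (cases "e \<in> T")
              case True
              then have "Z \<inter> e \<subset> e" using nF by (auto simp: F_def)
              then have "card (Z \<inter> e) < 2" using psubset_card_mono[of e "Z \<inter> e"] c2 by simp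
              then show ?thesis using nF by simp
            next
              case False
              then have "Z \<inter> e \<subseteq> {h e}" using Z0T[of e] Z e by auto
              then show ?thesis using nF card_mono[of "{h e}" "Z \<inter> e"] by simp
            qed
          qed
        qed
        also have "\<dots> = card M + card F"
        proof -
          have "(\<Sum>e\<in>M. (if e \<in> F then 1 else 0)) = card F"
            using FM by (simp add: sum.If_cases Int_absorb1)
          then show ?thesis unfolding sum.distrib by simp
        qed
        finally show ?thesis .
      qed
      then have "card Z + (s - card F) < b" using b False by linarith
      then show ?thesis
        unfolding fiber \<I>_def using ZN
        by (intro acyclic_at_matroid[OF sg] transversal_independence_system) auto
    qed
  qed
  then show ?thesis
    by (intro acyclic_at_fibers[OF sg _ convex_family_has_matching, of Z0]) auto
qed

text \<open>Choose an endpoint \<open>u e\<close> of every edge \<open>e\<close> of \<open>M\<close>. The sets missing some \<open>u e\<close> form a cone over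
  the other endpoint of \<open>e\<close>, so only the sets containing \<open>u ` M\<close> matter; the coboundary of a single set with \<open>s - 1\<close> full edges is a
  nonzero class among them in the lowest possible degree.\<close>

lemma not_acyclic_at_has_matching:
  fixes sg :: "'v \<Rightarrow> 'v set \<Rightarrow> 'k::field"
  assumes sg: "sign_function sg" and s: "1 \<le> s" "s \<le> card M"
  shows "\<not> acyclic_at sg {B. B \<subseteq> \<Union>M \<and> has_matching E s B} (card M + s)"
proof
  let ?F = "{B. B \<subseteq> \<Union>M \<and> has_matching E s B}"
  assume acyc: "acyclic_at sg ?F (card M + s)"
  obtain b where b: "card M + s = Suc b" using s by (metis add_Suc_right not0_implies_Suc not_one_le_zero)
  have "\<forall>e\<in>M. \<exists>x y. e = {x, y} \<and> x \<noteq> y"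
    using simple M_edges by (metis card_2_iff simple_graph_def)
  then obtain u v where uv: "\<And>e. e \<in> M \<Longrightarrow> e = {u e, v e} \<and> u e \<noteq> v e" by metis
  have in_e: "u e \<in> e" "v e \<in> e" if "e \<in> M" for e using uv[OF that] by auto
  have inju: "inj_on u M" and injv: "inj_on v M"
    using in_e M_disjoint by (metis inj_onI)+
  have uv_ne: "u e \<noteq> v f" if "e \<in> M" "f \<in> M" for e f
    using that uv in_e M_disjoint by metis
  have UM: "\<Union>M = u ` M \<union> v ` M"
  proof (intro subset_antisym subsetI)
    fix x assume "x \<in> \<Union>M"
    then obtain e where "e \<in> M" "x \<in> e" by auto
    then show "x \<in> u ` M \<union> v ` M" using uv[of e] by auto
  qed (use in_e in auto)
  \<comment> \<open>As \<open>M\<close> is induced, all edges within its vertex set belong to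
    \<open>M\<close>; a matching there is a set of full edges.\<close>
  have sub: "has_matching E s B \<longleftrightarrow> s \<le> card {e\<in>M. e \<subseteq> B}" if B: "B \<subseteq> \<Union>M" for B
  proof
    assume "has_matching E s B"
    then obtain K where K: "matching E K" "card K = s" "\<Union>K \<subseteq> B" unfolding has_matching_def by blast
    have "e \<in> M" "e \<subseteq> B" if "e \<in> K" for e
    proof -
      show "e \<subseteq> B" using K that by auto
      then show "e \<in> M" using K that B edge_in_M[of e] unfolding matching_def by blast
    qed
    then have "K \<subseteq> {e\<in>M. e \<subseteq> B}" by auto
    then show "s \<le> card {e\<in>M. e \<subseteq> B}" using K by (metis card_mono finite)
  next
    assume "s \<le> card {e\<in>M. e \<subseteq> B}"
    moreover have "matching E {e\<in>M. e \<subseteq> B}" by (rule matching_subset[OF M_matching]) auto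
    ultimately show "has_matching E s B" by (intro has_matchingI) auto
  qed
  \<comment> \<open>Acyclicity is passed on to smaller and smaller subcomplexes, one condition on
    \<open>u e\<close> at a time. If \<open>u e\<close> is missing, \<open>e\<close> is not full in
    any case and \<open>v e\<close> is free to be added or removed; this makes the quotient acyclic
    in degree \<open>b\<close>, as \<open>acyclic_at_subcomplex\<close> requires.\<close>
  have "acyclic_at sg {B\<in>?F. u ` K \<subseteq> B} (Suc b)" if "K \<subseteq> M" for K
    using finite[of K] that
  proof (induction K rule: finite_induct)
    case empty
    then show ?case using acyc b by simp
  next
    case (insert e K)
    let ?G = "{B\<in>?F. u ` K \<subseteq> B}"
    have e: "e \<in> M" "K \<subseteq> M" using insert.prems by auto
    have conv: "convex_family ?G"
    proof -
      have "?G = {B. B \<subseteq> \<Union>M \<and> (has_matching E s B \<and> u ` K \<subseteq> B)}" by auto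
      then show ?thesis by (simp only:) (intro convex_family_upward, blast intro: has_matching_mono)
    qed
    have cone: "insert (v e) B \<in> {B\<in>?G. u e \<notin> B} \<and> B - {v e} \<in> {B\<in>?G. u e \<notin> B}"
      if "B \<in> {B\<in>?G. u e \<notin> B}" for B
    proof -
      have B: "B \<subseteq> \<Union>M" "s \<le> card {e\<in>M. e \<subseteq> B}" "u ` K \<subseteq> B" "u e \<notin> B"
        using that sub by auto
      have ve: "v e \<in> \<Union>M" using e in_e by auto
      have "{f\<in>M. f \<subseteq> B} \<subseteq> {f\<in>M. f \<subseteq> insert (v e) B}" by auto
      from card_mono[OF finite this] have "s \<le> card {f\<in>M. f \<subseteq> insert (v e) B}"
        using B(2) by linarith
      moreover have "{e\<in>M. e \<subseteq> B} \<subseteq> {f\<in>M. f \<subseteq> B - {v e}}"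
      proof
        fix f assume f: "f \<in> {e\<in>M. e \<subseteq> B}"
        have "v e \<notin> f"
        proof
          assume "v e \<in> f"
          then have "f = e" using f e in_e M_disjoint by blast
          then show False using f B in_e[OF e(1)] by auto
        qed
        then show "f \<in> {f\<in>M. f \<subseteq> B - {v e}}" using f by auto
      qed
      from card_mono[OF finite this] have "s \<le> card {f\<in>M. f \<subseteq> B - {v e}}"
        using B(2) by linarith
      moreover have "insert (v e) B \<subseteq> \<Union>M" "B - {v e} \<subseteq> \<Union>M" using B(1) ve by auto
      ultimately have "has_matching E s (insert (v e) B)" "has_matching E s (B - {v e})"
        by (simp_all only: sub)
      moreover have "v e \<notin> u ` K" using uv_ne[OF _ e(1)] e(2) by (metis imageE subsetD)
      then have "u ` K \<subseteq> B - {v e}" using B(3) by (simp add: subset_Diff_insert)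
      moreover have "u ` K \<subseteq> insert (v e) B" using B(3) by (rule subset_insertI2)
      moreover have "u e \<notin> insert (v e) B" "u e \<notin> B - {v e}"
        using uv_ne[OF e(1) e(1)] B(4) by simp_all
      ultimately show ?thesis
        using \<open>insert (v e) B \<subseteq> \<Union>M\<close> \<open>B - {v e} \<subseteq> \<Union>M\<close> by (intro conjI CollectI)
    qed
    have "acyclic_at sg {B\<in>?G. u e \<notin> B} b"
      by (rule acyclic_at_cone[OF sg, where v = "v e"]) (rule cone[THEN conjunct1] cone[THEN conjunct2], assumption)+
    then have "acyclic_at sg {B\<in>?G. u e \<in> B} (Suc b)"
      using insert.IH e by (intro acyclic_at_subcomplex[OF sg conv]) auto
    moreover have "{B\<in>?G. u e \<in> B} = {B\<in>?F. u ` insert e K \<subseteq> B}" by auto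
    ultimately show ?case by simp
  qed
  define G where "G = {B. B \<subseteq> \<Union>M \<and> has_matching E s B \<and> u ` M \<subseteq> B}"
  have "{B\<in>?F. u ` M \<subseteq> B} = G" by (auto simp: G_def)
  with \<open>\<And>K. K \<subseteq> M \<Longrightarrow> acyclic_at sg {B\<in>?F. u ` K \<subseteq> B} (Suc b)\<close>[of M]
  have acyc: "acyclic_at sg G (Suc b)" by simp
  have full: "{e\<in>M. e \<subseteq> u ` M \<union> v ` K} = K" if "K \<subseteq> M" for K
  proof (intro subset_antisym subsetI)
    fix e assume e: "e \<in> {e\<in>M. e \<subseteq> u ` M \<union> v ` K}"
    then have "v e \<in> u ` M \<union> v ` K" using in_e by auto
    moreover have "v e \<notin> u ` M" using uv_ne[OF _ , of _ e] e by (metis (mono_tags, lifting) imageE mem_Collect_eq)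
    ultimately have "v e \<in> v ` K" by blast
    then show "e \<in> K" using injv e that by (auto dest: inj_onD)
  qed (use uv that in auto)
  have card_uv: "card (u ` M \<union> v ` K) = card M + card K" if "K \<subseteq> M" for K
  proof -
    have "u ` M \<inter> v ` K = {}" using uv_ne that by auto
    then show ?thesis
      using that inju injv by (simp add: card_Un_disjoint card_image inj_on_subset)
  qed
  have G_form: "\<exists>K\<subseteq>M. B = u ` M \<union> v ` K \<and> s \<le> card K" if "B \<in> G" for B
  proof -
    let ?K = "{e\<in>M. v e \<in> B}"
    have B: "B \<subseteq> u ` M \<union> v ` M" "u ` M \<subseteq> B" "has_matching E s B" using that UM by (simp_all add: G_def)
    have eq: "B = u ` M \<union> v ` ?K"
    proof (intro subset_antisym subsetI)
      fix x assume "x \<in> B"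
      then show "x \<in> u ` M \<union> v ` ?K" using B(1) by auto
    next
      fix x assume "x \<in> u ` M \<union> v ` ?K"
      then show "x \<in> B" using B(2) by auto
    qed
    have "B \<subseteq> \<Union>M" using B(1) UM by simp
    then have "s \<le> card {e\<in>M. e \<subseteq> B}" using B(3) sub by simp
    also have "{e\<in>M. e \<subseteq> B} = ?K" using full[of ?K] eq by simp
    finally show ?thesis using eq by (intro exI[of _ ?K]) simp
  qed
  have G_I: "u ` M \<union> v ` K \<in> G" if "K \<subseteq> M" "s \<le> card K" for K
  proof -
    have "u ` M \<union> v ` K \<subseteq> \<Union>M" using that(1) unfolding UM by auto
    then show ?thesis using that(2) by (simp add: sub full[OF that(1)] G_def)
  qed
  obtain K where K: "K \<subseteq> M" "card K = s - 1"
    using s by (meson diff_le_self le_trans obtain_subset_with_card_n)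
  then have "K \<noteq> M" using s by auto
  then obtain f where f: "f \<in> M" "f \<notin> K" using K by auto
  \<comment> \<open>With \<open>s - 1\<close> full edges, \<open>S\<close> has size \<open>b\<close>
    and just fails to be in \<open>G\<close>. Its coboundary lives on members of the smallest size
    \<open>Suc b\<close>, so it cannot be a coboundary within \<open>G\<close>.\<close>
  define S where "S = u ` M \<union> v ` K"
  define \<delta> :: "'v set \<Rightarrow> 'k" where "\<delta> B = (if B = S then 1 else 0)" for B
  define c where "c B = (if B \<in> G then coboundary sg \<delta> B else 0)" for B
  have d_nz: "\<exists>w\<in>B. B - {w} = S" if "coboundary sg \<delta> B \<noteq> 0" for B
  proof (rule ccontr)
    assume "\<not> ?thesis"
    then have "coboundary sg \<delta> B = 0"
      unfolding coboundary_def \<delta>_def by (intro sum.neutral) simp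
    then show False using that by simp
  qed
  have cardS: "Suc (card S) = Suc b" using card_uv[OF K(1)] K s b by (simp add: S_def)
  have "cochain G (Suc b) c"
    unfolding cochain_def
  proof (intro allI impI)
    fix B assume "c B \<noteq> 0"
    then have "B \<in> G" "coboundary sg \<delta> B \<noteq> 0" by (auto simp: c_def split: if_splits)
    moreover then obtain w where "w \<in> B" "B - {w} = S" using d_nz by blast
    then have "card B = Suc b" using cardS by (metis card_Suc_Diff1 finite)
    ultimately show "B \<in> G \<and> card B = Suc b" by blast
  qed
  moreover have "coboundary sg c B = 0" if B: "B \<in> G" "card B = Suc (Suc b)" for B
  proof -
    \<comment> \<open>As \<open>S\<close> is not in \<open>G\<close>,
      \<open>coboundary_truncated\<close> does not apply to its indicator. Still nothing is lost:
      adding any further vertex of \<open>M\<close> to \<open>S\<close> completes an edge and leads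
      into \<open>G\<close>.\<close>
    have "coboundary sg c B = coboundary sg (coboundary sg \<delta>) B"
    proof (rule coboundary_cong)
      fix w assume w: "w \<in> B"
      show "c (B - {w}) = coboundary sg \<delta> (B - {w})"
      proof (rule ccontr)
        assume "\<not> ?thesis"
        then have n: "B - {w} \<notin> G" "coboundary sg \<delta> (B - {w}) \<noteq> 0"
          by (auto simp: c_def split: if_splits)
        then obtain x where x: "x \<in> B - {w}" "B - {w} - {x} = S" using d_nz by blast
        then have "B - {w} = insert x S" by auto
        have "x \<in> \<Union>M" using x B by (auto simp: G_def)
        moreover have "x \<notin> S" using x by auto
        ultimately obtain g where g: "g \<in> M" "x = v g" using UM by (auto simp: S_def)
        then have "g \<notin> K" using \<open>x \<notin> S\<close> by (auto simp: S_def)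
        then have "s \<le> card (insert g K)" using K s by simp
        then have "u ` M \<union> v ` insert g K \<in> G" using G_I[of "insert g K"] g K by simp
        moreover have "B - {w} = u ` M \<union> v ` insert g K"
          using \<open>B - {w} = insert x S\<close> g by (auto simp: S_def)
        ultimately show False using n(1) by simp
      qed
    qed
    then show ?thesis using coboundary_coboundary[OF sg] by simp
  qed
  ultimately obtain c' where c': "\<And>B. c' B \<noteq> 0 \<Longrightarrow> B \<in> G \<and> card B = b"
    and cc': "\<And>B. B \<in> G \<Longrightarrow> card B = Suc b \<Longrightarrow> c B = coboundary sg c' B"
    by (rule acyclic_atE[OF acyc]) auto
  have "c' B = 0" for B
  proof (rule ccontr)
    assume "c' B \<noteq> 0"
    then have "B \<in> G" "card B = b" using c' by auto
    then show False using G_form[of B] card_uv b by fastforce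
  qed
  moreover define D where "D = u ` M \<union> v ` insert f K"
  have "s \<le> card (insert f K)" using f K s by simp
  then have DG: "D \<in> G" unfolding D_def using G_I[of "insert f K"] f K by blast
  have D: "D = insert (v f) S" "v f \<notin> S"
  proof -
    have "v f \<notin> u ` M" using uv_ne[OF _ f(1)] by (metis imageE)
    moreover have "v f \<notin> v ` K" using f injv K by (auto dest: inj_onD)
    ultimately show "v f \<notin> S" by (simp add: S_def)
    show "D = insert (v f) S" by (simp add: D_def S_def)
  qed
  then have "card D = Suc b" using cardS by simp
  ultimately have "c D = 0" using cc'[OF DG] by (simp add: coboundary_def)
  moreover have "coboundary sg \<delta> D = sg (v f) D"
  proof -
    have "coboundary sg \<delta> D = (\<Sum>w\<in>D. if w = v f then sg (v f) D else 0)"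
      unfolding coboundary_def \<delta>_def
    proof (rule sum.cong[OF refl])
      fix w assume "w \<in> D"
      then have "D - {w} = S \<longleftrightarrow> w = v f" using D by auto
      then show "sg w D * (if D - {w} = S then 1 else 0) = (if w = v f then sg (v f) D else 0)"
        by auto
    qed
    then show ?thesis using D by simp
  qed
  moreover have "sg (v f) D * sg (v f) D = 1" using sg by (simp add: sign_function_def)
  ultimately show False using DG by (auto simp: c_def)
qed

end


section \<open>Monomial ideals and squarefree powers\<close>

abbreviation "lookup \<equiv> Poly_Mapping.lookup"
abbreviation "keys \<equiv> Poly_Mapping.keys"
abbreviation "single \<equiv> Poly_Mapping.single"

section \<open>Coefficients, degrees and homogeneous components of polynomials\<close>

lemma poly_mapping_sum_single: "f = (\<Sum>u\<in>keys f. single u (lookup f u))"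
  by (intro poly_mapping_eqI) (simp add: lookup_sum lookup_single when_def in_keys_iff)

lemma lookup_single_times_add:
  fixes f :: "'a::cancel_comm_monoid_add \<Rightarrow>\<^sub>0 'b::semiring_0"
  shows "lookup (single t c * f) (t + w) = c * lookup f w"
proof -
  have "lookup (single t c * f) (t + w) = (\<Sum>l. (c * (\<Sum>q. lookup f q when t + w = l + q)) when t = l)"
    by (simp add: lookup_mult lookup_single when_mult)
  then show ?thesis by simp
qed

lemma lookup_single_times_other:
  fixes f :: "'a::cancel_comm_monoid_add \<Rightarrow>\<^sub>0 'b::semiring_0"
  assumes "\<And>w. u \<noteq> t + w"
  shows "lookup (single t c * f) u = 0"
proof -
  have "u \<notin> keys (single t c * f)"
    using keys_mult[of "single t c" f] assms by (auto split: if_splits)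
  then show ?thesis by (simp add: in_keys_iff)
qed

lemma lookup_single_single_times:
  fixes f :: "('v, 'k::field) mpoly"
  shows "lookup (single (single v 1) c * f) u =
    (if lookup u v = 0 then 0 else c * lookup f (u - single v 1))"
proof (cases "lookup u v = 0")
  case True
  have "u \<noteq> single v 1 + w" for w
  proof
    assume "u = single v 1 + w"
    then have "lookup u v = 1 + lookup w v" by (simp add: lookup_add)
    then show False using True by simp
  qed
  then show ?thesis using True by (simp add: lookup_single_times_other)
next
  case False
  have "single v 1 + (u - single v 1) = u"
    using False by (intro poly_mapping_eqI) (auto simp: lookup_add lookup_minus lookup_single when_def)
  then show ?thesis using False lookup_single_times_add[of "single v 1" c f "u - single v 1"] by simp
qed

lemma mdeg_add: "mdeg (u + w) = mdeg u + mdeg w"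
  by (simp add: mdeg_def lookup_add sum.distrib)

lemma mdeg_single: "mdeg (single v n) = n"
  by (simp add: mdeg_def lookup_single when_def)

lemma mdeg_eq_0_iff: "mdeg u = 0 \<longleftrightarrow> u = 0"
  by (auto simp: mdeg_def intro: poly_mapping_eqI)

lemma finite_mdeg: "finite {u :: 'v::finite \<Rightarrow>\<^sub>0 nat. int (mdeg u) = d}"
proof -
  have "lookup u v \<le> mdeg u" for u :: "'v \<Rightarrow>\<^sub>0 nat" and v
    unfolding mdeg_def by (rule member_le_sum) auto
  then have "lookup ` {u :: 'v \<Rightarrow>\<^sub>0 nat. int (mdeg u) = d} \<subseteq>
      {g. \<forall>v. (v \<in> UNIV \<longrightarrow> g v \<in> {..nat d}) \<and> (v \<notin> UNIV \<longrightarrow> g v = 0)}"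
    by auto
  then have "finite (lookup ` {u :: 'v \<Rightarrow>\<^sub>0 nat. int (mdeg u) = d})"
    by (rule finite_subset) (intro finite_set_of_finite_funs, auto)
  then show ?thesis
    by (rule finite_imageD) (simp add: inj_on_def flip: poly_mapping_eq_iff)
qed

lemma homogeneous_0 [simp]: "homogeneous d 0"
  by (simp add: homogeneous_def)

lemma homogeneous_add:
  assumes "homogeneous d f" and "homogeneous d g"
  shows "homogeneous d (f + g)"
  unfolding homogeneous_def
proof
  fix u assume "u \<in> keys (f + g)"
  then have "u \<in> keys f \<union> keys g" by (rule keys_add[THEN subsetD])
  then show "int (mdeg u) = d" using assms by (auto simp: homogeneous_def)
qed

lemma homogeneous_uminus: "homogeneous d f \<Longrightarrow> homogeneous d (- f)"
  by (auto simp: homogeneous_def in_keys_iff)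

lemma homogeneous_diff: "homogeneous d f \<Longrightarrow> homogeneous d g \<Longrightarrow> homogeneous d (f - g)"
  using homogeneous_add[of d f "- g"] homogeneous_uminus by auto

lemma homogeneous_sum: "(\<And>i. i \<in> A \<Longrightarrow> homogeneous d (f i)) \<Longrightarrow> homogeneous d (sum f A)"
  by (induction A rule: infinite_finite_induct) (auto intro: homogeneous_add)

lemma homogeneous_mult:
  assumes "homogeneous d f" "homogeneous e g"
  shows "homogeneous (d + e) (f * g)"
  unfolding homogeneous_def
proof
  fix u assume "u \<in> keys (f * g)"
  then obtain a b where "u = a + b" "a \<in> keys f" "b \<in> keys g" using keys_mult by blast
  then show "int (mdeg u) = d + e" using assms by (auto simp: homogeneous_def mdeg_add)
qed

lemma homogeneous_single: "int (mdeg u) = d \<Longrightarrow> homogeneous d (single u c)"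
  by (auto simp: homogeneous_def)

definition hcomp :: "int \<Rightarrow> ('v::finite, 'k::field) mpoly \<Rightarrow> ('v, 'k) mpoly" where
  "hcomp d f = (\<Sum>u\<in>{u\<in>keys f. int (mdeg u) = d}. single u (lookup f u))"

lemma lookup_hcomp: "lookup (hcomp d f) u = (if int (mdeg u) = d then lookup f u else 0)"
  by (simp add: hcomp_def lookup_sum lookup_single when_def in_keys_iff)

lemma hcomp_add: "hcomp d (f + g) = hcomp d f + hcomp d g"
  by (intro poly_mapping_eqI) (simp add: lookup_hcomp lookup_add)

lemma hcomp_0 [simp]: "hcomp d 0 = 0"
  by (intro poly_mapping_eqI) (simp add: lookup_hcomp)

lemma hcomp_sum: "hcomp d (sum f A) = (\<Sum>i\<in>A. hcomp d (f i))"
  by (induction A rule: infinite_finite_induct) (auto simp: hcomp_add)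

lemma homogeneous_hcomp [simp]: "homogeneous d (hcomp d f)"
  by (auto simp: homogeneous_def in_keys_iff lookup_hcomp split: if_splits)

lemma hcomp_homogeneous: "homogeneous d f \<Longrightarrow> hcomp e f = (if e = d then f else 0)"
  by (intro poly_mapping_eqI) (auto simp: lookup_hcomp homogeneous_def in_keys_iff)

lemma sum_hcomp:
  assumes "finite D" and "\<And>u. u \<in> keys f \<Longrightarrow> int (mdeg u) \<in> D"
  shows "(\<Sum>d\<in>D. hcomp d f) = f"
proof (rule poly_mapping_eqI)
  fix u
  show "lookup (\<Sum>d\<in>D. hcomp d f) u = lookup f u"
    using assms by (cases "u \<in> keys f") (auto simp: lookup_sum lookup_hcomp in_keys_iff)
qed

lemma hcomp_mult:
  assumes g: "homogeneous e g"
  shows "hcomp d (f * g) = hcomp (d - e) f * g"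
proof -
  define D where "D = insert (d - e) ((\<lambda>u. int (mdeg u)) ` keys f)"
  have "(\<Sum>d'\<in>D. hcomp d' f) = f" by (rule sum_hcomp) (auto simp: D_def)
  then have "hcomp d (f * g) = hcomp d ((\<Sum>d'\<in>D. hcomp d' f) * g)" by simp
  also have "\<dots> = (\<Sum>d'\<in>D. hcomp d (hcomp d' f * g))"
    by (simp only: sum_distrib_right hcomp_sum)
  also have "\<dots> = (\<Sum>d'\<in>D. if d' = d - e then hcomp d' f * g else 0)"
  proof (rule sum.cong[OF refl])
    fix d' assume "d' \<in> D"
    have "homogeneous (d' + e) (hcomp d' f * g)" by (intro homogeneous_mult g) simp
    then show "hcomp d (hcomp d' f * g) = (if d' = d - e then hcomp d' f * g else 0)"
      by (auto simp: hcomp_homogeneous)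
  qed
  also have "\<dots> = hcomp (d - e) f * g" by (simp add: D_def)
  finally show ?thesis .
qed

section \<open>Squarefree exponents and ideals described by their exponents\<close>

definition expo :: "'v::finite set \<Rightarrow> ('v \<Rightarrow>\<^sub>0 nat)" where
  "expo B = (\<Sum>v\<in>B. single v 1)"

lemma lookup_expo [simp]: "lookup (expo B) v = (if v \<in> B then 1 else 0)"
  by (simp add: expo_def lookup_sum lookup_single when_def)

lemma mdeg_expo: "mdeg (expo B) = card B"
  by (simp add: mdeg_def sum.If_cases)

lemma keys_expo: "keys (expo B) = B"
  by (auto simp: in_keys_iff split: if_splits)

lemma expo_insert: "v \<notin> B \<Longrightarrow> expo (insert v B) = single v 1 + expo B"
  by (simp add: expo_def)

definition monomial_ideal :: "('v::finite \<Rightarrow>\<^sub>0 nat) set \<Rightarrow> ('v, 'k::field) mpoly set" where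
  "monomial_ideal U = {f. keys f \<subseteq> U}"

definition up_closed :: "('v \<Rightarrow>\<^sub>0 nat) set \<Rightarrow> bool" where
  "up_closed U \<longleftrightarrow> (\<forall>u\<in>U. \<forall>w. u + w \<in> U)"

lemma module_mult: "module ((*) :: 'a::comm_ring_1 \<Rightarrow> 'a \<Rightarrow> 'a)"
  by unfold_locales (simp_all add: algebra_simps)

text \<open>A polynomial is the sum of its terms, and each term is a multiple of a monomial
  generator. \<open>A\<close> may contain other polynomials too, as the products generating
  \<open>ideal_power\<close> do. With this, all the ideals below become sets of exponents.\<close>

lemma ideal_gen_eq_monomial_ideal:
  fixes A :: "('v::finite, 'k::field) mpoly set"
  assumes up: "up_closed U" and A: "A \<subseteq> monomial_ideal U"
    and gens: "\<And>u. u \<in> U \<Longrightarrow> \<exists>t w. u = t + w \<and> monomial t \<in> A"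
  shows "ideal_gen A = monomial_ideal U"
proof -
  interpret module "(*) :: ('v, 'k) mpoly \<Rightarrow> _" by (rule module_mult)
  have "subspace (monomial_ideal U)"
  proof (rule subspaceI)
    show "x + y \<in> monomial_ideal U" if "x \<in> monomial_ideal U" "y \<in> monomial_ideal U"
      for x y :: "('v, 'k) mpoly"
      using that keys_add[of x y] by (auto simp: monomial_ideal_def)
    show "c * x \<in> monomial_ideal U" if "x \<in> monomial_ideal U" for c x :: "('v, 'k) mpoly"
    proof -
      have "u \<in> U" if u: "u \<in> keys (c * x)" for u
      proof -
        obtain a b where ab: "u = a + b" "b \<in> keys x" using u keys_mult by blast
        then have "b \<in> U" using \<open>x \<in> monomial_ideal U\<close> by (auto simp: monomial_ideal_def)
        then show ?thesis using up ab(1) unfolding up_closed_def by (metis add.commute)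
      qed
      then show ?thesis by (auto simp: monomial_ideal_def)
    qed
  qed (simp add: monomial_ideal_def)
  then have "span A \<subseteq> monomial_ideal U" using A by (intro span_minimal)
  moreover have "f \<in> span A" if f: "f \<in> monomial_ideal U" for f
  proof -
    have "single u c \<in> span A" if u: "u \<in> U" for u c
    proof -
      obtain t w where tw: "u = t + w" "monomial t \<in> A" using gens[OF u] by blast
      have "single w c * monomial t \<in> span A" using tw by (intro span_scale span_base)
      then show ?thesis using tw by (simp add: monomial_def mult_single add.commute)
    qed
    then have "(\<Sum>u\<in>keys f. single u (lookup f u)) \<in> span A"
      using f by (intro span_sum) (auto simp: monomial_ideal_def)
    then show ?thesis using poly_mapping_sum_single[of f] by simp
  qed
  ultimately show ?thesis unfolding ideal_gen_def by blast
qed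

lemma monomial_in_monomial_ideal [simp]:
  "(monomial u :: ('v::finite, 'k::field) mpoly) \<in> monomial_ideal U \<longleftrightarrow> u \<in> U"
  by (simp add: monomial_ideal_def monomial_def)

text \<open>Turns minimality of a resolution into the vanishing of constant coefficients.\<close>

lemma ideal_vars: "ideal_gen (range (var :: 'v::finite \<Rightarrow> ('v, 'k::field) mpoly)) = {f. lookup f 0 = 0}"
proof -
  have "ideal_gen (range (var :: 'v \<Rightarrow> ('v, 'k) mpoly)) = monomial_ideal (- {0})"
  proof (rule ideal_gen_eq_monomial_ideal)
    show "up_closed (- {0 :: 'v \<Rightarrow>\<^sub>0 nat})"
      by (auto simp: up_closed_def simp flip: mdeg_eq_0_iff simp: mdeg_add)
    have "single v 1 \<noteq> (0 :: 'v \<Rightarrow>\<^sub>0 nat)" for v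
      by (metis lookup_single_eq lookup_zero zero_neq_one)
    then show "range var \<subseteq> monomial_ideal (- {0 :: 'v \<Rightarrow>\<^sub>0 nat})" by (auto simp: var_def)
  next
    fix u :: "'v \<Rightarrow>\<^sub>0 nat" assume "u \<in> - {0}"
    then obtain v where v: "lookup u v \<noteq> 0" by (auto simp: poly_mapping_eq_iff fun_eq_iff)
    have "u = single v 1 + (u - single v 1)"
      using v by (intro poly_mapping_eqI) (auto simp: lookup_add lookup_minus lookup_single when_def)
    moreover have "monomial (single v 1) \<in> range (var :: 'v \<Rightarrow> ('v, 'k) mpoly)" by (simp add: var_def)
    ultimately show "\<exists>t w. u = t + w \<and> (monomial t :: ('v, 'k) mpoly) \<in> range var" by blast
  qed
  then show ?thesis by (auto simp: monomial_ideal_def in_keys_iff)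
qed

text \<open>Exponents of the multiples of products of \<open>s\<close> edges, repetitions allowed.
  The recursion follows that of \<open>ideal_power\<close>, including the whole ring for
  \<open>s = 0\<close>.\<close>

definition power_exponents :: "'v::finite set set \<Rightarrow> nat \<Rightarrow> ('v \<Rightarrow>\<^sub>0 nat) set" where
  "power_exponents E s = ((\<lambda>U. {single x 1 + single y 1 + w |x y w. {x, y} \<in> E \<and> w \<in> U}) ^^ s) UNIV"

lemma power_exponents_Suc:
  "power_exponents E (Suc s) = {single x 1 + single y 1 + w |x y w. {x, y} \<in> E \<and> w \<in> power_exponents E s}"
  by (simp add: power_exponents_def)

lemma up_closed_power_exponents: "up_closed (power_exponents E s)"
proof (induction s)
  case (Suc s)
  then show ?case unfolding power_exponents_Suc up_closed_def by (auto simp: add.assoc) blast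
qed (simp add: power_exponents_def up_closed_def)

lemma power_exponents_1: "power_exponents E 1 = {single x 1 + single y 1 + w |x y w. {x, y} \<in> E}"
  by (simp add: power_exponents_def)

lemma edge_ideal_eq:
  "(edge_ideal E :: ('v::finite, 'k::field) mpoly set) = monomial_ideal (power_exponents E 1)"
  unfolding edge_ideal_def
proof (rule ideal_gen_eq_monomial_ideal[OF up_closed_power_exponents])
  have eq: "var x * var y = (monomial (single x 1 + single y 1) :: ('v, 'k) mpoly)" for x y
    by (simp add: var_def monomial_def mult_single)
  show "{var x * var y |x y. {x, y} \<in> E} \<subseteq> (monomial_ideal (power_exponents E 1) :: ('v, 'k) mpoly set)"
    unfolding power_exponents_1 eq by (force intro: exI[of _ 0])
  show "\<exists>t w. u = t + w \<and> (monomial t :: ('v, 'k) mpoly) \<in> {var x * var y |x y. {x, y} \<in> E}"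
    if "u \<in> power_exponents E 1" for u
    using that unfolding power_exponents_1 eq by blast
qed

lemma ideal_power_edge_ideal:
  "ideal_power (edge_ideal E :: ('v::finite, 'k::field) mpoly set) s = monomial_ideal (power_exponents E s)"
proof (induction s)
  case 0
  then show ?case by (simp add: monomial_ideal_def power_exponents_def)
next
  case (Suc s)
  let ?I = "monomial_ideal (power_exponents E 1) :: ('v, 'k) mpoly set"
  let ?J = "monomial_ideal (power_exponents E s) :: ('v, 'k) mpoly set"
  have "ideal_gen {a * b |a b. a \<in> ?I \<and> b \<in> ?J} = monomial_ideal (power_exponents E (Suc s))"
  proof (rule ideal_gen_eq_monomial_ideal[OF up_closed_power_exponents])
    have "u \<in> power_exponents E (Suc s)" if "a \<in> ?I" "b \<in> ?J" "u \<in> keys (a * b)" for a b u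
    proof -
      obtain p q where pq: "u = p + q" "p \<in> keys a" "q \<in> keys b" using \<open>u \<in> keys _\<close> keys_mult by blast
      then have "p \<in> power_exponents E 1" "q \<in> power_exponents E s"
        using that by (auto simp: monomial_ideal_def)
      then obtain x y w where "p = single x 1 + single y 1 + w" "{x, y} \<in> E"
        unfolding power_exponents_1 by blast
      moreover have "w + q \<in> power_exponents E s"
        using up_closed_power_exponents[of E s] \<open>q \<in> power_exponents E s\<close>
        unfolding up_closed_def by (metis add.commute)
      ultimately show ?thesis unfolding power_exponents_Suc pq(1) by (auto simp: add.assoc)
    qed
    then show "{a * b |a b. a \<in> ?I \<and> b \<in> ?J} \<subseteq> monomial_ideal (power_exponents E (Suc s))"
      by (auto simp: monomial_ideal_def[of "power_exponents E (Suc s)"])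
  next
    fix u assume "u \<in> power_exponents E (Suc s)"
    then obtain x y w where u: "u = single x 1 + single y 1 + w" "{x, y} \<in> E" "w \<in> power_exponents E s"
      unfolding power_exponents_Suc by blast
    have "single x 1 + single y 1 \<in> power_exponents E 1"
      unfolding power_exponents_1 using u(2) by (force intro: exI[of _ 0])
    then have "monomial (single x 1 + single y 1) \<in> ?I" "monomial w \<in> ?J" using u by auto
    moreover have "(monomial u :: ('v, 'k) mpoly) = monomial (single x 1 + single y 1) * monomial w"
      using u by (simp add: monomial_def mult_single)
    ultimately show "\<exists>t w. u = t + w \<and> monomial t \<in> {a * b |a b. a \<in> ?I \<and> b \<in> ?J}"
      by (intro exI[of _ u] exI[of _ 0] conjI CollectI
          exI[of _ "monomial (single x 1 + single y 1)"] exI[of _ "monomial w"]) simp_all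
  qed
  then show ?case using Suc by (simp add: edge_ideal_eq)
qed

text \<open>In a squarefree monomial no vertex can occur in two of the \<open>s\<close> edges
  dividing it, so these are distinct and disjoint.\<close>

lemma has_matching_squarefree:
  assumes "t \<in> power_exponents E s" "squarefree_exponent t"
  shows "has_matching E s (keys t)"
  using assms
proof (induction s arbitrary: t)
  case 0
  then show ?case by (auto simp: has_matching_def matching_def intro!: exI[of _ "{}"])
next
  case (Suc s)
  then obtain x y w where t: "t = single x 1 + single y 1 + w" "{x, y} \<in> E" "w \<in> power_exponents E s"
    unfolding power_exponents_Suc by blast
  have l: "lookup t v = (if v = x then 1 else 0) + (if v = y then 1 else 0) + lookup w v" for v
    by (simp add: t lookup_add lookup_single when_def)
  have le: "lookup t v \<le> 1" for v using Suc.prems by (simp add: squarefree_exponent_def)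
  have "squarefree_exponent w"
    unfolding squarefree_exponent_def using le l by (metis le_add2 le_trans)
  then obtain M where M: "matching E M" "card M = s" "\<Union>M \<subseteq> keys w"
    using Suc.IH t unfolding has_matching_def by blast
  have "lookup w x = 0" "lookup w y = 0" using le[of x] le[of y] l[of x] l[of y] by auto
  then have n: "x \<notin> \<Union>M" "y \<notin> \<Union>M" using M by (auto simp: in_keys_iff)
  then have "matching E (insert {x, y} M)"
    using M t by (auto simp: matching_def pairwise_insert disjnt_def)
  moreover have "{x, y} \<notin> M" using n by auto
  then have "card (insert {x, y} M) = Suc s" using M by simp
  moreover have "\<Union>(insert {x, y} M) \<subseteq> keys t" using M l by (auto simp: in_keys_iff)
  ultimately show ?case unfolding has_matching_def by blast
qed

lemma expo_in_power_exponents: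
  assumes "simple_graph E" "matching E M"
  shows "expo (\<Union>M) \<in> power_exponents E (card M)"
  using finite[of M] assms(2)
proof (induction M rule: finite_induct)
  case (insert e M)
  have e: "e \<in> E" using insert.prems by (auto simp: matching_def)
  then obtain x y where xy: "e = {x, y}" "x \<noteq> y" using assms(1) by (metis card_2_iff simple_graph_def)
  have "e \<inter> f = {}" if "f \<in> M" for f
    using insert.prems insert.hyps that unfolding matching_def pairwise_def disjnt_def by (metis insertCI)
  then have "x \<notin> \<Union>M" "y \<notin> \<Union>M" using xy by auto
  then have "expo (\<Union>(insert e M)) = single x 1 + single y 1 + expo (\<Union>M)"
    using xy by (simp add: expo_insert add.assoc)
  moreover have "expo (\<Union>M) \<in> power_exponents E (card M)"
    using insert.IH matching_subset[OF insert.prems] by blast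
  ultimately show ?case using insert.hyps e xy by (auto simp: power_exponents_Suc)
qed (simp add: power_exponents_def)

text \<open>Only the support of an exponent matters, because the ideal is generated by squarefree
  monomials.\<close>

definition matching_exponents :: "'v::finite set set \<Rightarrow> nat \<Rightarrow> ('v \<Rightarrow>\<^sub>0 nat) set" where
  "matching_exponents E s = {u. has_matching E s (keys u)}"

lemma keys_add_nat: "keys (u + w) = keys u \<union> keys (w :: 'v \<Rightarrow>\<^sub>0 nat)"
  by (auto simp: in_keys_iff lookup_add)

lemma up_closed_matching_exponents: "up_closed (matching_exponents E s)"
  by (auto simp: up_closed_def matching_exponents_def keys_add_nat intro: has_matching_mono)

lemma squarefree_power_eq:
  fixes E :: "'v::finite set set"
  assumes "simple_graph E"
  shows "squarefree_power (edge_ideal E) s =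
    (monomial_ideal (matching_exponents E s) :: ('v, 'k::field) mpoly set)"
  unfolding squarefree_power_def ideal_power_edge_ideal
proof (rule ideal_gen_eq_monomial_ideal[OF up_closed_matching_exponents])
  show "{monomial u |u. squarefree_exponent u \<and> monomial u \<in>
      (monomial_ideal (power_exponents E s) :: ('v, 'k) mpoly set)} \<subseteq>
      (monomial_ideal (matching_exponents E s) :: ('v, 'k) mpoly set)"
    using has_matching_squarefree by (auto simp: matching_exponents_def)
next
  fix u assume "u \<in> matching_exponents E s"
  then obtain M where M: "matching E M" "card M = s" "\<Union>M \<subseteq> keys u"
    unfolding matching_exponents_def has_matching_def by blast
  have "u = expo (\<Union>M) + (u - expo (\<Union>M))"
  proof (rule poly_mapping_eqI)
    fix v
    show "lookup u v = lookup (expo (\<Union>M) + (u - expo (\<Union>M))) v"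
      using M(3) by (cases "v \<in> \<Union>M") (auto simp: lookup_add lookup_minus in_keys_iff)
  qed
  moreover have "squarefree_exponent (expo (\<Union>M))" by (simp add: squarefree_exponent_def)
  moreover have "expo (\<Union>M) \<in> power_exponents E s" using expo_in_power_exponents[OF assms M(1)] M by simp
  ultimately show "\<exists>t w. u = t + w \<and> (monomial t :: ('v, 'k) mpoly) \<in> {monomial u |u. squarefree_exponent u \<and>
      (monomial u :: ('v, 'k) mpoly) \<in> monomial_ideal (power_exponents E s)}"
    by (intro exI[of _ "expo (\<Union>M)"] exI[of _ "u - expo (\<Union>M)"]) auto
qed


section \<open>Multigraded Koszul homology\<close>

text \<open>\<open>B\<close> stands for the Koszul basis element indexed by
  \<open>keys a - B\<close>, whose coefficient in multidegree \<open>a\<close> is a multiple of the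
  monomial with exponent \<open>a - expo (keys a - B)\<close>. With complements as indices, the
  differential enlarges sets and the family of an ideal is closed under enlarging within
  \<open>keys a\<close>.\<close>

definition degree_family :: "('v::finite \<Rightarrow>\<^sub>0 nat) set \<Rightarrow> ('v \<Rightarrow>\<^sub>0 nat) \<Rightarrow> 'v set set" where
  "degree_family Q a = {B. B \<subseteq> keys a \<and> a - expo (keys a - B) \<in> Q}"

text \<open>The condition \<open>complement\<close> holds for the usual sign \<open>(-1)\<close> to the number of smaller elements. It
  turns the Koszul differential in a multidegree with support \<open>A\<close>, where \<open>B\<close> belongs to the basis
  element indexed by \<open>A - B\<close>, into the coboundary with signs \<open>twist A\<close>.\<close>

locale koszul =
  fixes sg :: "'v::finite \<Rightarrow> 'v set \<Rightarrow> 'k::field"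
  assumes sign: "sign_function sg"
    and complement: "B \<subseteq> A \<Longrightarrow> sg v (insert v (A - B)) = sg v A * sg v B"
begin

definition twist :: "'v set \<Rightarrow> 'v \<Rightarrow> 'v set \<Rightarrow> 'k" where
  "twist A v B = sg v A * sg v B"

text \<open>The Koszul differential in coordinates: a chain assigns a coefficient to every basis
  element, and the coefficient of the boundary at \<open>\<tau>\<close> collects contributions from
  the sets with one more element.\<close>

definition kb :: "('v set \<Rightarrow> ('v, 'k) mpoly) \<Rightarrow> 'v set \<Rightarrow> ('v, 'k) mpoly" where
  "kb c \<tau> = (\<Sum>v\<in>- \<tau>. single (single v 1) (sg v (insert v \<tau>)) * c (insert v \<tau>))"

lemma sign_sq: "sg v B * sg v B = 1"
  by (rule sign_function_sq[OF sign])

lemma sign_swap: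
  assumes "v \<notin> \<tau>" "w \<notin> \<tau>" "v \<noteq> w"
  shows "sg v (insert v \<tau>) * sg w (insert w (insert v \<tau>)) =
    - (sg w (insert w \<tau>) * sg v (insert v (insert w \<tau>)))"
proof -
  let ?\<rho> = "insert w (insert v \<tau>)"
  have "?\<rho> - {w} = insert v \<tau>" "?\<rho> - {v} = insert w \<tau>" "insert v (insert w \<tau>) = ?\<rho>" using assms by auto
  moreover have "sg v (?\<rho> - {w}) * sg w ?\<rho> = - (sg w (?\<rho> - {v}) * sg v ?\<rho>)"
    using assms by (intro sign_function_swap[OF sign]) simp_all
  ultimately show ?thesis by (simp only:)
qed

lemma sign_function_twist: "sign_function (twist A)"
  unfolding sign_function_def twist_def
proof (intro conjI allI impI)
  fix v B
  have "sg v A * sg v B * (sg v A * sg v B) = (sg v A * sg v A) * (sg v B * sg v B)" by (simp only: mult_ac)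
  then show "sg v A * sg v B * (sg v A * sg v B) = 1" by (simp add: sign_sq)
next
  fix v w :: 'v and B assume "v \<in> B" "w \<in> B" "v \<noteq> w"
  then have "sg v (B - {w}) * sg w B = - (sg w (B - {v}) * sg v B)"
    by (rule sign_function_swap[OF sign])
  moreover have "sg v A * sg v (B - {w}) * (sg w A * sg w B) = sg v A * sg w A * (sg v (B - {w}) * sg w B)"
    "sg w A * sg w (B - {v}) * (sg v A * sg v B) = sg v A * sg w A * (sg w (B - {v}) * sg v B)"
    by (simp_all only: mult_ac)
  ultimately show "sg v A * sg v (B - {w}) * (sg w A * sg w B) = - (sg w A * sg w (B - {v}) * (sg v A * sg v B))"
    by (simp only: mult_minus_right)
qed

lemma kb_diff: "kb (\<lambda>\<sigma>. c \<sigma> - c' \<sigma>) \<tau> = kb c \<tau> - kb c' \<tau>"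
  by (simp add: kb_def algebra_simps sum_subtractf)

lemma kb_0 [simp]: "kb (\<lambda>_. 0) \<tau> = 0"
  by (simp add: kb_def)

lemma kb_kb: "kb (kb c) \<tau> = 0"
proof -
  let ?s = "\<lambda>(v::'v) \<tau>. single (single v (1::nat)) (sg v (insert v \<tau>))"
  have "kb (kb c) \<tau> = (\<Sum>v\<in>- \<tau>. \<Sum>w\<in>- \<tau> - {v}. ?s v \<tau> * ?s w (insert v \<tau>) * c (insert w (insert v \<tau>)))"
    unfolding kb_def sum_distrib_left
  proof (intro sum.cong refl)
    show "- insert v \<tau> = - \<tau> - {v}" for v by auto
  qed (simp add: mult.assoc)
  also have "\<dots> = 0"
  proof (rule sum_antisymmetric_pairs)
    fix v w assume vw: "v \<in> - \<tau>" "w \<in> - \<tau>" "v \<noteq> w"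
    have "?s v \<tau> * ?s w (insert v \<tau>) = - (?s w \<tau> * ?s v (insert w \<tau>))"
      using vw sign_swap[of v \<tau> w] by (simp add: mult_single single_uminus add.commute)
    then show "?s v \<tau> * ?s w (insert v \<tau>) * c (insert w (insert v \<tau>)) =
        - (?s w \<tau> * ?s v (insert w \<tau>) * c (insert v (insert w \<tau>)))"
      by (simp add: insert_commute)
  qed simp
  finally show ?thesis .
qed

lemma lookup_kb:
  "lookup (kb c \<tau>) u = (\<Sum>v\<in>- \<tau>. if lookup u v = 0 then 0
     else sg v (insert v \<tau>) * lookup (c (insert v \<tau>)) (u - single v 1))"
  unfolding kb_def lookup_sum by (intro sum.cong refl) (simp only: lookup_single_single_times)

definition multidegree_part :: "('v \<Rightarrow>\<^sub>0 nat) \<Rightarrow> ('v set \<Rightarrow> ('v, 'k) mpoly) \<Rightarrow> 'v set \<Rightarrow> 'k" where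
  "multidegree_part a c B =
     (if B \<subseteq> keys a then lookup (c (keys a - B)) (a - expo (keys a - B)) else 0)"

text \<open>The differential preserves the multidegree. A variable outside of \<open>keys a\<close>
  does not divide the monomial in question, so only \<open>v\<close> in \<open>B\<close> contribute,
  and \<open>complement\<close> rewrites the signs as \<open>twist (keys a)\<close>.\<close>

lemma lookup_kb_multidegree:
  assumes B: "B \<subseteq> keys a"
  shows "lookup (kb c (keys a - B)) (a - expo (keys a - B)) =
    coboundary (twist (keys a)) (multidegree_part a c) B"
proof -
  let ?\<tau> = "keys a - B" let ?u = "a - expo (keys a - B)"
  have "lookup (kb c ?\<tau>) ?u = (\<Sum>v\<in>B. sg v (insert v ?\<tau>) * lookup (c (insert v ?\<tau>)) (?u - single v 1))"
    unfolding lookup_kb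
  proof (rule sum.mono_neutral_cong_right)
    show "B \<subseteq> - ?\<tau>" by auto
    show "\<forall>v\<in>- ?\<tau> - B. (if lookup ?u v = 0 then 0
        else sg v (insert v ?\<tau>) * lookup (c (insert v ?\<tau>)) (?u - single v 1)) = 0"
      by (auto simp: lookup_minus in_keys_iff)
    fix v assume v: "v \<in> B"
    then have "lookup ?u v \<noteq> 0" using B by (auto simp: lookup_minus in_keys_iff)
    then show "(if lookup ?u v = 0 then 0
        else sg v (insert v ?\<tau>) * lookup (c (insert v ?\<tau>)) (?u - single v 1)) =
        sg v (insert v ?\<tau>) * lookup (c (insert v ?\<tau>)) (?u - single v 1)" by simp
  qed simp
  also have "\<dots> = coboundary (twist (keys a)) (multidegree_part a c) B"
    unfolding coboundary_def
  proof (rule sum.cong[OF refl])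
    fix v assume v: "v \<in> B"
    have 1: "insert v ?\<tau> = keys a - (B - {v})" using v B by auto
    have 2: "?u - single v 1 = a - expo (keys a - (B - {v}))"
      by (rule poly_mapping_eqI) (use v B in \<open>auto simp: lookup_minus lookup_single when_def\<close>)
    have "multidegree_part a c (B - {v}) = lookup (c (keys a - (B - {v}))) (a - expo (keys a - (B - {v})))"
      using B by (auto simp: multidegree_part_def)
    then show "sg v (insert v ?\<tau>) * lookup (c (insert v ?\<tau>)) (?u - single v 1) =
        twist (keys a) v B * multidegree_part a c (B - {v})"
      using complement[OF B, of v] 1 2 by (simp add: twist_def)
  qed
  finally show ?thesis .
qed

text \<open>The basis element indexed by \<open>\<sigma>\<close> has degree
  \<open>card \<sigma>\<close>; thus \<open>j\<close> is the total degree and \<open>p\<close> the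
  homological degree.\<close>

definition koszul_chain :: "('v \<Rightarrow>\<^sub>0 nat) set \<Rightarrow> nat \<Rightarrow> int \<Rightarrow> ('v set \<Rightarrow> ('v, 'k) mpoly) \<Rightarrow> bool" where
  "koszul_chain Q p j c \<longleftrightarrow>
     (\<forall>\<sigma>. keys (c \<sigma>) \<subseteq> Q \<and> homogeneous (j - int (card \<sigma>)) (c \<sigma>) \<and> (c \<sigma> \<noteq> 0 \<longrightarrow> card \<sigma> = p))"

lemma degree_family_insert:
  assumes up: "up_closed Q" and v: "v \<in> B" "B \<subseteq> keys a" and fam: "B - {v} \<in> degree_family Q a"
  shows "B \<in> degree_family Q a"
proof -
  have "a - expo (keys a - B) = (a - expo (keys a - (B - {v}))) + single v 1"
  proof (rule poly_mapping_eqI)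
    fix x
    have "lookup a v \<noteq> 0" using v by (auto simp: in_keys_iff)
    then show "lookup (a - expo (keys a - B)) x = lookup (a - expo (keys a - (B - {v})) + single v 1) x"
      using v by (auto simp: lookup_minus lookup_add lookup_single when_def)
  qed
  then show ?thesis using up fam v unfolding degree_family_def up_closed_def by simp
qed

lemma multidegree_part_support:
  assumes c: "koszul_chain Q p j c" and nz: "multidegree_part a c B \<noteq> 0"
  shows "B \<in> degree_family Q a" and "card B + p = card (keys a)"
proof -
  have B: "B \<subseteq> keys a" and l: "lookup (c (keys a - B)) (a - expo (keys a - B)) \<noteq> 0"
    using nz by (auto simp: multidegree_part_def split: if_splits)
  then have "a - expo (keys a - B) \<in> keys (c (keys a - B))" by (simp add: in_keys_iff)
  then show "B \<in> degree_family Q a" using c B unfolding koszul_chain_def degree_family_def by blast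
  have "c (keys a - B) \<noteq> 0" using l by auto
  then have "card (keys a - B) = p" using c unfolding koszul_chain_def by blast
  moreover have "card (keys a - B) + card B = card (keys a)"
    using B by (metis card_Diff_subset card_mono finite finite_keys le_add_diff_inverse2)
  ultimately show "card B + p = card (keys a)" by simp
qed

text \<open>The bounding chain is found in each multidegree of total degree \<open>j\<close>
  separately, and the pieces are assembled into polynomials.\<close>

lemma koszul_exact:
  assumes up: "up_closed Q"
    and acyclic: "\<And>a b. int (mdeg a) = j \<Longrightarrow> b + p = card (keys a) \<Longrightarrow>
      acyclic_at (twist (keys a)) (degree_family Q a) b"
    and c: "koszul_chain Q p j c" and cycle: "\<And>\<tau>. kb c \<tau> = 0"
  shows "\<exists>c'. koszul_chain Q (Suc p) j c' \<and> (\<forall>\<tau>. c \<tau> = kb c' \<tau>)"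
proof -
  have "\<exists>g. (\<forall>B. g B \<noteq> 0 \<longrightarrow> B \<in> degree_family Q a \<and> Suc (card B + p) = card (keys a)) \<and>
      (\<forall>B\<subseteq>keys a. multidegree_part a c B = coboundary (twist (keys a)) g B)"
    if a: "int (mdeg a) = j" for a
  proof (cases "p \<le> card (keys a)")
    case False
    have "multidegree_part a c B = 0" for B
      using multidegree_part_support(2)[OF c, of a B] False by fastforce
    then show ?thesis by (intro exI[of _ "\<lambda>_. 0"]) (simp add: coboundary_def)
  next
    case True
    then obtain b where b: "b + p = card (keys a)" by (metis add.commute le_Suc_ex)
    have "cochain (degree_family Q a) b (multidegree_part a c)"
      using multidegree_part_support[OF c, of a] b unfolding cochain_def by fastforce
    moreover have "coboundary (twist (keys a)) (multidegree_part a c) B = 0"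
      if "B \<in> degree_family Q a" for B
      using lookup_kb_multidegree[of B a c] that cycle by (simp add: degree_family_def)
    ultimately obtain g where g: "\<And>B. g B \<noteq> 0 \<Longrightarrow> B \<in> degree_family Q a \<and> Suc (card B) = b"
      and g': "\<And>B. B \<in> degree_family Q a \<Longrightarrow> card B = b \<Longrightarrow>
        multidegree_part a c B = coboundary (twist (keys a)) g B"
      by (rule acyclic_atE[OF acyclic[OF a b]]) auto
    \<comment> \<open>Equality of polynomials concerns all \<open>B\<close>, whereas acyclicity only
      speaks of members of size \<open>b\<close>. For the other sets both sides vanish: a nonzero
      \<open>g (B - {v})\<close> would make \<open>B\<close> a member of size \<open>b\<close>, as
      the family is closed under enlarging.\<close>
    have "multidegree_part a c B = coboundary (twist (keys a)) g B" if B: "B \<subseteq> keys a" for B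
    proof (cases "B \<in> degree_family Q a \<and> card B = b")
      case True
      then show ?thesis using g' by simp
    next
      case False
      have "multidegree_part a c B = 0"
        using multidegree_part_support[OF c, of a B] b False by fastforce
      moreover have "g (B - {v}) = 0" if v: "v \<in> B" for v
      proof (rule ccontr)
        assume "g (B - {v}) \<noteq> 0"
        then have "B - {v} \<in> degree_family Q a" "Suc (card (B - {v})) = b" using g by auto
        moreover have "Suc (card (B - {v})) = card B" using v by (metis card_Suc_Diff1 finite)
        ultimately show False using False degree_family_insert[OF up v B] by simp
      qed
      ultimately show ?thesis by (simp add: coboundary_def)
    qed
    moreover have "B \<in> degree_family Q a \<and> Suc (card B + p) = card (keys a)" if "g B \<noteq> 0" for B
      using g[OF that] b by simp
    ultimately show ?thesis by (intro exI[of _ g]) simp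
  qed
  then obtain g where g: "\<And>a B. int (mdeg a) = j \<Longrightarrow> g a B \<noteq> 0 \<Longrightarrow>
      B \<in> degree_family Q a \<and> Suc (card B + p) = card (keys a)"
    and g': "\<And>a B. int (mdeg a) = j \<Longrightarrow> B \<subseteq> keys a \<Longrightarrow>
      multidegree_part a c B = coboundary (twist (keys a)) (g a) B"
    by metis
  \<comment> \<open>The exponent \<open>u\<close> at the basis element \<open>\<sigma>\<close>
    occurs in the single multidegree \<open>u + expo \<sigma>\<close>, so the solution for that
    multidegree prescribes the coefficient. Only finitely many \<open>u\<close> have the required
    degree.\<close>
  define c' where "c' \<sigma> = (\<Sum>u\<in>{u. int (mdeg u) = j - int (card \<sigma>)}.
      single u (g (u + expo \<sigma>) (keys (u + expo \<sigma>) - \<sigma>)))" for \<sigma>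
  have lookup_c': "lookup (c' \<sigma>) u =
      (if int (mdeg u) = j - int (card \<sigma>) then g (u + expo \<sigma>) (keys (u + expo \<sigma>) - \<sigma>) else 0)" for \<sigma> u
    by (simp add: c'_def lookup_sum lookup_single when_def finite_mdeg)
  have mdeg_shift: "int (mdeg (u + expo \<sigma>)) = j" if "int (mdeg u) = j - int (card \<sigma>)" for u \<sigma>
    using that by (simp add: mdeg_add mdeg_expo)
  have shift: "keys (u + expo \<sigma>) - (keys (u + expo \<sigma>) - \<sigma>) = \<sigma>" "u + expo \<sigma> - expo \<sigma> = u" for u :: "'v \<Rightarrow>\<^sub>0 nat" and \<sigma>
    by (auto simp: keys_add_nat keys_expo)
  have chain': "koszul_chain Q (Suc p) j c'"
    unfolding koszul_chain_def
  proof (intro allI conjI impI)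
    fix \<sigma>
    have *: "u \<in> Q \<and> card \<sigma> = Suc p \<and> int (mdeg u) = j - int (card \<sigma>)" if "u \<in> keys (c' \<sigma>)" for u
    proof -
      have u: "int (mdeg u) = j - int (card \<sigma>)" "g (u + expo \<sigma>) (keys (u + expo \<sigma>) - \<sigma>) \<noteq> 0"
        using that by (auto simp: in_keys_iff lookup_c' split: if_splits)
      have "keys (u + expo \<sigma>) - \<sigma> \<in> degree_family Q (u + expo \<sigma>)"
        and k: "Suc (card (keys (u + expo \<sigma>) - \<sigma>) + p) = card (keys (u + expo \<sigma>))"
        using g[OF mdeg_shift[OF u(1)] u(2)] by auto
      then have "u \<in> Q" unfolding degree_family_def by (simp add: shift)
      moreover have "card (keys (u + expo \<sigma>) - \<sigma>) + card \<sigma> = card (keys (u + expo \<sigma>))"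
      proof -
        have "\<sigma> \<subseteq> keys (u + expo \<sigma>)" by (simp add: keys_add_nat keys_expo)
        then show ?thesis
          by (metis card_Diff_subset card_mono finite finite_keys le_add_diff_inverse2)
      qed
      ultimately show ?thesis using k u by simp
    qed
    show "keys (c' \<sigma>) \<subseteq> Q" "homogeneous (j - int (card \<sigma>)) (c' \<sigma>)"
      using * by (auto simp: homogeneous_def)
    assume "c' \<sigma> \<noteq> 0"
    then obtain u where "u \<in> keys (c' \<sigma>)"
      by (metis in_keys_iff lookup_zero poly_mapping_eqI)
    then show "card \<sigma> = Suc p" using * by blast
  qed
  have "c \<tau> = kb c' \<tau>" for \<tau>
  proof (rule poly_mapping_eqI)
    fix u
    show "lookup (c \<tau>) u = lookup (kb c' \<tau>) u"
    proof (cases "int (mdeg u) = j - int (card \<tau>)")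
      case False
      have "homogeneous (j - int (card \<tau>)) (c \<tau>)" using c by (simp add: koszul_chain_def)
      then have "lookup (c \<tau>) u = 0" using False by (auto simp: homogeneous_def in_keys_iff)
      moreover have "homogeneous (j - int (card \<tau>)) (kb c' \<tau>)"
        unfolding kb_def
      proof (rule homogeneous_sum)
        fix v assume v: "v \<in> - \<tau>"
        have "homogeneous (1 + (j - int (card (insert v \<tau>))))
            (single (single v 1) (sg v (insert v \<tau>)) * c' (insert v \<tau>))"
          using chain' by (intro homogeneous_mult homogeneous_single) (simp_all add: mdeg_single koszul_chain_def)
        then show "homogeneous (j - int (card \<tau>)) (single (single v 1) (sg v (insert v \<tau>)) * c' (insert v \<tau>))"
          using v by simp
      qed
      then have "lookup (kb c' \<tau>) u = 0" using False by (auto simp: homogeneous_def in_keys_iff)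
      ultimately show ?thesis by simp
    next
      case True
      define a where "a = u + expo \<tau>"
      define B where "B = keys a - \<tau>"
      have a: "int (mdeg a) = j" using mdeg_shift[OF True] by (simp add: a_def)
      have B: "B \<subseteq> keys a" "keys a - B = \<tau>" "a - expo \<tau> = u" using shift[of u \<tau>] by (auto simp: a_def B_def)
      have "multidegree_part a c' B' = g a B'" if B': "B' \<subseteq> keys a" for B'
      proof -
        let ?\<sigma> = "keys a - B'"
        have 1: "a - expo ?\<sigma> + expo ?\<sigma> = a"
          by (rule poly_mapping_eqI) (auto simp: lookup_add lookup_minus in_keys_iff)
        then have "mdeg (a - expo ?\<sigma>) + card ?\<sigma> = mdeg a" by (metis mdeg_add mdeg_expo)
        then have "int (mdeg (a - expo ?\<sigma>)) = j - int (card ?\<sigma>)" using a by linarith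
        moreover have "keys a - ?\<sigma> = B'" using B' by auto
        ultimately show ?thesis using B' by (simp add: multidegree_part_def lookup_c' 1)
      qed
      then have "coboundary (twist (keys a)) (multidegree_part a c') B = coboundary (twist (keys a)) (g a) B"
        using B(1) by (intro coboundary_cong) (metis Diff_subset order_trans)
      then have "lookup (kb c' \<tau>) u = multidegree_part a c B"
        using lookup_kb_multidegree[OF B(1), of c'] g'[OF a B(1)] B by simp
      then show ?thesis using B by (simp add: multidegree_part_def)
    qed
  qed
  then show ?thesis using chain' by blast
qed

text \<open>A cocycle of the family is turned into a Koszul cycle concentrated in multidegree
  \<open>a\<close>; the part in multidegree \<open>a\<close> of a chain bounding it is the cochain
  sought.\<close>

lemma koszul_exact_imp_acyclic:
  assumes up: "up_closed Q" and a: "int (mdeg a) = j" and b: "b + p = card (keys a)"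
    and exact: "\<And>c. koszul_chain Q p j c \<Longrightarrow> (\<And>\<tau>. kb c \<tau> = 0) \<Longrightarrow>
      \<exists>c'. koszul_chain Q (Suc p) j c' \<and> (\<forall>\<tau>. c \<tau> = kb c' \<tau>)"
  shows "acyclic_at (twist (keys a)) (degree_family Q a) b"
  unfolding acyclic_at_def
proof (intro allI impI)
  fix g assume g: "cochain (degree_family Q a) b g"
    and cocycle: "\<forall>B\<in>degree_family Q a. card B = Suc b \<longrightarrow> coboundary (twist (keys a)) g B = 0"
  define c where "c \<sigma> = (if \<sigma> \<subseteq> keys a then single (a - expo \<sigma>) (g (keys a - \<sigma>)) else 0)" for \<sigma>
  have part: "multidegree_part a c B = g B" for B
  proof (cases "B \<subseteq> keys a")
    case True
    then have "keys a - (keys a - B) = B" by auto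
    then show ?thesis using True by (simp add: multidegree_part_def c_def)
  next
    case False
    then have "g B = 0" using g by (auto simp: cochain_def degree_family_def)
    then show ?thesis using False by (simp add: multidegree_part_def)
  qed
  have chain: "koszul_chain Q p j c"
    unfolding koszul_chain_def
  proof (intro allI conjI impI)
    fix \<sigma>
    show "homogeneous (j - int (card \<sigma>)) (c \<sigma>)"
    proof (cases "\<sigma> \<subseteq> keys a")
      case True
      then have "a - expo \<sigma> + expo \<sigma> = a"
        by (intro poly_mapping_eqI) (auto simp: lookup_add lookup_minus in_keys_iff)
      then have "mdeg (a - expo \<sigma>) + card \<sigma> = mdeg a" by (metis mdeg_add mdeg_expo)
      then have "int (mdeg (a - expo \<sigma>)) = j - int (card \<sigma>)" using a by linarith
      then show ?thesis using True by (simp add: c_def homogeneous_single)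
    qed (simp add: c_def)
    have *: "a - expo \<sigma> \<in> Q \<and> card \<sigma> = p" if "\<sigma> \<subseteq> keys a" "g (keys a - \<sigma>) \<noteq> 0"
    proof -
      have "keys a - \<sigma> \<in> degree_family Q a" "card (keys a - \<sigma>) = b" using that g by (auto simp: cochain_def)
      moreover have "keys a - (keys a - \<sigma>) = \<sigma>" using that by auto
      moreover have "card (keys a - \<sigma>) + card \<sigma> = card (keys a)"
        using that by (metis card_Diff_subset card_mono finite finite_keys le_add_diff_inverse2)
      ultimately show ?thesis using b by (simp add: degree_family_def)
    qed
    show "keys (c \<sigma>) \<subseteq> Q" using * by (auto simp: c_def split: if_splits)
    show "card \<sigma> = p" if "c \<sigma> \<noteq> 0" using that * by (metis c_def single_zero)
  qed
  have "kb c \<tau> = 0" for \<tau>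
  proof (rule poly_mapping_eqI)
    fix u
    show "lookup (kb c \<tau>) u = lookup 0 u"
    proof (cases "\<tau> \<subseteq> keys a \<and> u = a - expo \<tau>")
      case True
      define B where "B = keys a - \<tau>"
      have B: "B \<subseteq> keys a" "keys a - B = \<tau>" using True by (auto simp: B_def)
      have "lookup (kb c \<tau>) u = coboundary (twist (keys a)) g B"
        using lookup_kb_multidegree[OF B(1), of c] B True part
        by (metis (no_types, lifting) coboundary_cong)
      moreover have "coboundary (twist (keys a)) g B = 0"
      proof (cases "B \<in> degree_family Q a \<and> card B = Suc b")
        case False
        have "g (B - {v}) = 0" if v: "v \<in> B" for v
        proof (rule ccontr)
          assume "g (B - {v}) \<noteq> 0"
          then have "B - {v} \<in> degree_family Q a" "card (B - {v}) = b" using g by (auto simp: cochain_def)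
          moreover have "Suc (card (B - {v})) = card B" using v by (metis card_Suc_Diff1 finite)
          ultimately show False using False degree_family_insert[OF up v B(1)] by simp
        qed
        then show ?thesis by (simp add: coboundary_def)
      qed (use cocycle in auto)
      ultimately show ?thesis by simp
    next
      case False
      have "lookup (c (insert v \<tau>)) (u - single v 1) = 0" if v: "v \<in> - \<tau>" "lookup u v \<noteq> 0" for v
      proof (rule ccontr)
        assume "lookup (c (insert v \<tau>)) (u - single v 1) \<noteq> 0"
        then have s: "insert v \<tau> \<subseteq> keys a" and eq: "u - single v 1 = a - expo (insert v \<tau>)"
          by (auto simp: c_def lookup_single when_def split: if_splits)
        have "u = a - expo \<tau>"
        proof (rule poly_mapping_eqI)
          fix x
          have "lookup (u - single v 1) x = lookup (a - expo (insert v \<tau>)) x" using eq by simp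
          then show "lookup u x = lookup (a - expo \<tau>) x"
            using v s by (auto simp: lookup_minus lookup_single when_def in_keys_iff split: if_splits)
        qed
        then show False using False s by simp
      qed
      then show ?thesis unfolding lookup_kb by (simp add: sum.neutral)
    qed
  qed
  then obtain c' where c': "koszul_chain Q (Suc p) j c'" "\<And>\<tau>. c \<tau> = kb c' \<tau>"
    using exact[OF chain] by blast
  have "multidegree_part a c' B \<noteq> 0 \<longrightarrow> B \<in> degree_family Q a \<and> Suc (card B) = b" for B
    using multidegree_part_support[OF c'(1), of a B] b by auto
  moreover have "g B = coboundary (twist (keys a)) (multidegree_part a c') B" if "B \<in> degree_family Q a" for B
  proof -
    have B: "B \<subseteq> keys a" using that by (simp add: degree_family_def)
    have "g B = lookup (c (keys a - B)) (a - expo (keys a - B))"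
      using part[of B] B by (simp add: multidegree_part_def)
    then show ?thesis using lookup_kb_multidegree[OF B, of c'] c'(2) by simp
  qed
  ultimately show "\<exists>c'. (\<forall>B. c' B \<noteq> 0 \<longrightarrow> B \<in> degree_family Q a \<and> Suc (card B) = b) \<and>
      (\<forall>B\<in>degree_family Q a. card B = b \<longrightarrow> g B = coboundary (twist (keys a)) c' B)"
    by blast
qed

end


section \<open>Koszul homology and minimal presentations\<close>

definition vscale :: "'a::comm_ring_1 \<Rightarrow> (nat \<Rightarrow> 'a) \<Rightarrow> nat \<Rightarrow> 'a" where
  "vscale p f = (\<lambda>l. p * f l)"

definition vhom :: "(nat \<Rightarrow> int) \<Rightarrow> int \<Rightarrow> (nat \<Rightarrow> ('v::finite, 'k::field) mpoly) \<Rightarrow> bool" where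
  "vhom deg j f \<longleftrightarrow> (\<forall>k. homogeneous (j - deg k) (f k))"

definition vcomp ::
  "(nat \<Rightarrow> int) \<Rightarrow> int \<Rightarrow> (nat \<Rightarrow> ('v::finite, 'k::field) mpoly) \<Rightarrow> nat \<Rightarrow> ('v, 'k) mpoly" where
  "vcomp deg j f = (\<lambda>k. hcomp (j - deg k) (f k))"

definition vectors :: "nat \<Rightarrow> (nat \<Rightarrow> 'a::zero) set" where
  "vectors r = {f. \<forall>k\<ge>r. f k = 0}"

definition lin :: "nat \<Rightarrow> (nat \<Rightarrow> nat \<Rightarrow> 'a::comm_ring_1) \<Rightarrow> (nat \<Rightarrow> 'a) \<Rightarrow> nat \<Rightarrow> 'a" where
  "lin r D f = (\<lambda>l. \<Sum>k<r. f k * D k l)"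

definition graded_submodule ::
  "(nat \<Rightarrow> int) \<Rightarrow> (nat \<Rightarrow> ('v::finite, 'k::field) mpoly) set \<Rightarrow> bool" where
  "graded_submodule deg M \<longleftrightarrow> module.subspace vscale M \<and> (\<forall>f\<in>M. \<forall>j. vcomp deg j f \<in> M)"

definition graded_matrix ::
  "nat \<Rightarrow> (nat \<Rightarrow> int) \<Rightarrow> (nat \<Rightarrow> int) \<Rightarrow> (nat \<Rightarrow> nat \<Rightarrow> ('v::finite, 'k::field) mpoly) \<Rightarrow> bool" where
  "graded_matrix r deg deg0 D \<longleftrightarrow> (\<forall>k<r. vhom deg0 (deg k) (D k))"

definition lin_kernel :: "nat \<Rightarrow> (nat \<Rightarrow> nat \<Rightarrow> 'a::comm_ring_1) \<Rightarrow> (nat \<Rightarrow> 'a) set" where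
  "lin_kernel r D = {f \<in> vectors r. lin r D f = (\<lambda>_. 0)}"

definition minimal_kernel :: "(nat \<Rightarrow> ('v::finite, 'k::field) mpoly) set \<Rightarrow> bool" where
  "minimal_kernel K \<longleftrightarrow> (\<forall>f\<in>K. \<forall>k. lookup (f k) 0 = 0)"

interpretation vec: module "vscale :: 'a::comm_ring_1 \<Rightarrow> _"
  by unfold_locales (simp_all add: vscale_def fun_eq_iff algebra_simps)

lemma vhom_0 [simp]: "vhom deg j (\<lambda>_. 0)"
  by (simp add: vhom_def)

lemma vhom_diff: "vhom deg j f \<Longrightarrow> vhom deg j g \<Longrightarrow> vhom deg j (\<lambda>k. f k - g k)"
  by (simp add: vhom_def homogeneous_diff)

lemma vhom_vcomp [simp]: "vhom deg j (vcomp deg j f)"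
  by (simp add: vhom_def vcomp_def)

lemma vcomp_vhom:
  assumes "vhom deg j f"
  shows "vcomp deg i f = (if i = j then f else (\<lambda>_. 0))"
proof
  fix k
  have "homogeneous (j - deg k) (f k)" using assms by (simp add: vhom_def)
  from hcomp_homogeneous[OF this, of "i - deg k"]
  show "vcomp deg i f k = (if i = j then f else (\<lambda>_. 0)) k" by (simp add: vcomp_def)
qed

lemma vcomp_vectors: "f \<in> vectors r \<Longrightarrow> vcomp deg j f \<in> vectors r"
  by (simp add: vectors_def vcomp_def)

lemma subspace_vectors: "vec.subspace (vectors r)"
  by (rule vec.subspaceI) (simp_all add: vectors_def vscale_def)

lemma lin_add: "lin r D (f + g) = lin r D f + lin r D g"
  by (simp add: lin_def fun_eq_iff algebra_simps sum.distrib)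

lemma lin_diff: "lin r D (\<lambda>k. f k - g k) = (\<lambda>l. lin r D f l - lin r D g l)"
  by (simp add: lin_def fun_eq_iff algebra_simps sum_subtractf)

lemma lin_vscale: "lin r D (vscale p f) = vscale p (lin r D f)"
  by (simp add: lin_def vscale_def sum_distrib_left mult.assoc)

lemma lin_0 [simp]: "lin r D (\<lambda>_. 0) = (\<lambda>_. 0)"
  by (simp add: lin_def)

lemma subspace_lin_image: "vec.subspace (lin r D ` vectors r)"
proof (rule vec.subspaceI)
  show "0 \<in> lin r D ` vectors r"
    by (rule image_eqI[of _ _ "\<lambda>_. 0"]) (simp_all add: vectors_def fun_eq_iff)
next
  fix x y assume "x \<in> lin r D ` vectors r" "y \<in> lin r D ` vectors r"
  then obtain f g where "x = lin r D f" "f \<in> vectors r" "y = lin r D g" "g \<in> vectors r" by blast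
  then show "x + y \<in> lin r D ` vectors r"
    using vec.subspace_add[OF subspace_vectors]
    by (intro image_eqI[of _ _ "f + g"]) (simp_all only: lin_add)
next
  fix c x assume "x \<in> lin r D ` vectors r"
  then obtain f where "x = lin r D f" "f \<in> vectors r" by blast
  then show "vscale c x \<in> lin r D ` vectors r"
    using vec.subspace_scale[OF subspace_vectors]
    by (intro image_eqI[of _ _ "vscale c f"]) (simp_all only: lin_vscale)
qed

lemma subspace_lin_kernel: "vec.subspace (lin_kernel r D)"
proof (rule vec.subspaceI)
  show "0 \<in> lin_kernel r D"
    by (simp add: lin_kernel_def vectors_def lin_def)
  show "x + y \<in> lin_kernel r D" if "x \<in> lin_kernel r D" "y \<in> lin_kernel r D" for x y
    using that vec.subspace_add[OF subspace_vectors, of x r y]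
    by (simp add: lin_kernel_def lin_add fun_eq_iff)
  show "vscale c x \<in> lin_kernel r D" if "x \<in> lin_kernel r D" for c x
    using that vec.subspace_scale[OF subspace_vectors, of x r c]
    by (simp add: lin_kernel_def lin_vscale) (simp add: vscale_def)
qed

lemma sum_fun_apply: "(\<Sum>i\<in>A. f i) = (\<lambda>l. \<Sum>i\<in>A. f i l)"
  by (induction A rule: infinite_finite_induct) (simp_all add: fun_eq_iff)

lemma lin_eq_sum: "lin r D f = (\<Sum>k<r. vscale (f k) (D k))"
  by (simp add: lin_def vscale_def sum_fun_apply)

lemma lin_unit: "i < r \<Longrightarrow> lin r D (\<lambda>k. if k = i then 1 else 0) = D i"
  by (simp add: lin_def fun_eq_iff if_distrib[of "\<lambda>x. x * _"] cong: if_cong)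

lemma span_eq_lin_image: "vec.span (D ` {..<r}) = lin r D ` vectors r"
proof (rule subset_antisym)
  have "D ` {..<r} \<subseteq> lin r D ` vectors r"
  proof
    fix x assume "x \<in> D ` {..<r}"
    then obtain i where "i < r" "x = D i" by auto
    then show "x \<in> lin r D ` vectors r"
      by (intro image_eqI[of _ _ "\<lambda>k. if k = i then 1 else 0"]) (simp_all add: lin_unit vectors_def)
  qed
  then show "vec.span (D ` {..<r}) \<subseteq> lin r D ` vectors r"
    by (rule vec.span_minimal[OF _ subspace_lin_image])
  show "lin r D ` vectors r \<subseteq> vec.span (D ` {..<r})"
  proof (intro image_subsetI)
    fix f
    show "lin r D f \<in> vec.span (D ` {..<r})"
      unfolding lin_eq_sum by (intro vec.span_sum vec.span_scale vec.span_base) simp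
  qed
qed

lemma lin_vcomp:
  assumes "graded_matrix r deg deg0 D"
  shows "lin r D (vcomp deg j f) = vcomp deg0 j (lin r D f)"
proof
  fix l
  have "hcomp (j - deg0 l) (f k * D k l) = hcomp (j - deg k) (f k) * D k l" if "k < r" for k
  proof -
    have "homogeneous (deg k - deg0 l) (D k l)"
      using assms that by (simp add: graded_matrix_def vhom_def)
    from hcomp_mult[OF this, of "j - deg0 l"] show ?thesis by simp
  qed
  then show "lin r D (vcomp deg j f) l = vcomp deg0 j (lin r D f) l"
    by (simp add: lin_def vcomp_def hcomp_sum)
qed

lemma lin_vhom: "graded_matrix r deg deg0 D \<Longrightarrow> vhom deg j f \<Longrightarrow> vhom deg0 j (lin r D f)"
  using lin_vcomp[of r deg deg0 D j f] vcomp_vhom[of deg j f j] by (metis vhom_vcomp)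

lemma graded_submodule_lin_kernel:
  assumes "graded_matrix r deg deg0 D"
  shows "graded_submodule deg (lin_kernel r D)"
  unfolding graded_submodule_def
proof (intro conjI ballI allI subspace_lin_kernel)
  fix f j assume "f \<in> lin_kernel r D"
  then show "vcomp deg j f \<in> lin_kernel r D"
    using lin_vcomp[OF assms, of j f] by (simp add: lin_kernel_def vcomp_vectors) (simp add: vcomp_def)
qed

lemma subspace_fun_diff:
  assumes "vec.subspace M" "f \<in> M" "g \<in> M"
  shows "(\<lambda>k. f k - g k) \<in> M"
  using vec.subspace_diff[OF assms] by (simp add: fun_diff_def)

lemma subspace_fun_0: "vec.subspace M \<Longrightarrow> (\<lambda>_. 0) \<in> M"
  using vec.subspace_0[of M] by (simp add: zero_fun_def)

section \<open>Koszul homology with coefficients in a submodule of a free module\<close>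

context koszul
begin

definition vkb :: "('v set \<Rightarrow> nat \<Rightarrow> ('v, 'k) mpoly) \<Rightarrow> 'v set \<Rightarrow> nat \<Rightarrow> ('v, 'k) mpoly" where
  "vkb c \<tau> = (\<lambda>k. kb (\<lambda>\<sigma>. c \<sigma> k) \<tau>)"

definition vchain :: "(nat \<Rightarrow> ('v, 'k) mpoly) set \<Rightarrow> (nat \<Rightarrow> int) \<Rightarrow> nat \<Rightarrow> int \<Rightarrow>
    ('v set \<Rightarrow> nat \<Rightarrow> ('v, 'k) mpoly) \<Rightarrow> bool" where
  "vchain M deg p j c \<longleftrightarrow>
     (\<forall>\<sigma>. c \<sigma> \<in> M \<and> vhom deg (j - int (card \<sigma>)) (c \<sigma>) \<and> (card \<sigma> \<noteq> p \<longrightarrow> c \<sigma> = (\<lambda>_. 0)))"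

text \<open>The homology in question is \<open>Tor\<^sub>p(M, k)\<close> in degree \<open>j\<close>.\<close>

definition koszul_vanishes :: "(nat \<Rightarrow> ('v, 'k) mpoly) set \<Rightarrow> (nat \<Rightarrow> int) \<Rightarrow> nat \<Rightarrow> int \<Rightarrow> bool" where
  "koszul_vanishes M deg p j \<longleftrightarrow>
     (\<forall>c. vchain M deg p j c \<longrightarrow> (\<forall>\<tau>. vkb c \<tau> = (\<lambda>_. 0)) \<longrightarrow>
        (\<exists>c'. vchain M deg (Suc p) j c' \<and> (\<forall>\<tau>. c \<tau> = vkb c' \<tau>)))"

lemma koszul_vanishesE:
  assumes "koszul_vanishes M deg p j" "vchain M deg p j c" "\<And>\<tau>. vkb c \<tau> = (\<lambda>_. 0)"
  obtains c' where "vchain M deg (Suc p) j c'" "\<And>\<tau>. c \<tau> = vkb c' \<tau>"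
  using assms unfolding koszul_vanishes_def by auto

lemma vkb_diff: "vkb (\<lambda>\<sigma> k. c \<sigma> k - c' \<sigma> k) \<tau> = (\<lambda>k. vkb c \<tau> k - vkb c' \<tau> k)"
  by (simp add: vkb_def kb_diff)

lemma vkb_vkb: "vkb (vkb c) \<tau> = (\<lambda>_. 0)"
  by (simp add: vkb_def kb_kb)

lemma vkb_eq_sum: "vkb c \<tau> = (\<Sum>v\<in>- \<tau>. vscale (single (single v 1) (sg v (insert v \<tau>))) (c (insert v \<tau>)))"
  by (simp add: vkb_def kb_def vscale_def sum_fun_apply)

lemma vkb_lin: "vkb (\<lambda>\<sigma>. lin r D (c \<sigma>)) \<tau> = lin r D (vkb c \<tau>)"
proof
  fix l
  show "vkb (\<lambda>\<sigma>. lin r D (c \<sigma>)) \<tau> l = lin r D (vkb c \<tau>) l"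
    unfolding vkb_def kb_def lin_def sum_distrib_left sum_distrib_right
    by (subst sum.swap) (simp only: mult.assoc)
qed

lemma vchain_diff:
  assumes "vec.subspace M" "vchain M deg p j c" "vchain M deg p j c'"
  shows "vchain M deg p j (\<lambda>\<sigma> k. c \<sigma> k - c' \<sigma> k)"
  using assms unfolding vchain_def by (auto intro!: subspace_fun_diff vhom_diff)

lemma vchain_mono: "vchain M deg p j c \<Longrightarrow> M \<subseteq> N \<Longrightarrow> vchain N deg p j c"
  unfolding vchain_def by blast

lemma vchain_vkb:
  assumes M: "vec.subspace M" and c: "vchain M deg (Suc p) j c"
  shows "vchain M deg p j (vkb c)"
  unfolding vchain_def
proof (intro allI conjI impI)
  fix \<tau>
  show "vkb c \<tau> \<in> M"
    unfolding vkb_eq_sum using c M by (intro vec.subspace_sum vec.subspace_scale) (auto simp: vchain_def)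
  show "vhom deg (j - int (card \<tau>)) (vkb c \<tau>)"
    unfolding vhom_def vkb_def kb_def
  proof (intro allI homogeneous_sum)
    fix k v assume v: "v \<in> - \<tau>"
    have "homogeneous (1 + (j - int (card (insert v \<tau>)) - deg k))
        (single (single v 1) (sg v (insert v \<tau>)) * c (insert v \<tau>) k)"
      using c by (intro homogeneous_mult homogeneous_single) (simp_all add: mdeg_single vchain_def vhom_def)
    then show "homogeneous (j - int (card \<tau>) - deg k)
        (single (single v 1) (sg v (insert v \<tau>)) * c (insert v \<tau>) k)"
      using v by (simp add: algebra_simps)
  qed
  assume "card \<tau> \<noteq> p"
  then have "c (insert v \<tau>) = (\<lambda>_. 0)" if "v \<in> - \<tau>" for v
    using c that by (simp add: vchain_def)
  then show "vkb c \<tau> = (\<lambda>_. 0)" by (simp add: vkb_def kb_def)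
qed

lemma vkb_degree_0: "vchain M deg 0 j c \<Longrightarrow> vkb c \<tau> = (\<lambda>_. 0)"
  by (simp add: vkb_def kb_def vchain_def)

text \<open>Coordinatewise this is the Koszul complex of the ring. In a multidegree other than 0 all
  subsets of the support are allowed, which is a cone over any vertex of it. Multidegree 0 matters
  only for \<open>p = 0\<close> and \<open>deg k = j\<close>, where \<open>zero\<close> takes care
  of it.\<close>

lemma free_koszul_exact:
  assumes c: "vchain (vectors r) deg p j c" and cycle: "\<And>\<tau>. vkb c \<tau> = (\<lambda>_. 0)"
    and zero: "\<And>k. p = 0 \<Longrightarrow> deg k = j \<Longrightarrow> c {} k = 0"
  shows "\<exists>c'. vchain (vectors r) deg (Suc p) j c' \<and> (\<forall>\<tau>. c \<tau> = vkb c' \<tau>)"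
proof -
  have "\<exists>e. koszul_chain UNIV (Suc p) (j - deg k) e \<and> (\<forall>\<tau>. c \<tau> k = kb e \<tau>) \<and> (r \<le> k \<longrightarrow> e = (\<lambda>_. 0))" for k
  proof (cases "r \<le> k \<or> p = 0 \<and> deg k = j")
    case True
    have "c \<tau> k = 0" for \<tau>
    proof (cases "r \<le> k")
      case True
      then show ?thesis using c by (simp add: vchain_def vectors_def)
    next
      case False
      then have "p = 0" "deg k = j" using True by auto
      then show ?thesis using c zero by (cases "\<tau> = {}") (simp_all add: vchain_def card_eq_0_iff)
    qed
    then show ?thesis by (intro exI[of _ "\<lambda>_. 0"]) (simp add: koszul_chain_def)
  next
    case False
    have "\<exists>e. koszul_chain UNIV (Suc p) (j - deg k) e \<and> (\<forall>\<tau>. c \<tau> k = kb e \<tau>)"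
    proof (rule koszul_exact)
      show "up_closed UNIV" by (simp add: up_closed_def)
      show "koszul_chain UNIV p (j - deg k) (\<lambda>\<sigma>. c \<sigma> k)"
        unfolding koszul_chain_def
      proof (intro allI conjI impI)
        fix \<sigma>
        have "homogeneous (j - int (card \<sigma>) - deg k) (c \<sigma> k)" using c by (simp add: vchain_def vhom_def)
        then show "homogeneous (j - deg k - int (card \<sigma>)) (c \<sigma> k)" by (simp add: diff_right_commute)
        show "card \<sigma> = p" if "c \<sigma> k \<noteq> 0" using c that unfolding vchain_def by metis
      qed simp
      show "kb (\<lambda>\<sigma>. c \<sigma> k) \<tau> = 0" for \<tau> using cycle[of \<tau>] by (simp add: vkb_def fun_eq_iff)
      fix a :: "'v \<Rightarrow>\<^sub>0 nat" and b assume a: "int (mdeg a) = j - deg k" and b: "b + p = card (keys a)"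
      have "keys a \<noteq> {}"
      proof
        assume "keys a = {}"
        then have "a = 0" by simp
        then have "deg k = j" "p = 0" using a b by (simp_all add: mdeg_def)
        then show False using False by simp
      qed
      then obtain v where "v \<in> keys a" by blast
      then show "acyclic_at (twist (keys a)) (degree_family UNIV a) b"
        by (intro acyclic_at_cone[OF sign_function_twist, where v = v]) (auto simp: degree_family_def)
    qed
    then show ?thesis using False by auto
  qed
  then obtain e where e: "\<And>k. koszul_chain UNIV (Suc p) (j - deg k) (e k)"
    "\<And>k \<tau>. c \<tau> k = kb (e k) \<tau>" "\<And>k. r \<le> k \<Longrightarrow> e k = (\<lambda>_. 0)"
    by metis
  have "vchain (vectors r) deg (Suc p) j (\<lambda>\<sigma> k. e k \<sigma>)"
    unfolding vchain_def
  proof (intro allI conjI impI)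
    fix \<sigma>
    show "(\<lambda>k. e k \<sigma>) \<in> vectors r" using e(3) by (simp add: vectors_def)
    show "vhom deg (j - int (card \<sigma>)) (\<lambda>k. e k \<sigma>)"
      using e(1) by (simp add: vhom_def koszul_chain_def diff_right_commute)
    assume "card \<sigma> \<noteq> Suc p"
    then show "(\<lambda>k. e k \<sigma>) = (\<lambda>_. 0)" using e(1) unfolding koszul_chain_def by blast
  qed
  moreover have "\<forall>\<tau>. c \<tau> = vkb (\<lambda>\<sigma> k. e k \<sigma>) \<tau>" using e(2) by (simp add: vkb_def fun_eq_iff)
  ultimately show ?thesis by blast
qed

text \<open>The matrix respects degrees, so a homogeneous preimage is obtained as a homogeneous
  component of any preimage. Index sets of the wrong size are lifted to 0.\<close>

lemma vchain_lift:
  assumes D: "graded_matrix r deg deg0 D" and c: "vchain (lin r D ` vectors r) deg0 p j c"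
  obtains h where "vchain (vectors r) deg p j h" "\<And>\<sigma>. lin r D (h \<sigma>) = c \<sigma>"
proof -
  have "\<exists>f. f \<in> vectors r \<and> vhom deg (j - int (card \<sigma>)) f \<and> (card \<sigma> \<noteq> p \<longrightarrow> f = (\<lambda>_. 0)) \<and>
      lin r D f = c \<sigma>" for \<sigma>
  proof (cases "card \<sigma> = p")
    case True
    have im: "c \<sigma> \<in> lin r D ` vectors r" and hom: "vhom deg0 (j - int (card \<sigma>)) (c \<sigma>)"
      using c by (simp_all add: vchain_def)
    from im obtain f where f: "c \<sigma> = lin r D f" "f \<in> vectors r" by (rule imageE)
    have "lin r D (vcomp deg (j - int (card \<sigma>)) f) = vcomp deg0 (j - int (card \<sigma>)) (c \<sigma>)"
      using lin_vcomp[OF D] f by simp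
    also have "\<dots> = c \<sigma>" using vcomp_vhom[OF hom] by simp
    finally show ?thesis using f True
      by (intro exI[of _ "vcomp deg (j - int (card \<sigma>)) f"]) (simp add: vcomp_vectors)
  next
    case False
    then have "c \<sigma> = (\<lambda>_. 0)" using c by (simp add: vchain_def)
    then show ?thesis using subspace_fun_0[OF subspace_vectors, of r] by (intro exI[of _ "\<lambda>_. 0"]) simp
  qed
  then obtain h where "\<And>\<sigma>. h \<sigma> \<in> vectors r \<and> vhom deg (j - int (card \<sigma>)) (h \<sigma>) \<and>
      (card \<sigma> \<noteq> p \<longrightarrow> h \<sigma> = (\<lambda>_. 0)) \<and> lin r D (h \<sigma>) = c \<sigma>" by metis
  then show ?thesis using that[of h] by (simp add: vchain_def)
qed

lemma vchain_lin:
  assumes D: "graded_matrix r deg deg0 D" and h: "vchain (vectors r) deg p j h"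
  shows "vchain (lin r D ` vectors r) deg0 p j (\<lambda>\<sigma>. lin r D (h \<sigma>))"
  using h lin_vhom[OF D] unfolding vchain_def by (simp add: image_eqI)

lemma vchain_kernel:
  assumes "vchain (vectors r) deg p j h" "\<And>\<sigma>. lin r D (h \<sigma>) = (\<lambda>_. 0)"
  shows "vchain (lin_kernel r D) deg p j h"
  using assms by (simp add: vchain_def lin_kernel_def)

text \<open>The connecting isomorphism of the sequence \<open>0 \<rightarrow> K \<rightarrow> F \<rightarrow> M \<rightarrow> 0\<close>; minimality enters for
  \<open>p = 0\<close> only.\<close>

lemma koszul_vanishes_shift:
  assumes D: "graded_matrix r deg deg0 D" and min: "minimal_kernel (lin_kernel r D)"
  shows "koszul_vanishes (lin_kernel r D) deg p j \<longleftrightarrow>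
    koszul_vanishes (lin r D ` vectors r) deg0 (Suc p) j"
proof
  have KF: "lin_kernel r D \<subseteq> vectors r" by (auto simp: lin_kernel_def)
  note sF = subspace_vectors[of r] and sK = subspace_lin_kernel[of r D]
  {
    assume M: "koszul_vanishes (lin r D ` vectors r) deg0 (Suc p) j"
    show "koszul_vanishes (lin_kernel r D) deg p j"
      unfolding koszul_vanishes_def
    proof (intro allI impI)
      fix c assume c: "vchain (lin_kernel r D) deg p j c" and cycle: "\<forall>\<tau>. vkb c \<tau> = (\<lambda>_. 0)"
      \<comment> \<open>For \<open>p = 0\<close> this coordinate is a constant, for degree reasons,
        and minimality of the kernel forces it to be 0. This is the obstruction in
        \<open>free_koszul_exact\<close>.\<close>
      have "c {} k = 0" if "p = 0" "deg k = j" for k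
      proof (rule poly_mapping_eqI)
        fix u
        have "c {} \<in> lin_kernel r D" using c by (simp add: vchain_def)
        then have "lookup (c {} k) 0 = 0" using min by (simp add: minimal_kernel_def)
        moreover have "vhom deg (j - int (card ({} :: 'v set))) (c {})" using c unfolding vchain_def by blast
        then have "homogeneous (j - deg k) (c {} k)" by (simp add: vhom_def)
        then have "homogeneous 0 (c {} k)" using that(2) by simp
        ultimately show "lookup (c {} k) u = lookup 0 u"
          by (cases "u = 0") (auto simp: homogeneous_def in_keys_iff mdeg_eq_0_iff)
      qed
      then obtain e where e: "vchain (vectors r) deg (Suc p) j e" "\<And>\<tau>. c \<tau> = vkb e \<tau>"
        using free_koszul_exact[OF vchain_mono[OF c KF]] cycle by blast
      have "vkb (\<lambda>\<sigma>. lin r D (e \<sigma>)) \<tau> = (\<lambda>_. 0)" for \<tau>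
      proof -
        have "vkb e \<tau> \<in> lin_kernel r D" using c e(2) by (metis vchain_def)
        then show ?thesis unfolding vkb_lin by (simp add: lin_kernel_def)
      qed
      then obtain g where g: "vchain (lin r D ` vectors r) deg0 (Suc (Suc p)) j g"
        "\<And>\<tau>. lin r D (e \<tau>) = vkb g \<tau>"
        using koszul_vanishesE[OF M vchain_lin[OF D e(1)]] by metis
      obtain h where h: "vchain (vectors r) deg (Suc (Suc p)) j h" "\<And>\<sigma>. lin r D (h \<sigma>) = g \<sigma>"
        by (rule vchain_lift[OF D g(1)]) auto
      \<comment> \<open>\<open>e\<close> bounds \<open>c\<close> in the free module only.
        Subtracting the boundary of a lift of \<open>g\<close> moves it into the kernel and keeps
        its boundary.\<close>
      let ?e = "\<lambda>\<sigma> k. e \<sigma> k - vkb h \<sigma> k"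
      have "vkb (\<lambda>\<sigma>. lin r D (h \<sigma>)) \<tau> = vkb g \<tau>" for \<tau> by (simp add: h(2))
      then have "lin r D (?e \<sigma>) = (\<lambda>_. 0)" for \<sigma>
        unfolding lin_diff vkb_lin[symmetric] g(2) by simp
      then have "vchain (lin_kernel r D) deg (Suc p) j ?e"
        by (intro vchain_kernel vchain_diff[OF sF e(1)] vchain_vkb[OF sF h(1)])
      moreover have "c \<tau> = vkb ?e \<tau>" for \<tau>
        unfolding vkb_diff vkb_vkb by (simp add: e(2))
      ultimately show "\<exists>c'. vchain (lin_kernel r D) deg (Suc p) j c' \<and> (\<forall>\<tau>. c \<tau> = vkb c' \<tau>)" by blast
    qed
  next
    assume K: "koszul_vanishes (lin_kernel r D) deg p j"
    show "koszul_vanishes (lin r D ` vectors r) deg0 (Suc p) j"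
      unfolding koszul_vanishes_def
    proof (intro allI impI)
      fix c assume c: "vchain (lin r D ` vectors r) deg0 (Suc p) j c" and cycle: "\<forall>\<tau>. vkb c \<tau> = (\<lambda>_. 0)"
      obtain h where h: "vchain (vectors r) deg (Suc p) j h" "\<And>\<sigma>. lin r D (h \<sigma>) = c \<sigma>"
        by (rule vchain_lift[OF D c]) auto
      have "lin r D (vkb h \<tau>) = (\<lambda>_. 0)" for \<tau>
        unfolding vkb_lin[symmetric] h(2) using cycle by simp
      then have "vchain (lin_kernel r D) deg p j (vkb h)"
        by (intro vchain_kernel vchain_vkb[OF sF h(1)])
      then obtain g where g: "vchain (lin_kernel r D) deg (Suc p) j g" "\<And>\<tau>. vkb h \<tau> = vkb g \<tau>"
        using koszul_vanishesE[OF K] vkb_vkb by metis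
      let ?h = "\<lambda>\<sigma> k. h \<sigma> k - g \<sigma> k"
      have "vchain (vectors r) deg (Suc p) j ?h"
        by (rule vchain_diff[OF sF h(1) vchain_mono[OF g(1) KF]])
      moreover have "vkb ?h \<tau> = (\<lambda>_. 0)" for \<tau> unfolding vkb_diff g(2) by simp
      ultimately obtain e where e: "vchain (vectors r) deg (Suc (Suc p)) j e" "\<And>\<tau>. ?h \<tau> = vkb e \<tau>"
        using free_koszul_exact[of r deg "Suc p" j ?h] by blast
      have "c \<tau> = vkb (\<lambda>\<sigma>. lin r D (e \<sigma>)) \<tau>" for \<tau>
      proof -
        have "lin r D (g \<tau>) = (\<lambda>_. 0)" using g(1) by (simp add: vchain_def lin_kernel_def)
        then have "lin r D (?h \<tau>) = c \<tau>" unfolding lin_diff h(2) by simp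
        then show ?thesis unfolding vkb_lin e(2) by simp
      qed
      then show "\<exists>c'. vchain (lin r D ` vectors r) deg0 (Suc (Suc p)) j c' \<and> (\<forall>\<tau>. c \<tau> = vkb c' \<tau>)"
        using vchain_lin[OF D e(1)] by blast
    qed
  }
qed

text \<open>In homological degree 0 the Koszul homology is the module modulo the variables. If a
  basis vector of degree \<open>j\<close> had an image in the multiples of the variables, its
  difference from a suitable combination of such multiples would be a relation with constant
  coefficient 1, against minimality.\<close>

lemma koszul_vanishes_0_iff:
  assumes D: "graded_matrix r deg deg0 D" and min: "minimal_kernel (lin_kernel r D)"
  shows "koszul_vanishes (lin r D ` vectors r) deg0 0 j \<longleftrightarrow> (\<forall>k<r. deg k \<noteq> j)"
proof
  assume M: "koszul_vanishes (lin r D ` vectors r) deg0 0 j"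
  show "\<forall>k<r. deg k \<noteq> j"
  proof (intro allI impI notI)
    fix k assume k: "k < r" "deg k = j"
    define e :: "nat \<Rightarrow> ('v, 'k) mpoly" where "e = (\<lambda>i. if i = k then 1 else 0)"
    define c where "c \<sigma> = (if \<sigma> = {} then e else (\<lambda>_. 0))" for \<sigma> :: "'v set"
    have e: "e \<in> vectors r" "vhom deg j e"
      using k by (auto simp: e_def vectors_def vhom_def homogeneous_def mdeg_eq_0_iff)
    have "vchain (vectors r) deg 0 j c"
      using e by (auto simp: vchain_def c_def card_eq_0_iff vectors_def)
    from vchain_lin[OF D this] have ch: "vchain (lin r D ` vectors r) deg0 0 j (\<lambda>\<sigma>. lin r D (c \<sigma>))" .
    obtain g where g: "vchain (lin r D ` vectors r) deg0 (Suc 0) j g" "\<And>\<tau>. lin r D (c \<tau>) = vkb g \<tau>"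
      by (rule koszul_vanishesE[OF M ch vkb_degree_0[OF ch]]) auto
    obtain h where h: "vchain (vectors r) deg (Suc 0) j h" "\<And>\<sigma>. lin r D (h \<sigma>) = g \<sigma>"
      by (rule vchain_lift[OF D g(1)]) auto
    let ?f = "\<lambda>i. e i - vkb h {} i"
    have "vkb (\<lambda>\<sigma>. lin r D (h \<sigma>)) {} = vkb g {}" by (simp add: h(2))
    then have "lin r D (vkb h {}) = lin r D e" unfolding vkb_lin using g(2)[of "{}"] by (simp add: c_def)
    then have "lin r D ?f = (\<lambda>_. 0)" unfolding lin_diff by simp
    moreover have "vkb h {} \<in> vectors r"
      using vchain_vkb[OF subspace_vectors h(1)] by (simp add: vchain_def)
    ultimately have "?f \<in> lin_kernel r D"
      using subspace_fun_diff[OF subspace_vectors e(1)] by (simp add: lin_kernel_def)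
    with min[unfolded minimal_kernel_def] have "\<forall>k. lookup (?f k) 0 = 0" by (rule bspec)
    then have "lookup (?f k) 0 = 0" by (rule spec)
    moreover have "lookup (vkb h {} k) 0 = 0" by (simp add: vkb_def lookup_kb)
    ultimately show False by (simp add: lookup_minus e_def)
  qed
next
  assume none: "\<forall>k<r. deg k \<noteq> j"
  show "koszul_vanishes (lin r D ` vectors r) deg0 0 j"
    unfolding koszul_vanishes_def
  proof (intro allI impI)
    fix c assume c: "vchain (lin r D ` vectors r) deg0 0 j c" and cycle: "\<forall>\<tau>. vkb c \<tau> = (\<lambda>_. 0)"
    obtain h where h: "vchain (vectors r) deg 0 j h" "\<And>\<sigma>. lin r D (h \<sigma>) = c \<sigma>"
      by (rule vchain_lift[OF D c]) auto
    have "h {} k = 0" if "deg k = j" for k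
    proof -
      have "r \<le> k" by (rule ccontr) (use none that in \<open>simp add: not_le\<close>)
      then show ?thesis using h(1) by (simp add: vchain_def vectors_def)
    qed
    then obtain e where e: "vchain (vectors r) deg (Suc 0) j e" "\<And>\<tau>. h \<tau> = vkb e \<tau>"
      using free_koszul_exact[OF h(1) vkb_degree_0[OF h(1)]] by metis
    have "c \<tau> = vkb (\<lambda>\<sigma>. lin r D (e \<sigma>)) \<tau>" for \<tau>
      unfolding vkb_lin using h(2)[of \<tau>] e(2)[of \<tau>] by simp
    then show "\<exists>c'. vchain (lin r D ` vectors r) deg0 (Suc 0) j c' \<and> (\<forall>\<tau>. c \<tau> = vkb c' \<tau>)"
      using vchain_lin[OF D e(1)] by blast
  qed
qed

end


section \<open>Finite generation\<close>

text \<open>The same vectors over the field of constants, for dimension arguments in a fixed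
  degree.\<close>

interpretation kvec: vector_space "\<lambda>c. vscale (single 0 c :: ('v::finite, 'k::field) mpoly)"
  by unfold_locales
    (simp_all add: vscale_def fun_eq_iff algebra_simps single_add mult.assoc[symmetric] mult_single)

lemma finite_span_degree:
  "\<exists>T. finite T \<and> {f \<in> vectors r. vhom deg j f} \<subseteq>
     kvec.span (T :: (nat \<Rightarrow> ('v::finite, 'k::field) mpoly) set)"
proof -
  define t :: "nat \<Rightarrow> ('v \<Rightarrow>\<^sub>0 nat) \<Rightarrow> nat \<Rightarrow> ('v, 'k) mpoly" where
    "t i u = (\<lambda>l. if l = i then single u 1 else 0)" for i u
  define U where "U i = {u :: 'v \<Rightarrow>\<^sub>0 nat. int (mdeg u) = j - deg i}" for i
  define T where "T = (\<Union>i<r. t i ` U i)"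
  have "finite T" by (simp add: T_def U_def finite_mdeg)
  moreover have "f \<in> kvec.span T" if f: "f \<in> vectors r" "vhom deg j f" for f :: "nat \<Rightarrow> ('v, 'k) mpoly"
  proof -
    have "f = (\<Sum>i<r. \<Sum>u\<in>U i. vscale (single 0 (lookup (f i) u)) (t i u))"
    proof
      fix l
      have "(\<Sum>i<r. \<Sum>u\<in>U i. vscale (single 0 (lookup (f i) u)) (t i u)) l =
          (\<Sum>i<r. if i = l then (\<Sum>u\<in>U l. single u (lookup (f l) u)) else 0)"
        unfolding sum_fun_apply
        by (intro sum.cong refl) (auto simp: vscale_def t_def mult_single intro: sum.neutral)
      also have "\<dots> = f l"
      proof (cases "l < r")
        case True
        have "(\<Sum>u\<in>U l. single u (lookup (f l) u)) = f l"
        proof (rule poly_mapping_eqI)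
          fix u
          have "homogeneous (j - deg l) (f l)" using f by (simp add: vhom_def)
          then show "lookup (\<Sum>u\<in>U l. single u (lookup (f l) u)) u = lookup (f l) u"
            by (auto simp: lookup_sum lookup_single when_def U_def finite_mdeg homogeneous_def in_keys_iff)
        qed
        then show ?thesis using True by simp
      next
        case False
        then show ?thesis using f by (simp add: vectors_def)
      qed
      finally show "f l = (\<Sum>i<r. \<Sum>u\<in>U i. vscale (single 0 (lookup (f i) u)) (t i u)) l" by simp
    qed
    moreover have "(\<Sum>i<r. \<Sum>u\<in>U i. vscale (single 0 (lookup (f i) u)) (t i u)) \<in> kvec.span T"
      by (intro kvec.span_sum kvec.span_scale kvec.span_base) (auto simp: T_def)
    ultimately show ?thesis by simp
  qed
  ultimately show ?thesis by blast
qed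

text \<open>A fixed degree of the free module has finite dimension over the field, so a maximal
  linearly independent set in this degree of \<open>M\<close> is finite.\<close>

lemma finite_generators_degree:
  fixes M :: "(nat \<Rightarrow> ('v::finite, 'k::field) mpoly) set"
  assumes "M \<subseteq> vectors r"
  shows "\<exists>B. finite B \<and> B \<subseteq> {f\<in>M. vhom deg j f} \<and> {f\<in>M. vhom deg j f} \<subseteq> vec.span B"
proof -
  obtain T :: "(nat \<Rightarrow> ('v, 'k) mpoly) set" where T: "finite T" "{f \<in> vectors r. vhom deg j f} \<subseteq> kvec.span T"
    using finite_span_degree by blast
  obtain B where B: "B \<subseteq> {f\<in>M. vhom deg j f}" "kvec.independent B" "{f\<in>M. vhom deg j f} \<subseteq> kvec.span B"
    by (rule kvec.maximal_independent_subset)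
  have "{f\<in>M. vhom deg j f} \<subseteq> {f \<in> vectors r. vhom deg j f}" using assms by auto
  then have "B \<subseteq> kvec.span T" using B(1) T(2) by (meson order_trans)
  then have "finite B" using kvec.independent_span_bound[OF T(1) B(2)] by simp
  moreover have "kvec.span B \<subseteq> vec.span B"
  proof (rule kvec.span_minimal)
    show "B \<subseteq> vec.span B" by (rule vec.span_superset)
    show "kvec.subspace (vec.span B)"
      by (rule kvec.subspaceI) (auto intro: vec.span_zero vec.span_add vec.span_scale)
  qed
  ultimately show ?thesis using B by blast
qed

lemma sum_vcomp:
  fixes f :: "nat \<Rightarrow> ('v::finite, 'k::field) mpoly"
  assumes "f \<in> vectors r"
  shows "\<exists>J. finite J \<and> f = (\<Sum>j\<in>J. vcomp deg j f)"
proof -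
  define J where "J = (\<Union>i<r. (\<lambda>u. int (mdeg u) + deg i) ` keys (f i))"
  have "finite J" by (simp add: J_def)
  moreover have "f = (\<Sum>j\<in>J. vcomp deg j f)"
  proof
    fix k
    show "f k = (\<Sum>j\<in>J. vcomp deg j f) k"
    proof (cases "k < r")
      case True
      have "(\<Sum>d\<in>(\<lambda>j. j - deg k) ` J. hcomp d (f k)) = f k"
      proof (rule sum_hcomp)
        fix u assume "u \<in> keys (f k)"
        then have "int (mdeg u) + deg k \<in> J"
          unfolding J_def using True by (intro UN_I[of k] imageI) simp_all
        then show "int (mdeg u) \<in> (\<lambda>j. j - deg k) ` J"
          by (rule rev_image_eqI) simp
      qed (simp add: \<open>finite J\<close>)
      then show ?thesis
        by (simp add: sum_fun_apply vcomp_def sum.reindex inj_on_def)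
    next
      case False
      then show ?thesis using assms by (simp add: sum_fun_apply vcomp_def vectors_def)
    qed
  qed
  ultimately show ?thesis by blast
qed

context koszul
begin

text \<open>Takes the place of a Noetherian argument. Above degree \<open>N\<close> the homology in
  homological degree 0 vanishes, so every homogeneous element is a combination of variables times
  elements of the previous degree; induction on the excess over \<open>N\<close> leads down to
  degrees at most \<open>N\<close>.\<close>

lemma finite_generators:
  assumes M: "graded_submodule deg M" "M \<subseteq> vectors r" and N: "\<And>j. N < j \<Longrightarrow> koszul_vanishes M deg 0 j"
  shows "\<exists>G. finite G \<and> G \<subseteq> M \<and> (\<forall>g\<in>G. \<exists>j. vhom deg j g) \<and> M \<subseteq> vec.span G"
proof -
  have sM: "vec.subspace M" using M by (simp add: graded_submodule_def)
  have "\<forall>j. \<exists>B. finite B \<and> B \<subseteq> {f\<in>M. vhom deg j f} \<and> {f\<in>M. vhom deg j f} \<subseteq> vec.span B"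
    using finite_generators_degree[OF M(2)] by (rule allI)
  from choice[OF this] obtain B where "\<forall>j. finite (B j) \<and> B j \<subseteq> {f\<in>M. vhom deg j f} \<and>
      {f\<in>M. vhom deg j f} \<subseteq> vec.span (B j)" by (rule exE)
  then have B: "\<And>j. finite (B j)" "\<And>j. B j \<subseteq> {f\<in>M. vhom deg j f}"
    "\<And>j. {f\<in>M. vhom deg j f} \<subseteq> vec.span (B j)" by simp_all
  \<comment> \<open>The degrees up to \<open>N\<close> in which the free module can be nonzero;
    finitely many.\<close>
  define J where "J = (\<Union>i<r. {deg i..N})"
  define G where "G = (\<Union>j\<in>J. B j)"
  have in_span: "f \<in> vec.span G" if "j \<le> N + int n" "f \<in> M" "vhom deg j f" for n j f
    using that
  proof (induction n arbitrary: j f)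
    case 0
    show ?case
    proof (cases "j \<in> J")
      case True
      then have "B j \<subseteq> G" by (auto simp: G_def)
      moreover have "f \<in> vec.span (B j)" using B(3)[of j] 0 by auto
      ultimately show ?thesis using vec.span_mono by blast
    next
      case False
      have "f k = 0" for k
      proof (cases "k < r")
        case True
        then have "j < deg k" using False 0 by (force simp: J_def)
        moreover have "homogeneous (j - deg k) (f k)" using 0 by (simp add: vhom_def)
        ultimately have "keys (f k) = {}" by (force simp: homogeneous_def)
        then show ?thesis by simp
      next
        case False
        then show ?thesis using 0 M by (auto simp: vectors_def)
      qed
      then have "f = 0" by (simp add: fun_eq_iff)
      then show ?thesis by (simp only: vec.span_zero)
    qed
  next
    case (Suc n)
    show ?case
    proof (cases "j \<le> N + int n")
      case True
      then show ?thesis using Suc by blast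
    next
      case False
      define c where "c \<sigma> = (if \<sigma> = {} then f else (\<lambda>_. 0))" for \<sigma> :: "'v set"
      have c: "vchain M deg 0 j c"
        using Suc.prems subspace_fun_0[OF sM] by (auto simp: vchain_def c_def card_eq_0_iff)
      have "N < j" using False by simp
      then obtain g where g: "vchain M deg (Suc 0) j g" "\<And>\<tau>. c \<tau> = vkb g \<tau>"
        by (rule koszul_vanishesE[OF N c vkb_degree_0[OF c]]) auto
      have "f = vkb g {}" using g(2)[of "{}"] by (simp add: c_def)
      moreover have "g (insert v {}) \<in> vec.span G" for v
      proof -
        have *: "g {v} \<in> M \<and> vhom deg (j - int (card {v})) (g {v}) \<and> (card {v} \<noteq> Suc 0 \<longrightarrow> g {v} = (\<lambda>_. 0))"
          using g(1) unfolding vchain_def by (rule spec)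
        then have "vhom deg (j - 1) (g {v})" by simp
        then show ?thesis using Suc.IH[of "j - 1" "g {v}"] Suc.prems(1) * by simp
      qed
      ultimately show ?thesis
        unfolding vkb_eq_sum by (simp only:) (intro vec.span_sum vec.span_scale)
    qed
  qed
  have "M \<subseteq> vec.span G"
  proof
    fix f assume f: "f \<in> M"
    obtain J' where J': "finite J'" "f = (\<Sum>j\<in>J'. vcomp deg j f)"
      using sum_vcomp f M by blast
    have "vcomp deg j f \<in> vec.span G" for j
      using in_span[of j "nat (j - N)" "vcomp deg j f"] M f by (simp add: graded_submodule_def)
    then have "(\<Sum>j\<in>J'. vcomp deg j f) \<in> vec.span G" by (intro vec.span_sum)
    then show "f \<in> vec.span G" using J' by simp
  qed
  moreover have "finite G" using B(1) by (simp add: G_def J_def)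
  moreover have "G \<subseteq> M" "\<forall>g\<in>G. \<exists>j. vhom deg j g" using B(2) by (auto simp: G_def)
  ultimately show ?thesis by blast
qed

text \<open>A homogeneous generating system with the least possible number of elements has no relation
  with a nonzero constant coefficient.\<close>

lemma exists_minimal_cover:
  assumes M: "graded_submodule deg0 M" "M \<subseteq> vectors r0"
    and N: "\<And>j. N < j \<Longrightarrow> koszul_vanishes M deg0 0 j"
  shows "\<exists>r deg D. graded_matrix r deg deg0 D \<and> lin r D ` vectors r = M \<and> minimal_kernel (lin_kernel r D)"
proof -
  have sM: "vec.subspace M" using M by (simp add: graded_submodule_def)
  define P where "P r \<longleftrightarrow> (\<exists>deg D. graded_matrix r deg deg0 D \<and> vec.span (D ` {..<r}) = M)" for r
  have "\<exists>G. finite G \<and> G \<subseteq> M \<and> (\<forall>g\<in>G. \<exists>j. vhom deg0 j g) \<and> M \<subseteq> vec.span G"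
    by (rule finite_generators[OF M N])
  then obtain G
    where G: "finite G" "G \<subseteq> M" "\<forall>g\<in>G. \<exists>j. vhom deg0 j g" "M \<subseteq> vec.span G"
    by (elim exE conjE)
  obtain h where h: "bij_betw h {0..<card G} G" using ex_bij_betw_nat_finite[OF G(1)] by blast
  have hG: "h ` {..<card G} = G" using h by (simp add: bij_betw_def lessThan_atLeast0)
  have "\<forall>i. \<exists>j. i < card G \<longrightarrow> vhom deg0 j (h i)" using G(3) hG by blast
  then obtain dg where "\<forall>i. i < card G \<longrightarrow> vhom deg0 (dg i) (h i)" by metis
  then have "graded_matrix (card G) dg deg0 h" by (simp add: graded_matrix_def)
  moreover have "vec.span (h ` {..<card G}) = M"
    unfolding hG using G vec.span_minimal[OF G(2) sM] by blast
  ultimately have "P (card G)" unfolding P_def by blast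
  define r where "r = (LEAST r. P r)"
  have "P r" unfolding r_def using \<open>P (card G)\<close> by (rule LeastI[of P])
  then obtain deg D where D: "graded_matrix r deg deg0 D" "vec.span (D ` {..<r}) = M" unfolding P_def by blast
  have "minimal_kernel (lin_kernel r D)"
    unfolding minimal_kernel_def
  proof (intro ballI allI, rule ccontr)
    fix f k assume f: "f \<in> lin_kernel r D" and nz: "lookup (f k) 0 \<noteq> 0"
    have fv: "f \<in> vectors r" using f by (simp add: lin_kernel_def)
    have k: "k < r"
    proof (rule ccontr)
      assume "\<not> k < r"
      then have "f k = 0" using fv by (simp add: vectors_def)
      then show False using nz by simp
    qed
    \<comment> \<open>In this component coordinate \<open>k\<close> has degree 0, so it is the
      nonzero constant \<open>a\<close>. Dividing by it expresses \<open>D k\<close> through the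
      other rows, which contradicts the choice of \<open>r\<close>.\<close>
    define g where "g = vcomp deg (deg k) f"
    have "g \<in> lin_kernel r D"
      using graded_submodule_lin_kernel[OF D(1)] f by (simp add: graded_submodule_def g_def)
    then have lin0: "(\<Sum>i<r. vscale (g i) (D i)) = 0"
      by (simp add: lin_kernel_def lin_eq_sum zero_fun_def)
    define a where "a = lookup (f k) 0"
    have gk: "g k = single 0 a"
      by (rule poly_mapping_eqI)
        (auto simp: g_def vcomp_def lookup_hcomp lookup_single when_def a_def mdeg_eq_0_iff)
    let ?S = "vec.span (D ` ({..<r} - {k}))"
    have "vscale (g k) (D k) + (\<Sum>i\<in>{..<r} - {k}. vscale (g i) (D i)) = 0"
      using lin0 k by (subst (asm) sum.remove[of _ k]) auto
    then have "vscale (g k) (D k) = - (\<Sum>i\<in>{..<r} - {k}. vscale (g i) (D i))"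
      by (simp only: eq_neg_iff_add_eq_0)
    moreover have "- (\<Sum>i\<in>{..<r} - {k}. vscale (g i) (D i)) \<in> ?S"
      by (intro vec.span_neg vec.span_sum vec.span_scale vec.span_base) simp
    ultimately have "vscale (g k) (D k) \<in> ?S" by simp
    then have "vscale (single 0 (inverse a)) (vscale (g k) (D k)) \<in> ?S" by (rule vec.span_scale)
    moreover have "vscale (single 0 (inverse a)) (vscale (g k) (D k)) = D k"
      using nz by (simp add: gk vscale_def mult.assoc[symmetric] mult_single a_def)
    ultimately have Dk: "D k \<in> ?S" by simp
    define \<phi> where "\<phi> i = (if i < k then i else Suc i)" for i
    have \<phi>: "\<phi> ` {..<r - 1} = {..<r} - {k}"
    proof (intro subset_antisym subsetI)
      fix x assume "x \<in> {..<r} - {k}"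
      then have "x = \<phi> (if x < k then x else x - 1)" "(if x < k then x else x - 1) < r - 1"
        using k by (auto simp: \<phi>_def)
      then show "x \<in> \<phi> ` {..<r - 1}" by blast
    qed (use k in \<open>auto simp: \<phi>_def split: if_splits\<close>)
    have "?S = M"
    proof (rule subset_antisym)
      show "?S \<subseteq> M" unfolding D(2)[symmetric] by (intro vec.span_mono) auto
      have "D ` {..<r} \<subseteq> ?S" using Dk vec.span_superset[of "D ` ({..<r} - {k})"] by auto
      then show "M \<subseteq> ?S" unfolding D(2)[symmetric] by (rule vec.span_minimal) simp
    qed
    moreover have "(D \<circ> \<phi>) ` {..<r - 1} = D ` ({..<r} - {k})" unfolding image_comp[symmetric] \<phi> by simp
    moreover have "graded_matrix (r - 1) (deg \<circ> \<phi>) deg0 (D \<circ> \<phi>)"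
      unfolding graded_matrix_def
    proof (intro allI impI)
      fix i assume "i < r - 1"
      then have "\<phi> i < r" using \<phi> by blast
      then show "vhom deg0 ((deg \<circ> \<phi>) i) ((D \<circ> \<phi>) i)" using D(1) by (simp add: graded_matrix_def)
    qed
    ultimately have "P (r - 1)" unfolding P_def by (intro exI[of _ "deg \<circ> \<phi>"] exI[of _ "D \<circ> \<phi>"]) simp
    then have "r \<le> r - 1" unfolding r_def by (rule Least_le)
    then show False using k by simp
  qed
  then show ?thesis using D span_eq_lin_image[of D r] by blast
qed

end


section \<open>Minimal resolutions and the theorem\<close>

text \<open>The ideal as a submodule of the free module of rank 1, so that it is handled like its
  syzygy modules.\<close>

definition embed :: "'a::zero set \<Rightarrow> (nat \<Rightarrow> 'a) set" where
  "embed I = {f. f 0 \<in> I \<and> (\<forall>k\<ge>1. f k = 0)}"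

lemma graded_submodule_embed:
  fixes Q :: "('v::finite \<Rightarrow>\<^sub>0 nat) set"
  assumes up: "up_closed Q"
  shows "graded_submodule (\<lambda>_. 0) (embed (monomial_ideal Q :: ('v, 'k::field) mpoly set))"
proof -
  interpret ring: module "(*) :: ('v, 'k) mpoly \<Rightarrow> _" by (rule module_mult)
  have "ideal_gen (monomial ` Q) = (monomial_ideal Q :: ('v, 'k) mpoly set)"
  proof (rule ideal_gen_eq_monomial_ideal[OF up])
    show "\<exists>t w. u = t + w \<and> (monomial t :: ('v, 'k) mpoly) \<in> monomial ` Q" if "u \<in> Q" for u
      using that by (intro exI[of _ u] exI[of _ 0]) simp
  qed auto
  then have I: "ring.subspace (monomial_ideal Q :: ('v, 'k) mpoly set)"
    unfolding ideal_gen_def by (metis ring.subspace_span)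
  have "hcomp j f \<in> monomial_ideal Q" if "f \<in> monomial_ideal Q" for j and f :: "('v, 'k) mpoly"
    using that by (auto simp: monomial_ideal_def in_keys_iff lookup_hcomp split: if_splits)
  moreover have "vec.subspace (embed (monomial_ideal Q :: ('v, 'k) mpoly set))"
    by (rule vec.subspaceI)
      (simp_all add: embed_def vscale_def ring.subspace_0[OF I] ring.subspace_add[OF I] ring.subspace_scale[OF I])
  ultimately show ?thesis by (simp add: graded_submodule_def embed_def vcomp_def)
qed

text \<open>A variable with exponent at least 2 remains in the support whether or not it is in
  \<open>B\<close>; such vertices become cone points.\<close>

lemma degree_family_matching_exponents:
  "degree_family (matching_exponents E s) a =
    {B. B \<subseteq> keys a \<and> has_matching E s (B \<union> {v. 2 \<le> lookup a v})}"
proof -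
  have "keys (a - expo (keys a - B)) = B \<union> {v. 2 \<le> lookup a v}" if "B \<subseteq> keys a" for B
  proof (rule set_eqI)
    fix v
    show "v \<in> keys (a - expo (keys a - B)) \<longleftrightarrow> v \<in> B \<union> {v. 2 \<le> lookup a v}"
      using that by (cases "v \<in> B"; cases "v \<in> keys a") (auto simp: in_keys_iff lookup_minus)
  qed
  then show ?thesis by (auto simp: degree_family_def matching_exponents_def)
qed

lemma lookup_mult_0:
  assumes "lookup q 0 = 0"
  shows "lookup ((p :: ('v::finite, 'k::field) mpoly) * q) 0 = 0"
proof -
  interpret ring: module "(*) :: ('v, 'k) mpoly \<Rightarrow> _" by (rule module_mult)
  have "q \<in> ideal_gen (range var)" using assms by (simp add: ideal_vars)
  then have "p * q \<in> ideal_gen (range var)" unfolding ideal_gen_def by (rule ring.span_scale)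
  then show ?thesis by (simp add: ideal_vars)
qed

lemma free_module_eq_vectors: "free_module F i = vectors (basis_size F i)"
  by (simp add: free_module_def vectors_def)

context koszul
begin

lemma koszul_vanishes_embed:
  assumes up: "up_closed Q"
  shows "koszul_vanishes (embed (monomial_ideal Q)) (\<lambda>_. 0) p j \<longleftrightarrow>
    (\<forall>a b. int (mdeg a) = j \<longrightarrow> b + p = card (keys a) \<longrightarrow>
      acyclic_at (twist (keys a)) (degree_family Q a) b)"
proof (intro iffI allI impI)
  assume KV: "koszul_vanishes (embed (monomial_ideal Q)) (\<lambda>_. 0) p j"
  fix a :: "'v \<Rightarrow>\<^sub>0 nat" and b assume a: "int (mdeg a) = j" "b + p = card (keys a)"
  show "acyclic_at (twist (keys a)) (degree_family Q a) b"
  proof (rule koszul_exact_imp_acyclic[OF up a])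
    fix c assume c: "koszul_chain Q p j c" and cycle: "\<And>\<tau>. kb c \<tau> = 0"
    let ?c = "\<lambda>\<sigma> k. if k = (0::nat) then c \<sigma> else 0"
    have ch: "vchain (embed (monomial_ideal Q)) (\<lambda>_. 0) p j ?c"
      unfolding vchain_def
    proof (intro allI conjI impI)
      fix \<sigma>
      show "?c \<sigma> \<in> embed (monomial_ideal Q)" "vhom (\<lambda>_. 0) (j - int (card \<sigma>)) (?c \<sigma>)"
        using c by (simp_all add: embed_def monomial_ideal_def vhom_def koszul_chain_def)
      assume "card \<sigma> \<noteq> p"
      then have "c \<sigma> = 0" using c unfolding koszul_chain_def by metis
      then show "?c \<sigma> = (\<lambda>_. 0)" by auto
    qed
    have "vkb ?c \<tau> = (\<lambda>_. 0)" for \<tau>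
    proof
      fix k
      show "vkb ?c \<tau> k = 0" using cycle[of \<tau>] by (cases "k = 0") (simp_all add: vkb_def)
    qed
    from koszul_vanishesE[OF KV ch this] obtain g
      where g: "vchain (embed (monomial_ideal Q)) (\<lambda>_. 0) (Suc p) j g" "\<And>\<tau>. ?c \<tau> = vkb g \<tau>"
      by blast
    have "koszul_chain Q (Suc p) j (\<lambda>\<sigma>. g \<sigma> 0)"
      unfolding koszul_chain_def
    proof (intro allI conjI impI)
      fix \<sigma>
      have g': "g \<sigma> \<in> embed (monomial_ideal Q)" "vhom (\<lambda>_. 0) (j - int (card \<sigma>)) (g \<sigma>)"
        "card \<sigma> \<noteq> Suc p \<longrightarrow> g \<sigma> = (\<lambda>_. 0)"
        using g(1) unfolding vchain_def by simp_all
      show "keys (g \<sigma> 0) \<subseteq> Q" using g'(1) by (simp add: embed_def monomial_ideal_def)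
      have "homogeneous (j - int (card \<sigma>) - 0) (g \<sigma> 0)" using g'(2) unfolding vhom_def by (rule spec)
      then show "homogeneous (j - int (card \<sigma>)) (g \<sigma> 0)" by simp
      show "card \<sigma> = Suc p" if "g \<sigma> 0 \<noteq> 0" using g'(3) that by auto
    qed
    moreover have "c \<tau> = kb (\<lambda>\<sigma>. g \<sigma> 0) \<tau>" for \<tau>
      using fun_cong[OF g(2)[of \<tau>], of 0] by (simp add: vkb_def)
    ultimately show "\<exists>c'. koszul_chain Q (Suc p) j c' \<and> (\<forall>\<tau>. c \<tau> = kb c' \<tau>)" by blast
  qed
next
  assume acyc: "\<forall>a b. int (mdeg a) = j \<longrightarrow> b + p = card (keys a) \<longrightarrow>
      acyclic_at (twist (keys a)) (degree_family Q a) b"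
  show "koszul_vanishes (embed (monomial_ideal Q)) (\<lambda>_. 0) p j"
    unfolding koszul_vanishes_def
  proof (intro allI impI)
    fix c assume c: "vchain (embed (monomial_ideal Q)) (\<lambda>_. 0) p j c" and cycle: "\<forall>\<tau>. vkb c \<tau> = (\<lambda>_. 0)"
    have c': "c \<sigma> \<in> embed (monomial_ideal Q) \<and> vhom (\<lambda>_. 0) (j - int (card \<sigma>)) (c \<sigma>) \<and>
        (card \<sigma> \<noteq> p \<longrightarrow> c \<sigma> = (\<lambda>_. 0))" for \<sigma>
      using c unfolding vchain_def by (rule spec)
    have "koszul_chain Q p j (\<lambda>\<sigma>. c \<sigma> 0)"
      unfolding koszul_chain_def
    proof (intro allI conjI impI)
      fix \<sigma>
      show "keys (c \<sigma> 0) \<subseteq> Q" using c'[of \<sigma>] by (simp add: embed_def monomial_ideal_def)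
      show "homogeneous (j - int (card \<sigma>)) (c \<sigma> 0)" using c'[of \<sigma>] by (simp add: vhom_def)
      show "card \<sigma> = p" if "c \<sigma> 0 \<noteq> 0" using c'[of \<sigma>] that by auto
    qed
    moreover have "kb (\<lambda>\<sigma>. c \<sigma> 0) \<tau> = 0" for \<tau>
      using fun_cong[OF spec[OF cycle, of \<tau>], of 0] by (simp add: vkb_def)
    ultimately have "\<exists>e. koszul_chain Q (Suc p) j e \<and> (\<forall>\<tau>. c \<tau> 0 = kb e \<tau>)"
      using acyc by (intro koszul_exact[OF up]) auto
    then obtain e where e: "koszul_chain Q (Suc p) j e" "\<And>\<tau>. c \<tau> 0 = kb e \<tau>" by blast
    let ?e = "\<lambda>\<sigma> k. if k = (0::nat) then e \<sigma> else 0"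
    have "vchain (embed (monomial_ideal Q)) (\<lambda>_. 0) (Suc p) j ?e"
      unfolding vchain_def
    proof (intro allI conjI impI)
      fix \<sigma>
      show "?e \<sigma> \<in> embed (monomial_ideal Q)" "vhom (\<lambda>_. 0) (j - int (card \<sigma>)) (?e \<sigma>)"
        using e(1) by (simp_all add: embed_def monomial_ideal_def vhom_def koszul_chain_def)
      assume "card \<sigma> \<noteq> Suc p"
      then have "e \<sigma> = 0" using e(1) unfolding koszul_chain_def by metis
      then show "?e \<sigma> = (\<lambda>_. 0)" by auto
    qed
    moreover have "c \<tau> = vkb ?e \<tau>" for \<tau>
    proof
      fix k
      show "c \<tau> k = vkb ?e \<tau> k"
        using e(2)[of \<tau>] c'[of \<tau>] by (cases "k = 0") (simp_all add: vkb_def embed_def)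
    qed
    ultimately show "\<exists>c'. vchain (embed (monomial_ideal Q)) (\<lambda>_. 0) (Suc p) j c' \<and> (\<forall>\<tau>. c \<tau> = vkb c' \<tau>)"
      by blast
  qed
qed

text \<open>Minimal covers are iterated on their kernels. The bound \<open>N\<close> serves for all
  \<open>p\<close> at once, so it passes to the kernels under the shift of homological degree and
  keeps all of them finitely generated.\<close>

lemma exists_minimal_resolution:
  assumes up: "up_closed Q"
    and N: "\<And>p j. N < j \<Longrightarrow> koszul_vanishes (embed (monomial_ideal Q)) (\<lambda>_. 0) p j"
  shows "\<exists>F. minimal_graded_free_resolution (*) (monomial_ideal Q :: ('v, 'k) mpoly set)
    (\<lambda>j. {f \<in> monomial_ideal Q. homogeneous j f}) F"
proof -
  define ok where "ok = (\<lambda>(r, deg, D :: nat \<Rightarrow> nat \<Rightarrow> ('v, 'k) mpoly, K :: (nat \<Rightarrow> ('v, 'k) mpoly) set).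
    graded_submodule deg K \<and> K \<subseteq> vectors r \<and> (\<forall>p j. N < j \<longrightarrow> koszul_vanishes K deg p j))"
  define step where "step = (\<lambda>(r0 :: nat, deg0, D0 :: nat \<Rightarrow> nat \<Rightarrow> ('v, 'k) mpoly, K0 :: (nat \<Rightarrow> ('v, 'k) mpoly) set) (r, deg, D, K).
    graded_matrix r deg deg0 D \<and> lin r D ` vectors r = K0 \<and> K = lin_kernel r D \<and> minimal_kernel K)"
  let ?I = "monomial_ideal Q :: ('v, 'k) mpoly set"
  let ?x0 = "(1, (\<lambda>_. 0), (\<lambda>_ _. 0), embed ?I)"
  have ok0: "ok ?x0"
    using graded_submodule_embed[OF up] N by (auto simp: ok_def embed_def vectors_def)
  have "\<exists>y. ok y \<and> step x y" if x: "ok x" for x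
  proof -
    obtain r0 deg0 D0 K0 where xe: "x = (r0, deg0, D0, K0)" by (cases x)
    have K0: "graded_submodule deg0 K0" "K0 \<subseteq> vectors r0" "\<And>p j. N < j \<Longrightarrow> koszul_vanishes K0 deg0 p j"
      using x by (simp_all add: ok_def xe)
    have "\<exists>r deg D. graded_matrix r deg deg0 D \<and> lin r D ` vectors r = K0 \<and> minimal_kernel (lin_kernel r D)"
      by (rule exists_minimal_cover[OF K0])
    then obtain r deg D where D: "graded_matrix r deg deg0 D" "lin r D ` vectors r = K0" "minimal_kernel (lin_kernel r D)"
      by (elim exE conjE)
    have "koszul_vanishes (lin_kernel r D) deg p j" if "N < j" for p j
      using koszul_vanishes_shift[OF D(1,3)] K0(3)[OF that] D(2) by simp
    moreover have "lin_kernel r D \<subseteq> vectors r" by (auto simp: lin_kernel_def)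
    ultimately have "ok (r, deg, D, lin_kernel r D)"
      using graded_submodule_lin_kernel[OF D(1)] by (simp add: ok_def)
    moreover have "step x (r, deg, D, lin_kernel r D)" using D by (simp add: step_def xe)
    ultimately show ?thesis by blast
  qed
  then have "\<exists>f. \<forall>n. (ok (f n) \<and> (n = 0 \<longrightarrow> f n = ?x0)) \<and> step (f n) (f (Suc n))"
    using ok0 by (intro dependent_nat_choice) auto
  then obtain f where f: "\<And>n. ok (f n)" "f 0 = ?x0" "\<And>n. step (f n) (f (Suc n))" by blast
  define R where "R n = fst (f n)" for n
  define dg where "dg n = fst (snd (f n))" for n
  define D where "D n = fst (snd (snd (f n)))" for n
  define K where "K n = snd (snd (snd (f n)))" for n
  have f_eq: "f n = (R n, dg n, D n, K n)" for n by (simp add: R_def dg_def D_def K_def)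
  have K0: "K 0 = embed ?I" "dg 0 = (\<lambda>_. 0)" using f(2) by (simp_all add: K_def dg_def)
  have gm: "graded_matrix (R (Suc n)) (dg (Suc n)) (dg n) (D (Suc n))"
    and im: "lin (R (Suc n)) (D (Suc n)) ` vectors (R (Suc n)) = K n"
    and ker: "K (Suc n) = lin_kernel (R (Suc n)) (D (Suc n))"
    and min: "minimal_kernel (K (Suc n))" for n
  proof -
    have "graded_matrix (R (Suc n)) (dg (Suc n)) (dg n) (D (Suc n)) \<and>
        lin (R (Suc n)) (D (Suc n)) ` vectors (R (Suc n)) = K n \<and>
        K (Suc n) = lin_kernel (R (Suc n)) (D (Suc n)) \<and> minimal_kernel (K (Suc n))"
      using f(3)[of n] unfolding step_def f_eq prod.case .
    then show "graded_matrix (R (Suc n)) (dg (Suc n)) (dg n) (D (Suc n))"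
      "lin (R (Suc n)) (D (Suc n)) ` vectors (R (Suc n)) = K n"
      "K (Suc n) = lin_kernel (R (Suc n)) (D (Suc n))" "minimal_kernel (K (Suc n))"
      by - (elim conjE, assumption)+
  qed
  have KR: "K n \<subseteq> vectors (R n)" for n using f(1)[of n] by (simp add: ok_def f_eq)
  have row: "D (Suc n) k \<in> K n" if "k < R (Suc n)" for n k
    using that unfolding im[symmetric] span_eq_lin_image[symmetric] by (intro vec.span_base) simp
  \<comment> \<open>Position 0 of the sequence holds the ideal within rank 1, so the free module in
    homological degree \<open>i\<close> is stored at \<open>Suc i\<close>, and the first matrix
    becomes the augmentation.\<close>
  define F :: "(('v, 'k) mpoly, ('v, 'k) mpoly) free_complex" where
    "F = \<lparr>basis_size = \<lambda>i. R (Suc i), basis_deg = \<lambda>i. dg (Suc i),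
      diff_mat = \<lambda>i. D (Suc (Suc i)), aug = \<lambda>k. D 1 k 0\<rparr>"
  have F [simp]: "basis_size F = (\<lambda>i. R (Suc i))" "basis_deg F = (\<lambda>i. dg (Suc i))"
    "diff_mat F = (\<lambda>i. D (Suc (Suc i)))" "aug F = (\<lambda>k. D 1 k 0)" by (simp_all add: F_def)
  \<comment> \<open>\<open>diff_map\<close> cuts off at the rank of the target and
    \<open>lin\<close> does not; they agree because the rows lie in a kernel within
    \<open>vectors\<close>.\<close>
  have diff: "diff_map F i g = lin (R (Suc (Suc i))) (D (Suc (Suc i))) g" for i g
  proof
    fix l
    have "D (Suc (Suc i)) k l = 0" if "k < R (Suc (Suc i))" "R (Suc i) \<le> l" for k
      using row[OF that(1)] KR[of "Suc i"] that(2) by (auto simp: vectors_def)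
    then show "diff_map F i g l = lin (R (Suc (Suc i))) (D (Suc (Suc i))) g l"
      by (simp add: diff_map_def lin_def)
  qed
  have aug: "aug_map (*) F g = lin (R 1) (D 1) g 0" for g by (simp add: aug_map_def lin_def)
  have lin1: "lin (R 1) (D 1) ` vectors (R 1) = embed ?I" using im[of 0] K0 by simp
  have ker1: "{g \<in> vectors (R 1). lin (R 1) (D 1) g 0 = 0} = K 1"
  proof -
    have "lin (R 1) (D 1) g = (\<lambda>_. 0) \<longleftrightarrow> lin (R 1) (D 1) g 0 = 0" if "g \<in> vectors (R 1)" for g
    proof -
      have e: "lin (R 1) (D 1) g \<in> embed ?I" using lin1 that by blast
      show ?thesis
      proof
        assume z: "lin (R 1) (D 1) g 0 = 0"
        show "lin (R 1) (D 1) g = (\<lambda>_. 0)"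
        proof
          fix k
          show "lin (R 1) (D 1) g k = 0" using e z by (cases "k = 0") (simp_all add: embed_def)
        qed
      qed simp
    qed
    then show ?thesis using ker[of 0] by (auto simp: lin_kernel_def)
  qed
  have "graded_free_resolution (*) ?I (\<lambda>j. {f \<in> ?I. homogeneous j f}) F"
    unfolding graded_free_resolution_def free_module_eq_vectors
  proof (intro conjI allI impI)
    fix k assume k: "k < basis_size F 0"
    have "D 1 k \<in> embed ?I" using row[of k 0] K0 k by simp
    moreover have "vhom (\<lambda>_. 0) (dg 1 k) (D 1 k)" using gm[of 0] K0 k by (simp add: graded_matrix_def)
    then have "homogeneous (dg 1 k - 0) (D 1 k 0)" unfolding vhom_def by (rule spec)
    ultimately show "aug F k \<in> {f \<in> ?I. homogeneous (basis_deg F 0 k) f}" by (simp add: embed_def)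
  next
    fix i k l assume "k < basis_size F (Suc i)" "l < basis_size F i"
    then show "homogeneous (basis_deg F (Suc i) k - basis_deg F i l) (diff_mat F i k l)"
      using gm[of "Suc i"] by (simp add: graded_matrix_def vhom_def)
  next
    have "aug_map (*) F ` vectors (basis_size F 0) = (\<lambda>g. g 0) ` embed ?I"
      unfolding lin1[symmetric] image_image aug by simp
    also have "\<dots> = ?I"
    proof (intro subset_antisym subsetI)
      fix x assume "x \<in> ?I"
      then show "x \<in> (\<lambda>g. g 0) ` embed ?I"
        by (intro image_eqI[of _ _ "\<lambda>k. if k = 0 then x else 0"]) (simp_all add: embed_def)
    qed (auto simp: embed_def)
    finally show "aug_map (*) F ` vectors (basis_size F 0) = ?I" .
  next
    show "diff_map F 0 ` vectors (basis_size F 1) = {f \<in> vectors (basis_size F 0). aug_map (*) F f = 0}"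
      using im[of 1] ker1 by (simp add: diff aug)
  next
    fix i
    show "diff_map F (Suc i) ` vectors (basis_size F (Suc (Suc i))) =
        {f \<in> vectors (basis_size F (Suc i)). diff_map F i f = (\<lambda>_. 0)}"
      using im[of "Suc (Suc i)"] ker[of "Suc i"] by (simp add: diff lin_kernel_def)
  qed
  moreover have "diff_mat F i k l \<in> ideal_gen (range var)" if "k < basis_size F (Suc i)" for i k l
    using row[of k "Suc i"] min[of i] that by (simp add: ideal_vars minimal_kernel_def)
  ultimately show ?thesis unfolding minimal_graded_free_resolution_def by blast
qed

text \<open>The right-hand side does not mention \<open>F\<close>, so all minimal resolutions have
  basis elements in the same degrees. Shifting along the successive kernels reduces homological
  degree \<open>i\<close> to degree 0, where the basis degrees show directly.\<close>

lemma basis_deg_iff_koszul: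
  fixes F :: "(('v, 'k) mpoly, ('v, 'k) mpoly) free_complex"
  assumes F: "minimal_graded_free_resolution (*) I (\<lambda>j. {f \<in> I. homogeneous j f}) F"
  shows "(\<exists>k<basis_size F i. basis_deg F i k = j) \<longleftrightarrow> \<not> koszul_vanishes (embed I) (\<lambda>_. 0) i j"
proof -
  let ?r = "basis_size F" and ?dg = "basis_deg F"
  \<comment> \<open>The augmentation becomes a matrix with a single column. Entries of
    \<open>F\<close> beyond the ranks are arbitrary and are replaced by 0, because
    \<open>lin\<close> evaluates all columns.\<close>
  define A where "A k l = (if l = 0 then aug F k else 0)" for k and l :: nat
  define D where "D i k l = (if l < ?r i then diff_mat F i k l else 0)" for i k l
  have res: "\<And>k. k < ?r 0 \<Longrightarrow> aug F k \<in> {f \<in> I. homogeneous (?dg 0 k) f}"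
    "\<And>i k l. k < ?r (Suc i) \<Longrightarrow> l < ?r i \<Longrightarrow> homogeneous (?dg (Suc i) k - ?dg i l) (diff_mat F i k l)"
    "aug_map (*) F ` vectors (?r 0) = I"
    "diff_map F 0 ` vectors (?r 1) = {f \<in> vectors (?r 0). aug_map (*) F f = 0}"
    "\<And>i. diff_map F (Suc i) ` vectors (?r (Suc (Suc i))) =
      {f \<in> vectors (?r (Suc i)). diff_map F i f = (\<lambda>_. 0)}"
    "\<And>i k l. k < ?r (Suc i) \<Longrightarrow> l < ?r i \<Longrightarrow> lookup (diff_mat F i k l) 0 = 0"
    using F unfolding minimal_graded_free_resolution_def graded_free_resolution_def
      free_module_eq_vectors ideal_vars by simp_all
  have linA: "lin (?r 0) A f = (\<lambda>l. if l = 0 then aug_map (*) F f else 0)" for f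
    by (auto simp: lin_def A_def aug_map_def fun_eq_iff)
  have linD: "lin (?r (Suc i)) (D i) f = diff_map F i f" for i f
    by (auto simp: lin_def D_def diff_map_def fun_eq_iff)
  have gmA: "graded_matrix (?r 0) (?dg 0) (\<lambda>_. 0) A"
    using res(1) by (simp add: graded_matrix_def vhom_def A_def)
  have gmD: "graded_matrix (?r (Suc i)) (?dg (Suc i)) (?dg i) (D i)" for i
    using res(2) by (simp add: graded_matrix_def vhom_def D_def)
  have imA: "lin (?r 0) A ` vectors (?r 0) = embed I"
  proof (intro subset_antisym subsetI)
    fix x assume "x \<in> embed I"
    then have x: "x 0 \<in> I" "\<And>k. k \<noteq> 0 \<Longrightarrow> x k = 0" by (auto simp: embed_def)
    then obtain f where f: "f \<in> vectors (?r 0)" "aug_map (*) F f = x 0" using res(3) by (metis imageE)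
    have "x = lin (?r 0) A f" unfolding linA using f x by (auto simp: fun_eq_iff)
    then show "x \<in> lin (?r 0) A ` vectors (?r 0)" using f by (intro image_eqI)
  next
    fix x assume "x \<in> lin (?r 0) A ` vectors (?r 0)"
    then show "x \<in> embed I" using res(3) by (auto simp: embed_def linA)
  qed
  have kerA: "lin_kernel (?r 0) A = lin (?r 1) (D 0) ` vectors (?r 1)"
  proof -
    have "lin (?r 0) A f = (\<lambda>_. 0) \<longleftrightarrow> aug_map (*) F f = 0" for f
      by (auto simp: linA fun_eq_iff)
    then show ?thesis using res(4) linD[of 0] by (simp add: lin_kernel_def)
  qed
  have kerD: "lin_kernel (?r (Suc i)) (D i) = lin (?r (Suc (Suc i))) (D (Suc i)) ` vectors (?r (Suc (Suc i)))" for i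
    using res(5)[of i] by (simp add: linD lin_kernel_def)
  have min: "minimal_kernel (lin (?r (Suc i)) (D i) ` vectors (?r (Suc i)))" for i
  proof -
    have "lookup (D i k l) 0 = 0" if "k < ?r (Suc i)" for k l using res(6) that by (simp add: D_def)
    then show ?thesis by (auto simp: minimal_kernel_def lin_def lookup_sum lookup_mult_0)
  qed
  have minA: "minimal_kernel (lin_kernel (?r 0) A)" and minD: "\<And>i. minimal_kernel (lin_kernel (?r (Suc i)) (D i))"
    using min[of 0] min by (simp_all add: kerA kerD)
  have shift: "koszul_vanishes (lin (?r (Suc i)) (D i) ` vectors (?r (Suc i))) (?dg i) p j \<longleftrightarrow>
      koszul_vanishes (embed I) (\<lambda>_. 0) (Suc i + p) j" for i p
  proof (induction i arbitrary: p)
    case 0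
    show ?case using koszul_vanishes_shift[OF gmA minA, of p j] by (simp add: imA kerA)
  next
    case (Suc i)
    show ?case using koszul_vanishes_shift[OF gmD minD, of i p j] Suc.IH[of "Suc p"] by (simp add: kerD)
  qed
  show ?thesis
  proof (cases i)
    case 0
    then show ?thesis using koszul_vanishes_0_iff[OF gmA minA, of j] by (auto simp: imA)
  next
    case (Suc i')
    then show ?thesis using koszul_vanishes_0_iff[OF gmD minD, of i' j] shift[of i' 0] by auto
  qed
qed

end

theorem theorem4p3:
  fixes E :: "'v::finite set set" and s :: nat
  assumes "simple_graph E"
    and "cameron_walker E"
    and "1 \<le> s"
    and "s \<le> matching_number E"
  shows "ideal_regularity (squarefree_power (edge_ideal E :: ('v, 'k::field) mpoly set) s)
           = int (matching_number E) + int s"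
proof -
  obtain M where M: "induced_matching E M" "card M = matching_number E"
  proof -
    have "induced_matching E {}" by (simp add: induced_matching_def matching_def)
    then have "induced_matching_number E \<in> card ` {M. induced_matching E M}"
      unfolding induced_matching_number_def by (intro Max_in) auto
    then show ?thesis using that assms(2) by (auto simp: cameron_walker_def)
  qed
  interpret maximum_induced_matching E M using assms(1) M by unfold_locales
  obtain sg :: "'v \<Rightarrow> 'v set \<Rightarrow> 'k" where sg: "sign_function sg"
    "\<And>A B v. B \<subseteq> A \<Longrightarrow> sg v (insert v (A - B)) = sg v A * sg v B"
    using sign_function_exists by metis
  interpret koszul sg using sg by unfold_locales
  define Q where "Q = matching_exponents E s"
  have up: "up_closed Q" unfolding Q_def by (rule up_closed_matching_exponents)
  let ?I = "monomial_ideal Q :: ('v, 'k) mpoly set"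
  let ?KV = "koszul_vanishes (embed ?I) (\<lambda>_. 0)"
  \<comment> \<open>A vertex with exponent at least 2 would be a cone point of the family.\<close>
  have sqfree: "keys a = {v. lookup a v = 1} \<and> int (card (keys a)) = j"
    if "\<not> acyclic_at (twist (keys a)) (degree_family Q a) b" "int (mdeg a) = j" for a b j
  proof -
    have le: "lookup a v \<le> 1" for v
    proof (rule ccontr)
      assume v: "\<not> lookup a v \<le> 1"
      then have "insert v B \<union> {v. 2 \<le> lookup a v} = B \<union> {v. 2 \<le> lookup a v}"
        "B - {v} \<union> {v. 2 \<le> lookup a v} = B \<union> {v. 2 \<le> lookup a v}" for B by auto
      moreover have "v \<in> keys a" using v by (simp add: in_keys_iff)
      ultimately have "acyclic_at (twist (keys a)) (degree_family Q a) b"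
        unfolding Q_def degree_family_matching_exponents
        by (intro acyclic_at_cone[OF sign_function_twist, where v = v]) auto
      then show False using that(1) by simp
    qed
    have "lookup a v = (if v \<in> keys a then 1 else 0)" for v
      using le[of v] by (auto simp: in_keys_iff)
    then have "a = expo (keys a)" by (intro poly_mapping_eqI) simp
    then have "mdeg a = card (keys a)" by (metis mdeg_expo)
    moreover have "keys a = {v. lookup a v = 1}"
      using le by (auto simp: in_keys_iff le_Suc_eq)
    ultimately show ?thesis using that(2) by simp
  qed
  have squarefree_family: "degree_family Q a = {B. B \<subseteq> keys a \<and> has_matching E s B}"
    if "keys a = {v. lookup a v = 1}" for a
  proof -
    have "{v. 2 \<le> lookup a v} = {}"
    proof (rule ccontr)
      assume "{v. 2 \<le> lookup a v} \<noteq> {}"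
      then obtain v where "2 \<le> lookup a v" by blast
      moreover then have "v \<in> keys a" by (auto simp: in_keys_iff)
      ultimately show False using that by auto
    qed
    then show ?thesis unfolding Q_def degree_family_matching_exponents by simp
  qed
  \<comment> \<open>Nonvanishing requires a squarefree multidegree, where
    \<open>j = card (keys a) = b + p\<close>; the bound on \<open>b\<close> is thus one on
    \<open>j - p\<close>. The bounds on \<open>j\<close> and \<open>p\<close> separately give finite
    generation of the syzygies and finiteness of the set under the maximum.\<close>
  have vanish: "j \<le> int (card (UNIV :: 'v set)) \<and> p \<le> card (UNIV :: 'v set) \<and> j - int p \<le> int (matching_number E) + int s \<and> 0 \<le> j"
    if "\<not> ?KV p j" for p j
  proof -
    obtain a b where a: "int (mdeg a) = j" "b + p = card (keys a)"
      and na: "\<not> acyclic_at (twist (keys a)) (degree_family Q a) b"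
      using \<open>\<not> ?KV p j\<close> koszul_vanishes_embed[OF up] by blast
    have sq: "keys a = {v. lookup a v = 1}" "int (card (keys a)) = j" using sqfree[OF na a(1)] by auto
    have "\<not> card M + s < b"
      using na acyclic_at_has_matching[OF sign_function_twist] unfolding squarefree_family[OF sq(1)] by blast
    moreover have "card (keys a) \<le> card (UNIV :: 'v set)" by (intro card_mono) auto
    ultimately show ?thesis using a sq M by linarith
  qed
  have "\<exists>F. minimal_graded_free_resolution (*) ?I (\<lambda>j. {f \<in> ?I. homogeneous j f}) F"
    by (rule exists_minimal_resolution[OF up, of "int (card (UNIV :: 'v set))"]) (use vanish in force)
  then have F: "minimal_graded_free_resolution (*) ?I (\<lambda>j. {f \<in> ?I. homogeneous j f})
      (SOME F. minimal_graded_free_resolution (*) ?I (\<lambda>j. {f \<in> ?I. homogeneous j f}) F)"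
    by (rule someI_ex)
  have betti: "graded_betti (*) ?I (\<lambda>j. {f \<in> ?I. homogeneous j f}) i j \<noteq> 0 \<longleftrightarrow> \<not> ?KV i j" for i j
    unfolding graded_betti_def Let_def basis_deg_iff_koszul[OF F, symmetric] by (auto simp: card_eq_0_iff)
  let ?X = "{j - int i |i j. graded_betti (*) ?I (\<lambda>j. {f \<in> ?I. homogeneous j f}) i j \<noteq> 0}"
  have "?X \<subseteq> (\<lambda>(i, j). j - int i) ` ({..card (UNIV :: 'v set)} \<times> {0..int (card (UNIV :: 'v set))})"
  proof
    fix x assume "x \<in> ?X"
    then obtain i j where "x = j - int i" "\<not> ?KV i j" unfolding betti by blast
    then show "x \<in> (\<lambda>(i, j). j - int i) ` ({..card (UNIV :: 'v set)} \<times> {0..int (card (UNIV :: 'v set))})"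
      using vanish[of i j] by (intro image_eqI[of _ _ "(i, j)"]) auto
  qed
  then have "finite ?X" by (rule finite_subset) auto
  moreover have "x \<le> int (matching_number E) + int s" if "x \<in> ?X" for x
    using that vanish unfolding betti by blast
  moreover have "int (matching_number E) + int s \<in> ?X"
  proof -
    have disj: "pairwise disjnt M" using M_matching by (simp add: matching_def)
    have "card (\<Union>M) = (\<Sum>e\<in>M. card e)" by (rule card_Union_disjoint[OF disj]) simp
    also have "\<dots> = (\<Sum>e\<in>M. 2)" using M_edges assms(1) by (intro sum.cong) (auto simp: simple_graph_def)
    finally have card_UM: "card (\<Union>M) = 2 * card M" by simp
    define a where "a = expo (\<Union>M)"
    have ka: "keys a = \<Union>M" by (simp add: a_def keys_expo)
    have "degree_family Q a = {B. B \<subseteq> \<Union>M \<and> has_matching E s B}"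
    proof -
      have "keys a = {v. lookup a v = 1}" unfolding ka by (auto simp: a_def)
      then show ?thesis using squarefree_family[of a] by (simp only: ka)
    qed
    then have na: "\<not> acyclic_at (twist (keys a)) (degree_family Q a) (card M + s)"
      using not_acyclic_at_has_matching[OF sign_function_twist[of "keys a"]] assms M by simp
    \<comment> \<open>The nonzero class lives in size m + s on 2m vertices, hence in homological
      degree m - s and internal degree 2m, whose difference is m + s.\<close>
    have "card M + s + (card M - s) = card (keys a)" using assms M by (simp add: ka card_UM)
    moreover have "int (mdeg a) = int (2 * card M)" by (simp add: a_def mdeg_expo card_UM)
    ultimately have "\<not> ?KV (card M - s) (int (2 * card M))"
      using na koszul_vanishes_embed[OF up] by blast
    moreover have "int (matching_number E) + int s = int (2 * card M) - int (card M - s)"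
      using assms M by simp
    ultimately show ?thesis unfolding betti by blast
  qed
  ultimately have "Max ?X = int (matching_number E) + int s" by (intro Max_eqI)
  then show ?thesis
    unfolding ideal_regularity_def regularity_def squarefree_power_eq[OF assms(1)] Q_def .
qed

end
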